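(* Let $G$ be a finitely generated group with polynomial growth, with word length $\ell$ coming from a finite symmetric generating set. Then there exists a positive integer $s$ such that the compact quantum metric spaces $(P_{\Lambda}\mathbb{C}[G]P_{\Lambda},L_{s,\Lambda})$ converge to the compact quantum metric space $(\mathbb{C}[G],L_s)$ in quantum Gromov-Hausdorff distance as $\Lambda\to\infty$, i.e. $$\mathrm{dist}_q\big((\mathbb{C}[G],L_s),(P_{\Lambda}\mathbb{C}[G]P_{\Lambda},L_{s,\Lambda})\big)\longrightarrow 0\quad\text{as }\Lambda\to\infty.$$
   Context: Group notation. $G$ is a discrete group generated by a finite symmetric set $S=S^{-1}$; $\ell:G\to\mathbb{R}_+$ is the word length, $d(x,y)=\ell(x^{-1}y)$, $B_\Lambda(x)$ is the closed ball of radius $\Lambda>0$ centered at $x$ and $B_\Lambda=B_\Lambda(e)$. $G$ has polynomial growth if there are $C,k>0$ with $\#B_n\le Cn^k$ for all integers $n\ge 1$. $\lambda$ is the left regular representation of the group algebra $\mathbb{C}[G]$ on $\ell^2(G)$; $\mathbb{C}[G]$ is identified with $\lambda(\mathbb{C}[G])\subset B(\ell^2(G))$. $P_\Lambda$ is the orthogonal projection of $\ell^2(G)$ onto $\ell^2(B_\Lambda)$ (equivalently, the spectral projection onto $[-\Lambda,\Lambda]$ of $D:\delta_x\mapsto \ell(x)\delta_x$). $P_\Lambda\mathbb{C}[G]P_\Lambda=\{P_\Lambda\lambda(f)P_\Lambda: f\in\mathbb{C}[G]\}\subset B(P_\Lambda\ell^2(G))$, i.e. the space of matrices of the form $(a_{xy^{-1}})_{x,y\in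 B_\Lambda}$. Seminorms. $d:\mathbb{C}[G]\to\mathbb{C}[G]$, $\sum f(x)\delta_x\mapsto\sum\ell(x)f(x)\delta_x$, and $d_\Lambda:P_\Lambda\mathbb{C}[G]P_\Lambda\to P_\Lambda\mathbb{C}[G]P_\Lambda$, $(a_{xy^{-1}})_{x,y\in B_\Lambda}\mapsto(\ell(xy^{-1})a_{xy^{-1}})_{x,y\in B_\Lambda}$. For a positive integer $s$: $L_s(f)=\|\lambda(d^sf)\|_{B(\ell^2(G))}$ and $L_{s,\Lambda}(T)=\|d_\Lambda^sT\|_{B(P_\Lambda\ell^2(G))}$. Compact quantum metric spaces. An operator system is a unital self-adjoint subspace of some $B(H)$ (not necessarily norm closed). A seminorm $L$ (possibly taking the value $\infty$) on an operator system $A$ with unit $e$ is a Lip-norm if: (i) $L(a)=L(a^* )$ for all $a$, and $L(a)=0$ iff $a\in\mathbb{C}e$; (ii) $\{a\in A: L(a)<\infty\}$ is dense in $A$; (iii) the distance $d^L(\phi,\psi)=\sup\{|\phi(a)-\psi(a)|:a\in A,\ L(a)\le1\}$ on the state space $S(A)$ induces the weak-$*$ topology; (iv) $L$ is lower semicontinuous for the operator norm. Then $(A,L)$ is called a compact quantum metric space. Quantum Gromov-Hausdorff distance. For compact quantum metric spaces $(A,L_A)$, $(B,L_B)$, let $q_A,q_B$ be the coordinate projections of $A\oplus B$ onto $A$, $B$; pullback embeds $S(A)$ and $S(B)$ into $S(A\oplus B)$. A Lip-norm $L$ on $A\oplus B$ induces the seminorms $a\mapsto\inf\{L(a,b):b\in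 B\}$ on $A$ and $b\mapsto\inf\{L(a,b):a\in A\}$ on $B$. Let $\mathcal{M}(L_A,L_B)$ be the set of Lip-norms on $A\oplus B$ inducing $L_A$ and $L_B$. Then $\mathrm{dist}_q((A,L_A),(B,L_B))=\inf\{\mathrm{dist}_H^{d^L}(q_A^*S(A),q_B^*S(B)):L\in\mathcal{M}(L_A,L_B)\}$, where $\mathrm{dist}_H^{d^L}$ is the Hausdorff distance in $(S(A\oplus B),d^L)$. *)

theory Defs
  imports "HOL-Analysis.Analysis" "HOL-Algebra.Generated_Groups"
begin

section \<open>Complex Hilbert spaces and bounded operators\<close>

text \<open>
  Complex Hilbert spaces are real Hilbert spaces with a compatible complex structure.
  The inner product \<open>cinner\<close> is linear in its first argument.
\<close>

class scaleC =
  fixes scaleC :: "complex \<Rightarrow> 'a \<Rightarrow> 'a"  (infixr \<open>*\<^sub>C\<close> 75)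

class complex_hilbert_space = real_inner + complete_space + scaleC +
  fixes cinner :: "'a \<Rightarrow> 'a \<Rightarrow> complex"
  assumes scaleC_add_right: "c *\<^sub>C (x + y) = c *\<^sub>C x + c *\<^sub>C y"
    and scaleC_add_left: "(c + d) *\<^sub>C x = c *\<^sub>C x + d *\<^sub>C x"
    and scaleC_scaleC: "c *\<^sub>C d *\<^sub>C x = (c * d) *\<^sub>C x"
    and scaleR_scaleC: "r *\<^sub>R x = complex_of_real r *\<^sub>C x"
    and cinner_commute: "cinner x y = cnj (cinner y x)"
    and cinner_add_left: "cinner (x + y) z = cinner x z + cinner y z"
    and cinner_scaleC_left: "cinner (c *\<^sub>C x) y = c * cinner x y"
    and inner_eq_Re_cinner: "inner x y = Re (cinner x y)"

lemma cinner_self: "cinner x x = complex_of_real ((norm x)\<^sup>2)"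
proof (rule complex_eqI)
  have "Im (cinner x x) = Im (cnj (cinner x x))" using cinner_commute[of x x] by simp
  then show "Im (cinner x x) = Im (complex_of_real ((norm x)\<^sup>2))" by simp
qed (simp add: inner_eq_Re_cinner[symmetric] power2_norm_eq_inner)

lemma norm_scaleC: "norm (c *\<^sub>C x) = cmod c * norm (x :: 'a :: complex_hilbert_space)"
proof -
  have "cinner (c *\<^sub>C x) (c *\<^sub>C x) = c * cnj c * cinner x x"
    by (simp add: cinner_scaleC_left cinner_commute[of x "c *\<^sub>C x"] cinner_commute[of x x, symmetric])
  then have "complex_of_real ((norm (c *\<^sub>C x))\<^sup>2) = complex_of_real ((cmod c * norm x)\<^sup>2)"
    by (simp only: cinner_self complex_norm_square[symmetric] power_mult_distrib of_real_mult)
  then have "(norm (c *\<^sub>C x))\<^sup>2 = (cmod c * norm x)\<^sup>2"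
    by (simp only: of_real_eq_iff)
  then show ?thesis
    by (simp add: power2_eq_iff_nonneg)
qed

lemma bounded_linear_scaleC:
  "bounded_linear (\<lambda>x :: 'a :: complex_hilbert_space. c *\<^sub>C x)"
  by (rule bounded_linear_intro[of _ "cmod c"])
    (auto simp: scaleC_add_right scaleR_scaleC scaleC_scaleC norm_scaleC mult.commute)

instantiation prod :: (complex_hilbert_space, complex_hilbert_space) complex_hilbert_space
begin

definition scaleC_prod_def: "c *\<^sub>C x = (c *\<^sub>C fst x, c *\<^sub>C snd x)"

definition cinner_prod_def: "cinner x y = cinner (fst x) (fst y) + cinner (snd x) (snd y)"

instance
proof
  fix x y :: "'a \<times> 'b"
  show "cinner x y = cnj (cinner y x)"
    unfolding cinner_prod_def complex_cnj_add
    by (simp only: cinner_commute[of "fst x" "fst y"] cinner_commute[of "snd x" "snd y"])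
qed (auto simp: scaleC_prod_def cinner_prod_def scaleC_add_right scaleC_add_left scaleC_scaleC
        scaleR_scaleC scaleR_prod_def cinner_add_left cinner_scaleC_left inner_eq_Re_cinner
        inner_prod_def algebra_simps)

end

instantiation blinfun :: (real_normed_vector, complex_hilbert_space) scaleC
begin

lift_definition scaleC_blinfun :: "complex \<Rightarrow> ('a \<Rightarrow>\<^sub>L 'b) \<Rightarrow> ('a \<Rightarrow>\<^sub>L 'b)"
  is "\<lambda>c T x. c *\<^sub>C T x"
  by (rule bounded_linear_compose[OF bounded_linear_scaleC])

instance ..

end

text \<open>
  Elements of \<open>'h \<Rightarrow>\<^sub>L 'h\<close> are only real linear; \<open>B(H)\<close> consists of those satisfying \<open>clinear_op\<close>.
  For them the norm of \<open>'h \<Rightarrow>\<^sub>L 'h\<close> is the usual operator norm.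
\<close>

definition clinear_op :: "('h::complex_hilbert_space \<Rightarrow>\<^sub>L 'k::complex_hilbert_space) \<Rightarrow> bool" where
  "clinear_op T \<longleftrightarrow> (\<forall>c x. blinfun_apply T (c *\<^sub>C x) = c *\<^sub>C blinfun_apply T x)"

definition adj :: "('h::complex_hilbert_space \<Rightarrow>\<^sub>L 'h) \<Rightarrow> ('h \<Rightarrow>\<^sub>L 'h)" where
  "adj T = (THE S. \<forall>x y. cinner (blinfun_apply S x) y = cinner x (blinfun_apply T y))"

lemma adj_eqI:
  assumes "\<And>x y. cinner (blinfun_apply S x) y = cinner x (blinfun_apply T y)"
  shows "adj T = S"
  unfolding adj_def
proof (rule the_equality)
  fix R assume R: "\<forall>x y. cinner (blinfun_apply R x) y = cinner x (blinfun_apply T y)"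
  show "R = S"
  proof (rule blinfun_eqI)
    fix x
    have "inner (blinfun_apply R x) y = inner (blinfun_apply S x) y" for y
      using R assms by (simp add: inner_eq_Re_cinner)
    then have "inner (blinfun_apply R x - blinfun_apply S x) y = 0" for y
      by (simp add: inner_diff_left)
    then show "blinfun_apply R x = blinfun_apply S x"
      by (metis eq_iff_diff_eq_0 inner_eq_zero_iff)
  qed
qed (use assms in blast)

text \<open>The order is that of the complex numbers, so the inner products are real and nonnegative.\<close>

definition positive_op :: "('h::complex_hilbert_space \<Rightarrow>\<^sub>L 'h) \<Rightarrow> bool" where
  "positive_op T \<longleftrightarrow> clinear_op T \<and> (\<forall>x. 0 \<le> cinner (blinfun_apply T x) x)"


section \<open>Compact quantum metric spaces\<close>

text \<open>
  The predicate \<open>operator_system e A\<close> says that \<open>A\<close> is an operator system with unit \<open>e\<close>, where \<open>e\<close>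
  is an orthogonal projection of a Hilbert space \<open>H\<close> and \<open>A \<subseteq> B(eH)\<close>; here \<open>B(eH)\<close> is identified
  with the corner \<open>e B(H) e\<close>, which preserves norm, adjoint and positivity. The projection makes it
  possible to work with subspaces of \<open>H\<close> that depend on a parameter.
\<close>

definition operator_system ::
  "('h::complex_hilbert_space \<Rightarrow>\<^sub>L 'h) \<Rightarrow> ('h \<Rightarrow>\<^sub>L 'h) set \<Rightarrow> bool" where
  "operator_system e A \<longleftrightarrow>
     e o\<^sub>L e = e \<and> adj e = e \<and>
     e \<in> A \<and>
     (\<forall>a\<in>A. clinear_op a \<and> e o\<^sub>L a o\<^sub>L e = a) \<and>
     (\<forall>a\<in>A. \<forall>b\<in>A. a + b \<in> A) \<and>
     (\<forall>c. \<forall>a\<in>A. c *\<^sub>C a \<in> A) \<and>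
     (\<forall>a\<in>A. adj a \<in> A)"

text \<open>
  States are positive unital functionals, represented as functions that are \<open>undefined\<close> outside \<open>A\<close>.
\<close>

definition states ::
  "('h::complex_hilbert_space \<Rightarrow>\<^sub>L 'h) \<Rightarrow> ('h \<Rightarrow>\<^sub>L 'h) set \<Rightarrow> (('h \<Rightarrow>\<^sub>L 'h) \<Rightarrow> complex) set" where
  "states e A = {\<phi> \<in> extensional A.
     (\<forall>a\<in>A. \<forall>b\<in>A. \<phi> (a + b) = \<phi> a + \<phi> b) \<and>
     (\<forall>c. \<forall>a\<in>A. \<phi> (c *\<^sub>C a) = c * \<phi> a) \<and>
     (\<forall>a\<in>A. positive_op a \<longrightarrow> 0 \<le> \<phi> a) \<and>
     \<phi> e = 1}"

definition weak_star ::
  "('h::complex_hilbert_space \<Rightarrow>\<^sub>L 'h) \<Rightarrow> ('h \<Rightarrow>\<^sub>L 'h) set \<Rightarrow> (('h \<Rightarrow>\<^sub>L 'h) \<Rightarrow> complex) topology" where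
  "weak_star e A = subtopology (product_topology (\<lambda>_. euclidean) A) (states e A)"

definition state_dist ::
  "('h::complex_hilbert_space \<Rightarrow>\<^sub>L 'h) set \<Rightarrow> (('h \<Rightarrow>\<^sub>L 'h) \<Rightarrow> ennreal) \<Rightarrow>
   (('h \<Rightarrow>\<^sub>L 'h) \<Rightarrow> complex) \<Rightarrow> (('h \<Rightarrow>\<^sub>L 'h) \<Rightarrow> complex) \<Rightarrow> ennreal" where
  "state_dist A L \<phi> \<psi> = (SUP a \<in> {a \<in> A. L a \<le> 1}. ennreal (cmod (\<phi> a - \<psi> a)))"

text \<open>
  Only the values of \<open>L\<close> on \<open>A\<close> matter. The seventh conjunct says that the (a priori extended) metric
  \<open>state_dist A L\<close> has the same open sets as the weak-* topology; the last one is lower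
  semicontinuity for the operator norm.
\<close>

definition lip_norm ::
  "('h::complex_hilbert_space \<Rightarrow>\<^sub>L 'h) \<Rightarrow> ('h \<Rightarrow>\<^sub>L 'h) set \<Rightarrow> (('h \<Rightarrow>\<^sub>L 'h) \<Rightarrow> ennreal) \<Rightarrow> bool" where
  "lip_norm e A L \<longleftrightarrow>
     (\<forall>a\<in>A. \<forall>b\<in>A. L (a + b) \<le> L a + L b) \<and>
     (\<forall>c. \<forall>a\<in>A. L (c *\<^sub>C a) = ennreal (cmod c) * L a) \<and>
     (\<forall>a\<in>A. L (adj a) = L a) \<and>
     (\<forall>a\<in>A. L a = 0 \<longleftrightarrow> (\<exists>c. a = c *\<^sub>C e)) \<and>
     A \<subseteq> closure {a \<in> A. L a < \<infinity>} \<and>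
     (\<forall>U. openin (weak_star e A) U \<longleftrightarrow>
        U \<subseteq> states e A \<and>
        (\<forall>\<phi>\<in>U. \<exists>\<epsilon>>0. \<forall>\<psi>\<in>states e A. state_dist A L \<phi> \<psi> < ennreal \<epsilon> \<longrightarrow> \<psi> \<in> U)) \<and>
     (\<forall>r. closedin (top_of_set A) {a \<in> A. L a \<le> r})"

definition compact_quantum_metric_space ::
  "('h::complex_hilbert_space \<Rightarrow>\<^sub>L 'h) \<Rightarrow> ('h \<Rightarrow>\<^sub>L 'h) set \<Rightarrow> (('h \<Rightarrow>\<^sub>L 'h) \<Rightarrow> ennreal) \<Rightarrow> bool" where
  "compact_quantum_metric_space e A L \<longleftrightarrow> operator_system e A \<and> lip_norm e A L"


section \<open>Quantum Gromov-Hausdorff distance\<close>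

definition dsum_op ::
  "('h::complex_hilbert_space \<Rightarrow>\<^sub>L 'h) \<Rightarrow> ('k::complex_hilbert_space \<Rightarrow>\<^sub>L 'k) \<Rightarrow> (('h \<times> 'k) \<Rightarrow>\<^sub>L ('h \<times> 'k))" where
  "dsum_op S T = Blinfun (\<lambda>x. (blinfun_apply S (fst x), blinfun_apply T (snd x)))"

lemma dsum_op_apply [simp]:
  "blinfun_apply (dsum_op S T) x = (blinfun_apply S (fst x), blinfun_apply T (snd x))"
  unfolding dsum_op_def
  by (subst bounded_linear_Blinfun_apply)
    (intro bounded_linear_intros bounded_linear_fst bounded_linear_snd, rule refl)

definition dsum ::
  "('h::complex_hilbert_space \<Rightarrow>\<^sub>L 'h) set \<Rightarrow> ('k::complex_hilbert_space \<Rightarrow>\<^sub>L 'k) set \<Rightarrow>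
   (('h \<times> 'k) \<Rightarrow>\<^sub>L ('h \<times> 'k)) set" where
  "dsum A B = {dsum_op a b | a b. a \<in> A \<and> b \<in> B}"

text \<open>The coordinate projections of \<open>dsum A B\<close>, as compressions to the two summands.\<close>

definition coord1 ::
  "(('h::complex_hilbert_space \<times> 'k::complex_hilbert_space) \<Rightarrow>\<^sub>L ('h \<times> 'k)) \<Rightarrow> ('h \<Rightarrow>\<^sub>L 'h)" where
  "coord1 T = Blinfun (\<lambda>x. fst (blinfun_apply T (x, 0)))"

lemma coord1_apply [simp]: "blinfun_apply (coord1 T) x = fst (blinfun_apply T (x, 0))"
  unfolding coord1_def
  by (subst bounded_linear_Blinfun_apply)
    (intro bounded_linear_intros bounded_linear_compose[OF bounded_linear_fst], rule refl)

definition coord2 ::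
  "(('h::complex_hilbert_space \<times> 'k::complex_hilbert_space) \<Rightarrow>\<^sub>L ('h \<times> 'k)) \<Rightarrow> ('k \<Rightarrow>\<^sub>L 'k)" where
  "coord2 T = Blinfun (\<lambda>y. snd (blinfun_apply T (0, y)))"

lemma coord2_apply [simp]: "blinfun_apply (coord2 T) y = snd (blinfun_apply T (0, y))"
  unfolding coord2_def
  by (subst bounded_linear_Blinfun_apply)
    (intro bounded_linear_intros bounded_linear_compose[OF bounded_linear_snd], rule refl)

lemma coord_dsum_op [simp]: "coord1 (dsum_op a b) = a" "coord2 (dsum_op a b) = b"
  by (auto intro!: blinfun_eqI)

definition admissible_lip_norms where
  "admissible_lip_norms e A LA f B LB =
     {L. lip_norm (dsum_op e f) (dsum A B) L \<and>
         (\<forall>a\<in>A. LA a = (INF b\<in>B. L (dsum_op a b))) \<and>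
         (\<forall>b\<in>B. LB b = (INF a\<in>A. L (dsum_op a b)))}"

definition hausdorff_dist :: "('a \<Rightarrow> 'a \<Rightarrow> ennreal) \<Rightarrow> 'a set \<Rightarrow> 'a set \<Rightarrow> ennreal" where
  "hausdorff_dist d X Y = max (SUP x\<in>X. INF y\<in>Y. d x y) (SUP y\<in>Y. INF x\<in>X. d x y)"

definition dist_q ::
  "('h::complex_hilbert_space \<Rightarrow>\<^sub>L 'h) \<Rightarrow> ('h \<Rightarrow>\<^sub>L 'h) set \<Rightarrow> (('h \<Rightarrow>\<^sub>L 'h) \<Rightarrow> ennreal) \<Rightarrow>
   ('k::complex_hilbert_space \<Rightarrow>\<^sub>L 'k) \<Rightarrow> ('k \<Rightarrow>\<^sub>L 'k) set \<Rightarrow> (('k \<Rightarrow>\<^sub>L 'k) \<Rightarrow> ennreal) \<Rightarrow> ennreal" where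
  "dist_q e A LA f B LB =
     (INF L \<in> admissible_lip_norms e A LA f B LB.
        hausdorff_dist (state_dist (dsum A B) L)
          ((\<lambda>\<phi>. restrict (\<phi> \<circ> coord1) (dsum A B)) ` states e A)
          ((\<lambda>\<psi>. restrict (\<psi> \<circ> coord2) (dsum A B)) ` states f B))"


section \<open>The Hilbert space of square-summable families\<close>

typedef 'a ell2 = "{f :: 'a \<Rightarrow> complex. (\<lambda>x. (cmod (f x))\<^sup>2) summable_on UNIV}"
  by (rule exI[of _ "\<lambda>_. 0"]) simp

setup_lifting type_definition_ell2

lemma ell2_summable_if_le:
  assumes "(g :: 'a \<Rightarrow> real) summable_on UNIV" "\<And>x. (cmod (f x))\<^sup>2 \<le> g x"
  shows "(\<lambda>x. (cmod (f x))\<^sup>2) summable_on UNIV"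
  by (rule summable_on_comparison_test[OF assms(1)]) (use assms(2) in auto)

lemma ell2_summable_add:
  fixes f g :: "'a \<Rightarrow> complex"
  assumes "(\<lambda>x. (cmod (f x))\<^sup>2) summable_on UNIV" "(\<lambda>x. (cmod (g x))\<^sup>2) summable_on UNIV"
  shows "(\<lambda>x. (cmod (f x + g x))\<^sup>2) summable_on UNIV"
proof (rule ell2_summable_if_le)
  show "(\<lambda>x. 2 * ((cmod (f x))\<^sup>2 + (cmod (g x))\<^sup>2)) summable_on UNIV"
    by (intro summable_on_cmult_right summable_on_add assms)
  fix x
  have "(cmod (f x + g x))\<^sup>2 \<le> (cmod (f x) + cmod (g x))\<^sup>2"
    by (intro power_mono norm_triangle_ineq) simp
  also have "\<dots> \<le> 2 * ((cmod (f x))\<^sup>2 + (cmod (g x))\<^sup>2)"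
    using sum_squares_bound[of "cmod (f x)" "cmod (g x)"] by (simp add: power2_sum)
  finally show "(cmod (f x + g x))\<^sup>2 \<le> 2 * ((cmod (f x))\<^sup>2 + (cmod (g x))\<^sup>2)" .
qed

lemma ell2_summable_mult:
  fixes f :: "'a \<Rightarrow> complex"
  assumes "(\<lambda>x. (cmod (f x))\<^sup>2) summable_on UNIV"
  shows "(\<lambda>x. (cmod (c * f x))\<^sup>2) summable_on UNIV"
  using summable_on_cmult_right[OF assms, of "(cmod c)\<^sup>2"] by (simp add: norm_mult power_mult_distrib)

lemma ell2_summable_cinner:
  fixes f g :: "'a \<Rightarrow> complex"
  assumes "(\<lambda>x. (cmod (f x))\<^sup>2) summable_on UNIV" "(\<lambda>x. (cmod (g x))\<^sup>2) summable_on UNIV"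
  shows "(\<lambda>x. f x * cnj (g x)) summable_on UNIV"
proof (rule abs_summable_summable, rule summable_on_comparison_test)
  show "(\<lambda>x. (cmod (f x))\<^sup>2 + (cmod (g x))\<^sup>2) summable_on UNIV"
    by (intro summable_on_add assms)
  fix x
  have "2 * (cmod (f x) * cmod (g x)) \<le> (cmod (f x))\<^sup>2 + (cmod (g x))\<^sup>2"
    using sum_squares_bound[of "cmod (f x)" "cmod (g x)"] by simp
  moreover have "0 \<le> cmod (f x) * cmod (g x)" by simp
  ultimately have "cmod (f x) * cmod (g x) \<le> (cmod (f x))\<^sup>2 + (cmod (g x))\<^sup>2" by linarith
  then show "norm (f x * cnj (g x)) \<le> (cmod (f x))\<^sup>2 + (cmod (g x))\<^sup>2"
    by (simp add: norm_mult)
qed simp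

instantiation ell2 :: (type) real_inner
begin

lift_definition zero_ell2 :: "'a ell2" is "\<lambda>_. 0" by simp

lift_definition plus_ell2 :: "'a ell2 \<Rightarrow> 'a ell2 \<Rightarrow> 'a ell2" is "\<lambda>f g x. f x + g x"
  by (rule ell2_summable_add)

lift_definition uminus_ell2 :: "'a ell2 \<Rightarrow> 'a ell2" is "\<lambda>f x. - f x" by simp

lift_definition minus_ell2 :: "'a ell2 \<Rightarrow> 'a ell2 \<Rightarrow> 'a ell2" is "\<lambda>f g x. f x - g x"
  subgoal for f g using ell2_summable_add[of f "\<lambda>x. - g x"] by simp
  done

lift_definition scaleR_ell2 :: "real \<Rightarrow> 'a ell2 \<Rightarrow> 'a ell2" is "\<lambda>r f x. complex_of_real r * f x"
  by (rule ell2_summable_mult)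

lift_definition inner_ell2 :: "'a ell2 \<Rightarrow> 'a ell2 \<Rightarrow> real"
  is "\<lambda>f g. Re (\<Sum>\<^sub>\<infinity>x. f x * cnj (g x))" .

definition norm_ell2 :: "'a ell2 \<Rightarrow> real" where "norm_ell2 x = sqrt (inner x x)"
definition dist_ell2 :: "'a ell2 \<Rightarrow> 'a ell2 \<Rightarrow> real" where "dist_ell2 x y = norm (x - y)"
definition sgn_ell2 :: "'a ell2 \<Rightarrow> 'a ell2" where "sgn_ell2 x = inverse (norm x) *\<^sub>R x"
definition uniformity_ell2 :: "('a ell2 \<times> 'a ell2) filter" where
  "uniformity_ell2 = (INF e\<in>{0<..}. principal {(x, y). dist x y < e})"
definition open_ell2 :: "'a ell2 set \<Rightarrow> bool" where
  "open_ell2 U = (\<forall>x\<in>U. eventually (\<lambda>(x', y). x' = x \<longrightarrow> y \<in> U) uniformity)"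

instance
proof
  fix x y z :: "'a ell2" and r s :: real and U :: "'a ell2 set"
  show "x + y + z = x + (y + z)" by transfer (simp add: algebra_simps)
  show "x + y = y + x" by transfer (simp add: algebra_simps)
  show "0 + x = x" by transfer simp
  show "- x + x = 0" by transfer simp
  show "x - y = x + - y" by transfer simp
  show "r *\<^sub>R (x + y) = r *\<^sub>R x + r *\<^sub>R y" by transfer (simp add: algebra_simps)
  show "(r + s) *\<^sub>R x = r *\<^sub>R x + s *\<^sub>R x" by transfer (simp add: algebra_simps)
  show "r *\<^sub>R s *\<^sub>R x = (r * s) *\<^sub>R x" by transfer (simp add: algebra_simps)
  show "1 *\<^sub>R x = x" by transfer simp
  show "sgn x = inverse (norm x) *\<^sub>R x" by (rule sgn_ell2_def)
  show "dist x y = norm (x - y)" by (rule dist_ell2_def)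
  show "uniformity = (INF e\<in>{0<..}. principal {(x, y :: 'a ell2). dist x y < e})"
    by (rule uniformity_ell2_def)
  show "open U = (\<forall>x\<in>U. eventually (\<lambda>(x', y). x' = x \<longrightarrow> y \<in> U) uniformity)"
    by (rule open_ell2_def)
  show "norm x = sqrt (inner x x)" by (rule norm_ell2_def)
  show "inner x y = inner y x"
  proof transfer
    fix f g :: "'a \<Rightarrow> complex"
    have "Re (\<Sum>\<^sub>\<infinity>x. f x * cnj (g x)) = Re (\<Sum>\<^sub>\<infinity>x. cnj (g x * cnj (f x)))"
      by (simp add: mult.commute)
    then show "Re (\<Sum>\<^sub>\<infinity>x. f x * cnj (g x)) = Re (\<Sum>\<^sub>\<infinity>x. g x * cnj (f x))"
      by (simp only: infsum_cnj) simp
  qed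
  show "inner (x + y) z = inner x z + inner y z"
    by transfer (simp add: distrib_right infsum_add ell2_summable_cinner)
  show "inner (r *\<^sub>R x) y = r * inner x y"
    by transfer (simp add: mult.assoc infsum_cmult_right')
  have sq: "f x * cnj (f x) = complex_of_real ((cmod (f x))\<^sup>2)" for f :: "'a \<Rightarrow> complex" and x
    by (simp only: complex_norm_square)
  have inn: "Re (\<Sum>\<^sub>\<infinity>x. f x * cnj (f x)) = (\<Sum>\<^sub>\<infinity>x. (cmod (f x))\<^sup>2)"
    if "(\<lambda>x. (cmod (f x))\<^sup>2) summable_on UNIV" for f :: "'a \<Rightarrow> complex"
    using infsum_Re[OF ell2_summable_cinner[OF that that], symmetric] by (simp only: sq Re_complex_of_real)
  show "0 \<le> inner x x"
    by transfer (simp only: inn, simp add: infsum_nonneg)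
  show "inner x x = 0 \<longleftrightarrow> x = 0"
  proof transfer
    fix f :: "'a \<Rightarrow> complex" assume f: "(\<lambda>x. (cmod (f x))\<^sup>2) summable_on UNIV"
    show "Re (\<Sum>\<^sub>\<infinity>x. f x * cnj (f x)) = 0 \<longleftrightarrow> f = (\<lambda>_. 0)"
    proof
      assume "Re (\<Sum>\<^sub>\<infinity>x. f x * cnj (f x)) = 0"
      then have z: "(\<Sum>\<^sub>\<infinity>x. (cmod (f x))\<^sup>2) = 0" by (simp only: inn[OF f])
      have "(cmod (f y))\<^sup>2 \<le> 0" for y
        using finite_sum_le_infsum[OF f, of "{y}"] z by simp
      then show "f = (\<lambda>_. 0)" by (auto simp: fun_eq_iff)
    qed simp
  qed
qed

end

lemma summable_Rep_ell2: "(\<lambda>x. (cmod (Rep_ell2 f x))\<^sup>2) summable_on UNIV"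
  using Rep_ell2[of f] by simp

lemma norm_ell2_power2: "(norm f)\<^sup>2 = (\<Sum>\<^sub>\<infinity>x. (cmod (Rep_ell2 f x))\<^sup>2)"
proof -
  have "(norm f)\<^sup>2 = Re (\<Sum>\<^sub>\<infinity>x. Rep_ell2 f x * cnj (Rep_ell2 f x))"
    by (simp add: power2_norm_eq_inner inner_ell2.rep_eq)
  also have "\<dots> = (\<Sum>\<^sub>\<infinity>x. Re (Rep_ell2 f x * cnj (Rep_ell2 f x)))"
    by (rule infsum_Re[symmetric]) (intro ell2_summable_cinner summable_Rep_ell2)
  also have "\<dots> = (\<Sum>\<^sub>\<infinity>x. (cmod (Rep_ell2 f x))\<^sup>2)"
    by (simp add: cmod_power2 flip: power2_eq_square)
  finally show ?thesis .
qed

lemma sum_le_norm_ell2_power2: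
  assumes "finite F" shows "(\<Sum>x\<in>F. (cmod (Rep_ell2 f x))\<^sup>2) \<le> (norm f)\<^sup>2"
  unfolding norm_ell2_power2 by (rule finite_sum_le_infsum[OF summable_Rep_ell2 assms]) auto

lemma norm_Rep_ell2_le: "cmod (Rep_ell2 f x) \<le> norm f"
  using sum_le_norm_ell2_power2[of "{x}" f] by (simp add: power2_le_iff_abs_le)

lemma norm_ell2_leI:
  assumes "\<And>F. finite F \<Longrightarrow> (\<Sum>x\<in>F. (cmod (Rep_ell2 f x))\<^sup>2) \<le> C\<^sup>2" "0 \<le> C"
  shows "norm f \<le> C"
proof -
  have "(norm f)\<^sup>2 \<le> C\<^sup>2"
    unfolding norm_ell2_power2
    by (rule infsum_le_finite_sums[OF summable_Rep_ell2]) (use assms in auto)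
  then show ?thesis using assms(2) by (rule power2_le_imp_le)
qed

instance ell2 :: (type) complete_space
proof
  fix X :: "nat \<Rightarrow> 'a ell2" assume X: "Cauchy X"
  define f where "f x = lim (\<lambda>n. Rep_ell2 (X n) x)" for x
  have f: "(\<lambda>n. Rep_ell2 (X n) x) \<longlonglongrightarrow> f x" for x
  proof -
    have "Cauchy (\<lambda>n. Rep_ell2 (X n) x)"
    proof (rule metric_CauchyI)
      fix e :: real assume "e > 0"
      then obtain M where M: "dist (X m) (X n) < e" if "m \<ge> M" "n \<ge> M" for m n
        using X by (meson metric_CauchyD)
      show "\<exists>M. \<forall>m\<ge>M. \<forall>n\<ge>M. dist (Rep_ell2 (X m) x) (Rep_ell2 (X n) x) < e"
      proof (intro exI allI impI)
        fix m n assume "m \<ge> M" "n \<ge> M"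
        have "dist (Rep_ell2 (X m) x) (Rep_ell2 (X n) x) \<le> dist (X m) (X n)"
          using norm_Rep_ell2_le[of "X m - X n" x] by (simp add: dist_norm minus_ell2.rep_eq)
        also have "\<dots> < e" using M \<open>m \<ge> M\<close> \<open>n \<ge> M\<close> .
        finally show "dist (Rep_ell2 (X m) x) (Rep_ell2 (X n) x) < e" .
      qed
    qed
    then show ?thesis unfolding f_def by (intro convergent_LIMSEQ_iff[THEN iffD1] Cauchy_convergent)
  qed
  have bound: "\<exists>M. \<forall>n\<ge>M. \<forall>F. finite F \<longrightarrow> (\<Sum>x\<in>F. (cmod (Rep_ell2 (X n) x - f x))\<^sup>2) \<le> e\<^sup>2"
    if "e > 0" for e
  proof -
    obtain M where M: "dist (X m) (X n) < e" if "m \<ge> M" "n \<ge> M" for m n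
      using X \<open>e > 0\<close> by (meson metric_CauchyD)
    have "(\<Sum>x\<in>F. (cmod (Rep_ell2 (X n) x - f x))\<^sup>2) \<le> e\<^sup>2" if "n \<ge> M" "finite F" for n F
    proof (rule LIMSEQ_le_const2)
      show "(\<lambda>m. \<Sum>x\<in>F. (cmod (Rep_ell2 (X n) x - Rep_ell2 (X m) x))\<^sup>2)
              \<longlonglongrightarrow> (\<Sum>x\<in>F. (cmod (Rep_ell2 (X n) x - f x))\<^sup>2)"
        by (intro tendsto_intros f)
      have "(\<Sum>x\<in>F. (cmod (Rep_ell2 (X n) x - Rep_ell2 (X m) x))\<^sup>2) \<le> e\<^sup>2" if "m \<ge> M" for m
      proof -
        have "(\<Sum>x\<in>F. (cmod (Rep_ell2 (X n) x - Rep_ell2 (X m) x))\<^sup>2) \<le> (norm (X n - X m))\<^sup>2"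
          using sum_le_norm_ell2_power2[OF \<open>finite F\<close>, of "X n - X m"]
          by (simp add: minus_ell2.rep_eq)
        also have "\<dots> \<le> e\<^sup>2"
          using M[OF \<open>n \<ge> M\<close> \<open>m \<ge> M\<close>] by (intro power_mono) (auto simp: dist_norm)
        finally show ?thesis .
      qed
      then show "\<exists>N. \<forall>m\<ge>N. (\<Sum>x\<in>F. (cmod (Rep_ell2 (X n) x - Rep_ell2 (X m) x))\<^sup>2) \<le> e\<^sup>2" by blast
    qed
    then show ?thesis by blast
  qed
  obtain M where M: "\<And>F. finite F \<Longrightarrow> (\<Sum>x\<in>F. (cmod (Rep_ell2 (X M) x - f x))\<^sup>2) \<le> 1\<^sup>2"
    using bound[of 1] by auto
  have "(\<lambda>x. (cmod (Rep_ell2 (X M) x - f x))\<^sup>2) summable_on UNIV"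
    by (rule nonneg_bdd_above_summable_on) (use M in \<open>auto intro!: bdd_aboveI2[of _ _ 1]\<close>)
  from ell2_summable_add[OF summable_Rep_ell2[of "X M"] ell2_summable_mult[OF this, of "-1"]]
  have fs: "(\<lambda>x. (cmod (f x))\<^sup>2) summable_on UNIV" by simp
  have Rf: "Rep_ell2 (Abs_ell2 f) = f" using fs by (simp add: Abs_ell2_inverse)
  have "X \<longlonglongrightarrow> Abs_ell2 f"
  proof (rule metric_LIMSEQ_I)
    fix e :: real assume "e > 0"
    then obtain M where M:
      "\<And>n F. n \<ge> M \<Longrightarrow> finite F \<Longrightarrow> (\<Sum>x\<in>F. (cmod (Rep_ell2 (X n) x - f x))\<^sup>2) \<le> (e / 2)\<^sup>2"
      using bound[of "e / 2"] by auto
    have "dist (X n) (Abs_ell2 f) < e" if "n \<ge> M" for n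
    proof -
      have "norm (X n - Abs_ell2 f) \<le> e / 2"
        by (rule norm_ell2_leI) (use M[OF that] \<open>e > 0\<close> in \<open>auto simp: minus_ell2.rep_eq Rf\<close>)
      then show ?thesis using \<open>e > 0\<close> by (simp add: dist_norm)
    qed
    then show "\<exists>M. \<forall>n\<ge>M. dist (X n) (Abs_ell2 f) < e" by blast
  qed
  then show "convergent X" by (rule convergentI)
qed

instantiation ell2 :: (type) complex_hilbert_space
begin

lift_definition scaleC_ell2 :: "complex \<Rightarrow> 'a ell2 \<Rightarrow> 'a ell2" is "\<lambda>c f x. c * f x"
  by (rule ell2_summable_mult)

lift_definition cinner_ell2 :: "'a ell2 \<Rightarrow> 'a ell2 \<Rightarrow> complex"
  is "\<lambda>f g. \<Sum>\<^sub>\<infinity>x. f x * cnj (g x)" .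

instance
proof
  fix x y z :: "'a ell2" and c d :: complex and r :: real
  show "c *\<^sub>C (x + y) = c *\<^sub>C x + c *\<^sub>C y" by transfer (simp add: algebra_simps)
  show "(c + d) *\<^sub>C x = c *\<^sub>C x + d *\<^sub>C x" by transfer (simp add: algebra_simps)
  show "c *\<^sub>C d *\<^sub>C x = (c * d) *\<^sub>C x" by transfer (simp add: algebra_simps)
  show "r *\<^sub>R x = complex_of_real r *\<^sub>C x" by transfer simp
  show "cinner x y = cnj (cinner y x)"
    by transfer (simp add: mult.commute flip: infsum_cnj)
  show "cinner (x + y) z = cinner x z + cinner y z"
    by transfer (simp add: distrib_right infsum_add ell2_summable_cinner)
  show "cinner (c *\<^sub>C x) y = c * cinner x y"
    by transfer (simp add: mult.assoc infsum_cmult_right')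
  show "inner x y = Re (cinner x y)" by transfer simp
qed

end

lift_definition delta :: "'a \<Rightarrow> 'a ell2" is "\<lambda>a x. if x = a then 1 else 0"
proof -
  fix a :: 'a
  have "(\<lambda>x. (cmod (if x = a then 1 else 0 :: complex))\<^sup>2) summable_on {a}" by simp
  then show "(\<lambda>x. (cmod (if x = a then 1 else 0 :: complex))\<^sup>2) summable_on UNIV"
    by (rule summable_on_cong_neutral[THEN iffD1, rotated -1]) auto
qed

lemma Rep_ell2_sum: "Rep_ell2 (sum h A) x = (\<Sum>a\<in>A. Rep_ell2 (h a) x)"
  by (induction A rule: infinite_finite_induct) (auto simp: zero_ell2.rep_eq plus_ell2.rep_eq)

text \<open>A reindexing operator \<open>\<xi> \<mapsto> (\<lambda>x. if x \<in> X then \<xi> (h x) else 0)\<close>, where \<open>h\<close> is injective on \<open>X\<close>.\<close>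

lemma reindex_sum_le:
  assumes "inj_on h X" "finite F"
  shows "(\<Sum>x\<in>F. (cmod (if x \<in> X then Rep_ell2 \<xi> (h x) else 0))\<^sup>2) \<le> (norm \<xi>)\<^sup>2"
proof -
  have "(\<Sum>x\<in>F. (cmod (if x \<in> X then Rep_ell2 \<xi> (h x) else 0))\<^sup>2)
      = (\<Sum>x\<in>F \<inter> X. (cmod (Rep_ell2 \<xi> (h x)))\<^sup>2)"
    using assms(2) by (intro sum.mono_neutral_cong_right) auto
  also have "\<dots> = (\<Sum>y\<in>h ` (F \<inter> X). (cmod (Rep_ell2 \<xi> y))\<^sup>2)"
    using assms(1) by (subst sum.reindex) (auto intro: inj_on_subset)
  also have "\<dots> \<le> (norm \<xi>)\<^sup>2" by (rule sum_le_norm_ell2_power2) (use assms in simp)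
  finally show ?thesis .
qed

definition reindex_op :: "('a \<Rightarrow> 'a) \<Rightarrow> 'a set \<Rightarrow> ('a ell2 \<Rightarrow>\<^sub>L 'a ell2)" where
  "reindex_op h X =
     Blinfun (\<lambda>\<xi>. Abs_ell2 (\<lambda>x. if x \<in> X then Rep_ell2 \<xi> (h x) else 0))"

lemma reindex_op_apply:
  assumes inj: "inj_on h X"
  shows "Rep_ell2 (blinfun_apply (reindex_op h X) \<xi>) = (\<lambda>x. if x \<in> X then Rep_ell2 \<xi> (h x) else 0)"
proof -
  have R: "Rep_ell2 (Abs_ell2 (\<lambda>x. if x \<in> X then Rep_ell2 \<xi> (h x) else 0))
           = (\<lambda>x. if x \<in> X then Rep_ell2 \<xi> (h x) else 0)" for \<xi>
  proof (rule Abs_ell2_inverse, rule CollectI, rule nonneg_bdd_above_summable_on)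
    show "bdd_above (sum (\<lambda>x. (cmod (if x \<in> X then Rep_ell2 \<xi> (h x) else 0))\<^sup>2)
            ` {F. F \<subseteq> UNIV \<and> finite F})"
      by (rule bdd_aboveI2[of _ _ "(norm \<xi>)\<^sup>2"]) (use reindex_sum_le[OF inj] in simp)
  qed simp
  have "bounded_linear (\<lambda>\<xi>. Abs_ell2 (\<lambda>x. if x \<in> X then Rep_ell2 \<xi> (h x) else 0))"
  proof (rule bounded_linear_intro[of _ 1])
    fix \<xi> :: "'a ell2"
    show "norm (Abs_ell2 (\<lambda>x. if x \<in> X then Rep_ell2 \<xi> (h x) else 0)) \<le> norm \<xi> * 1"
      by (rule norm_ell2_leI) (use reindex_sum_le[OF inj] in \<open>auto simp: R\<close>)
  qed (auto simp: R plus_ell2.rep_eq scaleR_ell2.rep_eq fun_eq_iff simp flip: Rep_ell2_inject)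
  then show ?thesis by (simp add: reindex_op_def bounded_linear_Blinfun_apply R)
qed

text \<open>The orthogonal projection onto \<open>\<ell>\<^sup>2(X)\<close>.\<close>

definition proj_op :: "'a set \<Rightarrow> ('a ell2 \<Rightarrow>\<^sub>L 'a ell2)" where
  "proj_op X = reindex_op (\<lambda>x. x) X"

text \<open>The matrix entry in row \<open>x\<close> and column \<open>y\<close>, and the corresponding matrix unit.\<close>

definition entry :: "('a ell2 \<Rightarrow>\<^sub>L 'a ell2) \<Rightarrow> 'a \<Rightarrow> 'a \<Rightarrow> complex" where
  "entry T x y = Rep_ell2 (blinfun_apply T (delta y)) x"

lift_definition matrix_unit :: "'a \<Rightarrow> 'a \<Rightarrow> ('a ell2 \<Rightarrow>\<^sub>L 'a ell2)"
  is "\<lambda>x y \<xi>. Rep_ell2 \<xi> y *\<^sub>C delta x"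
proof -
  fix x y :: 'a
  show "bounded_linear (\<lambda>\<xi>. Rep_ell2 \<xi> y *\<^sub>C delta x)"
  proof (rule bounded_linear_intro[of _ "norm (delta x)"])
    show "norm (Rep_ell2 \<xi> y *\<^sub>C delta x) \<le> norm \<xi> * norm (delta x)" for \<xi> :: "'a ell2"
      by (simp add: norm_scaleC mult_right_mono norm_Rep_ell2_le)
  qed (auto simp: plus_ell2.rep_eq scaleR_ell2.rep_eq scaleC_add_left scaleR_scaleC[where x = "c *\<^sub>C z" for c z] scaleC_scaleC)
qed


section \<open>Groups, word length and spectral truncations\<close>

text \<open>
  The Hilbert space \<open>\<ell>\<^sup>2(G)\<close> is the range of \<open>proj_op (carrier G)\<close>, so this projection is the unit of
  \<open>\<complex>[G]\<close>.
\<close>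

definition word_length :: "('a, 'm) monoid_scheme \<Rightarrow> 'a set \<Rightarrow> 'a \<Rightarrow> nat" where
  "word_length G S x = (LEAST n. \<exists>w. length w = n \<and> set w \<subseteq> S \<and> foldr (mult G) w (one G) = x)"

definition word_ball :: "('a, 'm) monoid_scheme \<Rightarrow> 'a set \<Rightarrow> real \<Rightarrow> 'a set" where
  "word_ball G S \<Lambda> = {x \<in> carrier G. real (word_length G S x) \<le> \<Lambda>}"

definition polynomial_growth :: "('a, 'm) monoid_scheme \<Rightarrow> 'a set \<Rightarrow> bool" where
  "polynomial_growth G S \<longleftrightarrow>
     (\<exists>C>0. \<exists>k>0. \<forall>n::nat. n \<ge> 1 \<longrightarrow> real (card (word_ball G S (real n))) \<le> C * real n powr k)"

definition group_alg :: "('a, 'm) monoid_scheme \<Rightarrow> ('a \<Rightarrow> complex) set" where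
  "group_alg G = {f. finite {x. f x \<noteq> 0} \<and> {x. f x \<noteq> 0} \<subseteq> carrier G}"

text \<open>The left translation \<open>(\<lambda>\<^sub>y \<xi>)(x) = \<xi>(y\<^sup>-\<^sup>1 x)\<close>, and \<open>\<lambda>(f) = \<Sum>\<^sub>y f(y) \<lambda>\<^sub>y\<close>.\<close>

definition left_transl :: "('a, 'm) monoid_scheme \<Rightarrow> 'a \<Rightarrow> ('a ell2 \<Rightarrow>\<^sub>L 'a ell2)" where
  "left_transl G y = reindex_op (\<lambda>x. inv\<^bsub>G\<^esub> y \<otimes>\<^bsub>G\<^esub> x) (carrier G)"

lemma (in group) left_transl_apply:
  assumes "y \<in> carrier G"
  shows "Rep_ell2 (blinfun_apply (left_transl G y) \<xi>) =
           (\<lambda>x. if x \<in> carrier G then Rep_ell2 \<xi> (inv y \<otimes> x) else 0)"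
  unfolding left_transl_def by (rule reindex_op_apply) (use assms in \<open>auto simp: inj_on_def\<close>)

definition left_reg :: "('a, 'm) monoid_scheme \<Rightarrow> ('a \<Rightarrow> complex) \<Rightarrow> ('a ell2 \<Rightarrow>\<^sub>L 'a ell2)" where
  "left_reg G f = (\<Sum>y \<in> {y. f y \<noteq> 0}. f y *\<^sub>C left_transl G y)"

lemma (in group) entry_left_reg:
  assumes "f \<in> group_alg G" "x \<in> carrier G" "y \<in> carrier G"
  shows "entry (left_reg G f) x y = f (x \<otimes> inv y)"
proof -
  have fin: "finite {y. f y \<noteq> 0}" and sub: "{y. f y \<noteq> 0} \<subseteq> carrier G"
    using assms by (auto simp: group_alg_def)
  have eq: "inv z \<otimes> x = y \<longleftrightarrow> z = x \<otimes> inv y" if "z \<in> carrier G" for z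
    using that assms by (metis inv_closed inv_solve_left inv_solve_right m_closed inv_inv)
  have "entry (left_reg G f) x y = (\<Sum>z\<in>{y. f y \<noteq> 0}. f z * Rep_ell2 (blinfun_apply (left_transl G z) (delta y)) x)"
    unfolding entry_def left_reg_def
    by (simp add: blinfun.sum_left Rep_ell2_sum scaleC_blinfun.rep_eq scaleC_ell2.rep_eq)
  also have "\<dots> = (\<Sum>z\<in>{y. f y \<noteq> 0}. if z = x \<otimes> inv y then f z else 0)"
    by (rule sum.cong) (use sub assms in \<open>auto simp: left_transl_apply delta.rep_eq eq subset_iff\<close>)
  also have "\<dots> = f (x \<otimes> inv y)" using fin by (simp add: sum.delta)
  finally show ?thesis .
qed

definition group_alg_op :: "('a, 'm) monoid_scheme \<Rightarrow> ('a ell2 \<Rightarrow>\<^sub>L 'a ell2) set" where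
  "group_alg_op G = left_reg G ` group_alg G"

definition d_map ::
  "('a, 'm) monoid_scheme \<Rightarrow> 'a set \<Rightarrow> ('a \<Rightarrow> complex) \<Rightarrow> ('a \<Rightarrow> complex)" where
  "d_map G S f = (\<lambda>x. of_nat (word_length G S x) * f x)"

text \<open>The group algebra is identified with its image under \<open>left_reg G\<close>, which is injective on it.\<close>

definition L_full :: "('a, 'm) monoid_scheme \<Rightarrow> 'a set \<Rightarrow> nat \<Rightarrow> ('a ell2 \<Rightarrow>\<^sub>L 'a ell2) \<Rightarrow> ennreal" where
  "L_full G S s T =
     ennreal (norm (left_reg G ((d_map G S ^^ s) (inv_into (group_alg G) (left_reg G) T))))"

definition P_op :: "('a, 'm) monoid_scheme \<Rightarrow> 'a set \<Rightarrow> real \<Rightarrow> ('a ell2 \<Rightarrow>\<^sub>L 'a ell2)" where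
  "P_op G S \<Lambda> = proj_op (word_ball G S \<Lambda>)"

definition truncation :: "('a, 'm) monoid_scheme \<Rightarrow> 'a set \<Rightarrow> real \<Rightarrow> ('a ell2 \<Rightarrow>\<^sub>L 'a ell2) set" where
  "truncation G S \<Lambda> = (\<lambda>f. P_op G S \<Lambda> o\<^sub>L left_reg G f o\<^sub>L P_op G S \<Lambda>) ` group_alg G"

definition d_trunc ::
  "('a, 'm) monoid_scheme \<Rightarrow> 'a set \<Rightarrow> real \<Rightarrow> ('a ell2 \<Rightarrow>\<^sub>L 'a ell2) \<Rightarrow> ('a ell2 \<Rightarrow>\<^sub>L 'a ell2)" where
  "d_trunc G S \<Lambda> T =
     (\<Sum>x \<in> word_ball G S \<Lambda>. \<Sum>y \<in> word_ball G S \<Lambda>.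
        (of_nat (word_length G S (x \<otimes>\<^bsub>G\<^esub> inv\<^bsub>G\<^esub> y)) * entry T x y) *\<^sub>C matrix_unit x y)"

definition L_trunc ::
  "('a, 'm) monoid_scheme \<Rightarrow> 'a set \<Rightarrow> nat \<Rightarrow> real \<Rightarrow> ('a ell2 \<Rightarrow>\<^sub>L 'a ell2) \<Rightarrow> ennreal" where
  "L_trunc G S s \<Lambda> T = ennreal (norm ((d_trunc G S \<Lambda> ^^ s) T))"

end

theory Submission
  imports Defs
begin

text \<open>
  With growth of degree at most \<open>p\<close> put \<open>s = p + 2\<close>. Matrix entries are bounded by the operator
  norm, so \<open>\<bar>f x\<bar> \<le> L\<^sub>s f / \<ell>(x)\<^sup>s\<close> for \<open>x \<noteq> e\<close>, also for truncations, and the sum of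
  \<open>\<ell>(x)\<^sup>-\<^sup>s\<close> over \<open>x \<noteq> e\<close> converges. Hence every element is, up to a small multiple of its Lip-norm,
  a combination of a fixed finite set with bounded coefficients modulo scalars; this gives the
  weak-* condition.

  For the distance, let \<open>\<tau>\<close> be the compression from \<open>\<complex>[G]\<close> to the ball of radius \<open>\<Lambda>\<close>. In the other
  direction let \<open>\<sigma>\<close> multiply the coefficients by \<open>m x = card (K \<inter> x K) / card K\<close>, where
  \<open>K\<close> is a ball of fixed radius that is almost invariant under translation by short elements; such
  balls exist because growth is not exponential. Averaging over right translates of \<open>K\<close> shows that
  \<open>\<sigma>\<close> is positive and contractive. Both maps commute with the derivation, so they do not increase
  Lip-norms, and by the decay of the coefficients \<open>\<sigma> \<circ> \<tau>\<close> and \<open>\<tau> \<circ> \<sigma>\<close> are \<open>\<epsilon>\<close>-close to the identity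
  on Lip-balls, uniformly in \<open>\<Lambda>\<close>. The Lip-norm \<open>max (L a) (max (L b) (\<parallel>b - \<tau> a\<parallel> / \<epsilon>))\<close> on the
  direct sum then bounds the distance by \<open>2 \<epsilon>\<close>.
\<close>

section \<open>Complex Hilbert spaces\<close>

text \<open>A matrix over the ball does not determine the coefficients outside the products
  \<open>y \<otimes> inv z\<close> of elements of the ball, and extending it by 0 is in general
  neither positive nor contractive, so states could not be transported along such a map. This
  obstacle dictates the form of \<open>\<sigma>\<close>: a multiplier that vanishes outside the
  products from the smaller ball \<open>K\<close> needs only coefficients that the truncation knows.
  As \<open>K\<close> is chosen from \<open>\<epsilon>\<close> alone, a single multiplier serves all
  \<open>\<Lambda>\<close> beyond its radius. Right translates occur because the entry at
  \<open>(x, y)\<close> depends on \<open>x \<otimes> inv y\<close>, which is unchanged when both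
  are multiplied from the right.

  The coefficient at the unit is invisible to the Lip-norm. Hence everything holds modulo scalars,
  and the multiplier has to be exactly 1 there.

  The group algebra is in general not norm closed, so limits of Lip-bounded sequences may leave it;
  approximants are therefore constructed inside the algebra, and semicontinuity is only claimed for
  limits in it.\<close>

lemma cinner_add_right: "cinner x (y + z) = cinner x y + cinner x (z :: 'a :: complex_hilbert_space)"
  by (metis cinner_add_left cinner_commute complex_cnj_add)

lemma cinner_scaleC_right: "cinner x (c *\<^sub>C y) = cnj c * cinner x (y :: 'a :: complex_hilbert_space)"
  by (metis cinner_commute cinner_scaleC_left complex_cnj_mult)

text \<open>Multiplying \<open>x\<close> by a phase \<open>w\<close> makes the inner product real,
  which reduces the claim to the Cauchy-Schwarz inequality of the underlying real Hilbert
  space.\<close>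

lemma cinner_cauchy_schwarz: "cmod (cinner x y) \<le> norm x * norm (y :: 'a :: complex_hilbert_space)"
proof (cases "cinner x y = 0")
  case False
  define w where "w = cnj (cinner x y) / cmod (cinner x y)"
  have w: "cmod w = 1" using False by (simp add: w_def norm_divide)
  have "cinner (w *\<^sub>C x) y = cmod (cinner x y)"
    using False
    by (simp add: w_def cinner_scaleC_left complex_norm_square[symmetric] mult.commute power2_eq_square)
  then have "inner (w *\<^sub>C x) y = cmod (cinner x y)" by (simp add: inner_eq_Re_cinner)
  then show ?thesis using norm_cauchy_schwarz[of "w *\<^sub>C x" y] by (simp add: norm_scaleC w)
qed simp

lemma bounded_bilinear_cinner:
  "bounded_bilinear (cinner :: 'a :: complex_hilbert_space \<Rightarrow> 'a \<Rightarrow> complex)"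
  by standard
    (auto simp: cinner_add_left cinner_add_right scaleR_scaleC cinner_scaleC_left cinner_scaleC_right
       scaleR_conv_of_real intro!: exI[of _ 1] cinner_cauchy_schwarz)

interpretation cinner: bounded_bilinear "cinner :: 'a :: complex_hilbert_space \<Rightarrow> 'a \<Rightarrow> complex"
  by (rule bounded_bilinear_cinner)

lemma scaleC_one [simp]: "1 *\<^sub>C (x :: 'a :: complex_hilbert_space) = x"
  by (metis of_real_1 scaleR_one scaleR_scaleC)

lemma scaleC_zero_left [simp]: "0 *\<^sub>C (x :: 'a :: complex_hilbert_space) = 0"
  by (metis of_real_0 scaleR_zero_left scaleR_scaleC)

lemma scaleC_minus1 [simp]: "(-1) *\<^sub>C (x :: 'a :: complex_hilbert_space) = - x"
  by (metis of_real_1 of_real_minus scaleR_minus1_left scaleR_scaleC)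

lemma scaleC_blinfun_apply [simp]:
  "blinfun_apply (c *\<^sub>C T) x = c *\<^sub>C blinfun_apply T x"
  by (simp add: scaleC_blinfun.rep_eq)

lemma scaleC_blinfun_simps:
  fixes S T :: "'a::real_normed_vector \<Rightarrow>\<^sub>L 'b::complex_hilbert_space"
  shows "c *\<^sub>C (S + T) = c *\<^sub>C S + c *\<^sub>C T"
    and "(c + d) *\<^sub>C T = c *\<^sub>C T + d *\<^sub>C T"
    and "c *\<^sub>C d *\<^sub>C T = (c * d) *\<^sub>C T"
    and "1 *\<^sub>C T = T" and "0 *\<^sub>C T = 0" and "(-1) *\<^sub>C T = - T"
    and "c *\<^sub>C (0 :: 'a \<Rightarrow>\<^sub>L 'b) = 0"
  by (auto intro!: blinfun_eqI simp: blinfun.bilinear_simps scaleC_add_right scaleC_add_left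
      scaleC_scaleC linear_0[OF bounded_linear.linear[OF bounded_linear_scaleC]])

lemma scaleC_blinfun_diff:
  fixes S T :: "'a::real_normed_vector \<Rightarrow>\<^sub>L 'b::complex_hilbert_space"
  shows "c *\<^sub>C (S - T) = c *\<^sub>C S - c *\<^sub>C T"
  by (rule blinfun_eqI)
    (simp add: blinfun.diff_left linear_diff[OF bounded_linear.linear[OF bounded_linear_scaleC]])

text \<open>Only the upper bound is direct; the reverse one is the same bound for
  \<open>inverse c\<close>.\<close>

lemma norm_scaleC_blinfun:
  fixes T :: "'a::real_normed_vector \<Rightarrow>\<^sub>L 'b::complex_hilbert_space"
  shows "norm (c *\<^sub>C T) = cmod c * norm T"
proof -
  have le: "norm (c *\<^sub>C T) \<le> cmod c * norm T" for c and T :: "'a \<Rightarrow>\<^sub>L 'b"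
    by (rule norm_blinfun_bound)
      (auto simp: norm_scaleC mult.assoc intro!: mult_left_mono norm_blinfun)
  show ?thesis
  proof (cases "c = 0")
    case False
    have "norm (inverse c *\<^sub>C c *\<^sub>C T) \<le> cmod (inverse c) * norm (c *\<^sub>C T)" by (rule le)
    then have "norm T \<le> norm (c *\<^sub>C T) / cmod c"
      using False by (simp add: scaleC_blinfun_simps norm_inverse divide_inverse mult.commute)
    then show ?thesis using le[of c T] False by (simp add: field_simps)
  qed (simp add: scaleC_blinfun_simps)
qed

text \<open>The square of the norm of \<open>S x\<close> is the inner product of \<open>x\<close>
  with \<open>T (S x)\<close>, so one factor cancels. Applied to an operator and to its adjoint this
  gives the equality \<open>norm_adj\<close>.\<close>

lemma norm_adj_le:
  assumes "\<And>x y. cinner (blinfun_apply S x) y = cinner x (blinfun_apply T y)"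
  shows "norm S \<le> norm T"
proof (rule norm_blinfun_bound)
  fix x
  let ?n = "norm (blinfun_apply S x)"
  have "?n\<^sup>2 = cmod (cinner x (blinfun_apply T (blinfun_apply S x)))"
    unfolding assms[symmetric] cinner_self by (simp only: norm_of_real) simp
  also have "\<dots> \<le> norm x * (norm T * ?n)"
    by (intro order.trans[OF cinner_cauchy_schwarz] mult_left_mono norm_blinfun) simp
  finally have *: "?n * ?n \<le> (norm T * norm x) * ?n" by (simp add: power2_eq_square mult_ac)
  show "?n \<le> norm T * norm x"
  proof (cases "?n = 0")
    case False
    then have "?n > 0" by simp
    then show ?thesis using * mult_right_le_imp_le by blast
  qed (simp only: norm_ge_zero mult_nonneg_nonneg)
qed simp


section \<open>States of operator systems\<close>

text \<open>Linearity is asked on \<open>A\<close> only, and neither continuity nor positivity is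
  included, so that states, their differences and their pullbacks all qualify.\<close>

definition clin_fun :: "('h::complex_hilbert_space \<Rightarrow>\<^sub>L 'h) set \<Rightarrow> (('h \<Rightarrow>\<^sub>L 'h) \<Rightarrow> complex) \<Rightarrow> bool" where
  "clin_fun A \<phi> \<longleftrightarrow> (\<forall>a\<in>A. \<forall>b\<in>A. \<phi> (a + b) = \<phi> a + \<phi> b) \<and> (\<forall>c. \<forall>a\<in>A. \<phi> (c *\<^sub>C a) = c * \<phi> a)"

text \<open>The adjoint is a definite description, so its existence has to be assumed separately.\<close>

locale op_sys =
  fixes e :: "'h::complex_hilbert_space \<Rightarrow>\<^sub>L 'h" and A :: "('h \<Rightarrow>\<^sub>L 'h) set"
  assumes operator_system: "operator_system e A"
    and adj_rel: "a \<in> A \<Longrightarrow> cinner (blinfun_apply (adj a) x) y = cinner x (blinfun_apply a y)"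
begin

lemma unit_in: "e \<in> A"
  and add_in: "a \<in> A \<Longrightarrow> b \<in> A \<Longrightarrow> a + b \<in> A"
  and scaleC_in: "a \<in> A \<Longrightarrow> c *\<^sub>C a \<in> A"
  and adj_in: "a \<in> A \<Longrightarrow> adj a \<in> A"
  and clinear_in: "a \<in> A \<Longrightarrow> clinear_op a"
  and corner: "a \<in> A \<Longrightarrow> e o\<^sub>L a o\<^sub>L e = a"
  and adj_unit: "adj e = e"
  and unit_idem: "e o\<^sub>L e = e"
  using operator_system by (auto simp: operator_system_def)

lemma zero_in: "0 \<in> A"
  using scaleC_in[OF unit_in, of 0] by (simp add: scaleC_blinfun_simps)

lemma uminus_in: "a \<in> A \<Longrightarrow> - a \<in> A"
  using scaleC_in[of a "-1"] by (simp add: scaleC_blinfun_simps)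

lemma diff_in: "a \<in> A \<Longrightarrow> b \<in> A \<Longrightarrow> a - b \<in> A"
  using add_in[OF _ uminus_in, of a b] by simp

lemma sum_in: "(\<And>x. x \<in> F \<Longrightarrow> h x \<in> A) \<Longrightarrow> sum h F \<in> A"
  by (induction F rule: infinite_finite_induct) (auto intro: add_in zero_in)

lemma adj_add: "a \<in> A \<Longrightarrow> b \<in> A \<Longrightarrow> adj (a + b) = adj a + adj b"
  by (rule adj_eqI) (simp add: blinfun.add_left cinner_add_left cinner_add_right adj_rel)

lemma adj_scaleC: "a \<in> A \<Longrightarrow> adj (c *\<^sub>C a) = cnj c *\<^sub>C adj a"
  by (rule adj_eqI) (simp add: cinner_scaleC_left cinner_scaleC_right adj_rel)

lemma adj_adj: "a \<in> A \<Longrightarrow> adj (adj a) = a"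
  by (rule adj_eqI) (metis adj_rel cinner_commute)

lemma norm_adj: "a \<in> A \<Longrightarrow> norm (adj a) = norm a"
  by (metis adj_adj adj_in adj_rel norm_adj_le order.antisym)

lemma clin_fun_scale: "clin_fun A \<phi> \<Longrightarrow> a \<in> A \<Longrightarrow> \<phi> (c *\<^sub>C a) = c * \<phi> a"
  and clin_fun_add: "clin_fun A \<phi> \<Longrightarrow> a \<in> A \<Longrightarrow> b \<in> A \<Longrightarrow> \<phi> (a + b) = \<phi> a + \<phi> b"
  by (auto simp: clin_fun_def)

lemma clin_fun_minus: "clin_fun A \<phi> \<Longrightarrow> a \<in> A \<Longrightarrow> \<phi> (- a) = - \<phi> a"
  using clin_fun_scale[of \<phi> a "-1"] by (simp add: scaleC_blinfun_simps)

lemma clin_fun_diff: "clin_fun A \<phi> \<Longrightarrow> a \<in> A \<Longrightarrow> b \<in> A \<Longrightarrow> \<phi> (a - b) = \<phi> a - \<phi> b"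
  using clin_fun_add[OF _ _ uminus_in, of \<phi> a b] by (simp add: clin_fun_minus)

lemma clin_fun_zero: "clin_fun A \<phi> \<Longrightarrow> \<phi> 0 = 0"
  using clin_fun_diff[OF _ zero_in zero_in] by simp

lemma clin_fun_sum: "clin_fun A \<phi> \<Longrightarrow> (\<And>x. x \<in> F \<Longrightarrow> h x \<in> A) \<Longrightarrow> \<phi> (sum h F) = (\<Sum>x\<in>F. \<phi> (h x))"
  by (induction F rule: infinite_finite_induct) (auto simp: clin_fun_zero clin_fun_add sum_in)

lemma states_clin_fun: "\<phi> \<in> states e A \<Longrightarrow> clin_fun A \<phi>"
  and states_unit: "\<phi> \<in> states e A \<Longrightarrow> \<phi> e = 1"
  and states_positive: "\<phi> \<in> states e A \<Longrightarrow> a \<in> A \<Longrightarrow> positive_op a \<Longrightarrow> 0 \<le> \<phi> a"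
  by (auto simp: states_def clin_fun_def)

text \<open>A self-adjoint \<open>a\<close> is at least \<open>- norm a\<close> times the unit,
  where the unit is \<open>e\<close> and not the identity. Since \<open>a\<close> equals its corner,
  the quadratic form at \<open>x\<close> only sees \<open>y\<close>, the image of \<open>x\<close>
  under \<open>e\<close>, and there Cauchy-Schwarz bounds it.\<close>

lemma positive_shift:
  assumes a: "a \<in> A" "adj a = a"
  shows "positive_op (complex_of_real (norm a) *\<^sub>C e + a)" (is "positive_op ?p")
  unfolding positive_op_def
proof (intro conjI allI)
  show "clinear_op ?p" using a by (intro clinear_in add_in scaleC_in unit_in)
  fix x
  define y where "y = blinfun_apply e x"
  have "cinner (blinfun_apply e x) x = cinner y y"
    by (metis adj_rel adj_unit blinfun_apply_blinfun_compose unit_idem unit_in y_def)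
  moreover have "cinner (blinfun_apply a x) x = cinner (blinfun_apply a y) y"
    by (metis adj_rel adj_unit blinfun_apply_blinfun_compose corner[OF a(1)] unit_in y_def)
  ultimately have *: "cinner (blinfun_apply ?p x) x = norm a * (norm y)\<^sup>2 + cinner (blinfun_apply a y) y"
    by (simp add: blinfun.add_left cinner_add_left cinner_scaleC_left cinner_self)
  have im: "Im (cinner (blinfun_apply a y) y) = 0"
    using adj_rel[OF a(1), of y y] a(2) cinner_commute[of y "blinfun_apply a y"]
    by (metis complex_In_mult_cnj_zero complex_cnj_cancel_iff add_cancel_right_right cnj.simps(2) equation_minus_iff neg_equal_zero)
  have "cmod (cinner (blinfun_apply a y) y) \<le> norm a * norm y * norm y"
    by (intro order.trans[OF cinner_cauchy_schwarz] mult_right_mono norm_blinfun) simp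
  then have "\<bar>Re (cinner (blinfun_apply a y) y)\<bar> \<le> norm a * (norm y)\<^sup>2"
    using abs_Re_le_cmod[of "cinner (blinfun_apply a y) y"] by (simp add: power2_eq_square mult.assoc)
  then show "0 \<le> cinner (blinfun_apply ?p x) x"
    unfolding * by (simp add: less_eq_complex_def im)
qed

text \<open>\<open>positive_shift\<close> is applied to \<open>a\<close> and to \<open>- a\<close>.
  Being nonnegative in the order of the complex numbers includes being real, so both conclusions
  come out together.\<close>

lemma state_selfadjoint:
  assumes \<phi>: "\<phi> \<in> states e A" and a: "a \<in> A" "adj a = a"
  shows "Im (\<phi> a) = 0" "\<bar>Re (\<phi> a)\<bar> \<le> norm a"
proof -
  have *: "0 \<le> complex_of_real (norm b) + \<phi> b" if "b \<in> A" "adj b = b" for b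
    using states_positive[OF \<phi> _ positive_shift[OF that]] that
    by (simp add: add_in scaleC_in unit_in clin_fun_add[OF states_clin_fun[OF \<phi>]]
        clin_fun_scale[OF states_clin_fun[OF \<phi>]] states_unit[OF \<phi>])
  have "0 \<le> complex_of_real (norm a) - \<phi> a"
    using *[of "- a"] adj_scaleC[OF a(1), of "-1"] a
    by (simp add: uminus_in clin_fun_minus[OF states_clin_fun[OF \<phi>]] scaleC_blinfun_simps)
  with *[OF a] show "Im (\<phi> a) = 0" "\<bar>Re (\<phi> a)\<bar> \<le> norm a"
    by (auto simp: less_eq_complex_def)
qed

text \<open>The real and imaginary parts of \<open>a\<close>, up to scalars \<open>a + adj a\<close>
  and \<open>\<i>\<close> times \<open>a - adj a\<close>, are self-adjoint and thus have real
  values.\<close>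

lemma state_adj:
  assumes \<phi>: "\<phi> \<in> states e A" and a: "a \<in> A"
  shows "\<phi> (adj a) = cnj (\<phi> a)"
proof -
  note l = clin_fun_add[OF states_clin_fun[OF \<phi>]] clin_fun_scale[OF states_clin_fun[OF \<phi>]]
  have "adj (a + adj a) = a + adj a"
    using a by (simp add: adj_add adj_in adj_adj add.commute)
  from state_selfadjoint(1)[OF \<phi> _ this]
  have 1: "Im (\<phi> a) + Im (\<phi> (adj a)) = 0" using a by (simp add: l adj_in add_in)
  have "adj (\<i> *\<^sub>C a + (- \<i>) *\<^sub>C adj a) = \<i> *\<^sub>C a + (- \<i>) *\<^sub>C adj a"
    using a by (simp add: adj_add adj_in adj_adj adj_scaleC scaleC_in add.commute)
  from state_selfadjoint(1)[OF \<phi> _ this]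
  have 2: "Re (\<phi> a) - Re (\<phi> (adj a)) = 0" using a by (simp add: l adj_in add_in scaleC_in)
  from 1 2 show ?thesis by (simp add: complex_eq_iff)
qed

lemma state_norm_le:
  assumes \<phi>: "\<phi> \<in> states e A" and a: "a \<in> A"
  shows "cmod (\<phi> a) \<le> norm a"
proof (cases "\<phi> a = 0")
  case False
  note l = clin_fun_add[OF states_clin_fun[OF \<phi>]] clin_fun_scale[OF states_clin_fun[OF \<phi>]]
  define w where "w = cnj (\<phi> a) / cmod (\<phi> a)"
  have w: "cmod w = 1" using False by (simp add: w_def norm_divide)
  have wa: "w * \<phi> a = cmod (\<phi> a)"
    using False by (simp add: w_def complex_norm_square[symmetric] mult.commute power2_eq_square)
  define h where "h = (1/2) *\<^sub>C (w *\<^sub>C a + adj (w *\<^sub>C a))"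
  have hA: "h \<in> A" unfolding h_def using a by (intro scaleC_in add_in adj_in)
  have "adj h = h"
    unfolding h_def using a by (simp add: adj_scaleC adj_add adj_in adj_adj scaleC_in add_in add.commute scaleC_blinfun_simps)
  have "\<phi> h = cmod (\<phi> a)"
    unfolding h_def using a by (simp add: l state_adj[OF \<phi>] scaleC_in add_in adj_in wa flip: complex_cnj_mult)
  with state_selfadjoint(2)[OF \<phi> hA \<open>adj h = h\<close>] have "cmod (\<phi> a) \<le> norm h" by simp
  also have "\<dots> \<le> (norm (w *\<^sub>C a) + norm (adj (w *\<^sub>C a))) / 2"
    unfolding h_def norm_scaleC_blinfun[of "1/2"] using norm_triangle_ineq[of "w *\<^sub>C a" "adj (w *\<^sub>C a)"]
    by (simp add: norm_divide)
  also have "\<dots> = norm a" using a by (simp add: norm_adj scaleC_in norm_scaleC_blinfun w)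
  finally show ?thesis .
qed simp

end


section \<open>Lip-norms from finite-rank approximation\<close>

text \<open>
  The approximation condition replaces total boundedness of the Lip-ball modulo scalars: up to a
  multiple of the unit, elements are approximated by bounded combinations of a finite set.
  The combination is described by its values under linear functionals.
\<close>

locale lip_system = op_sys e A
  for e :: "'h::complex_hilbert_space \<Rightarrow>\<^sub>L 'h" and A :: "('h \<Rightarrow>\<^sub>L 'h) set" +
  fixes N :: "('h \<Rightarrow>\<^sub>L 'h) \<Rightarrow> real"
  assumes N_nonneg: "0 \<le> N a"
    and N_add: "a \<in> A \<Longrightarrow> b \<in> A \<Longrightarrow> N (a + b) \<le> N a + N b"
    and N_scaleC: "a \<in> A \<Longrightarrow> N (c *\<^sub>C a) = cmod c * N a"
    and N_adj: "a \<in> A \<Longrightarrow> N (adj a) = N a"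
    and N_eq_0: "a \<in> A \<Longrightarrow> N a = 0 \<Longrightarrow> \<exists>c. a = c *\<^sub>C e"
    and N_unit: "N e = 0"
    and N_closed: "(\<And>n. X n \<in> A) \<Longrightarrow> a \<in> A \<Longrightarrow> X \<longlonglongrightarrow> a \<Longrightarrow> (\<And>n::nat. N (X n) \<le> r) \<Longrightarrow> N a \<le> r"
    and N_approx: "\<epsilon> > 0 \<Longrightarrow> \<exists>F K. finite F \<and> F \<subseteq> A \<and> 0 \<le> K \<and>
      (\<forall>a\<in>A. \<exists>v\<in>A. norm (a - v) \<le> \<epsilon> * N a \<and>
        (\<forall>\<phi>. clin_fun A \<phi> \<longrightarrow> cmod (\<phi> v) \<le> norm a * cmod (\<phi> e) + K * N a * (\<Sum>x\<in>F. cmod (\<phi> x))))"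
begin

abbreviation L :: "('h \<Rightarrow>\<^sub>L 'h) \<Rightarrow> ennreal" where "L a \<equiv> ennreal (N a)"

text \<open>By homogeneity \<open>a\<close> is scaled into the Lip-ball; dividing by
  \<open>N a + 1\<close> rather than by \<open>N a\<close> covers the multiples of the unit.\<close>

lemma state_dist_bound:
  assumes \<phi>: "\<phi> \<in> states e A" and \<psi>: "\<psi> \<in> states e A" and a: "a \<in> A"
    and d: "state_dist A L \<phi> \<psi> < ennreal \<epsilon>" and \<epsilon>: "0 < \<epsilon>"
  shows "cmod (\<phi> a - \<psi> a) < (N a + 1) * \<epsilon>"
proof -
  have p: "0 < N a + 1" using N_nonneg[of a] by simp
  define b where "b = complex_of_real (1 / (N a + 1)) *\<^sub>C a"
  have b: "b \<in> A" unfolding b_def by (intro scaleC_in a)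
  have "N b \<le> 1" unfolding b_def N_scaleC[OF a] norm_of_real using p by simp
  then have "ennreal (cmod (\<phi> b - \<psi> b)) \<le> state_dist A L \<phi> \<psi>"
    unfolding state_dist_def using b by (intro SUP_upper) auto
  then have "ennreal (cmod (\<phi> b - \<psi> b)) < ennreal \<epsilon>" using d by order
  then have "cmod (\<phi> b - \<psi> b) < \<epsilon>" using \<epsilon> by (simp add: ennreal_less_iff)
  also have "\<phi> b - \<psi> b = complex_of_real (1 / (N a + 1)) * (\<phi> a - \<psi> a)"
    unfolding b_def clin_fun_scale[OF states_clin_fun[OF \<phi>] a] clin_fun_scale[OF states_clin_fun[OF \<psi>] a]
    by (simp only: right_diff_distrib)
  also have "cmod \<dots> = cmod (\<phi> a - \<psi> a) / (N a + 1)"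
    using p by (simp only: norm_mult norm_of_real) simp
  finally show ?thesis using p by (simp add: field_simps)
qed

lemma topspace_weak_star: "topspace (weak_star e A) = states e A"
  unfolding weak_star_def by (auto simp: states_def PiE_def)

text \<open>The easy direction: by \<open>state_dist_bound\<close> every evaluation is Lipschitz for
  the state metric, and a basic weak-* open set constrains only finitely many evaluations.\<close>

lemma weak_star_openD:
  assumes U: "openin (weak_star e A) U" and \<phi>: "\<phi> \<in> U"
  shows "\<exists>\<epsilon>>0. \<forall>\<psi>\<in>states e A. state_dist A L \<phi> \<psi> < ennreal \<epsilon> \<longrightarrow> \<psi> \<in> U"
proof -
  obtain T where T: "openin (product_topology (\<lambda>_. euclidean) A) T" "U = T \<inter> states e A"
    using U by (auto simp: weak_star_def openin_subtopology)
  obtain V where V: "finite {i \<in> A. V i \<noteq> UNIV}" "\<And>i. i \<in> A \<Longrightarrow> open (V i)"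
     "\<phi> \<in> Pi\<^sub>E A V" "Pi\<^sub>E A V \<subseteq> T"
    using T(1)[unfolded openin_product_topology_alt] \<phi> T(2)
    by (auto simp flip: open_openin)
  define J where "J = {i \<in> A. V i \<noteq> UNIV}"
  have "\<exists>d. d > 0 \<and> ball (\<phi> i) d \<subseteq> V i" if "i \<in> J" for i
    using V(2,3) that by (metis (no_types, lifting) J_def PiE_mem mem_Collect_eq open_contains_ball)
  then obtain d where d: "\<And>i. i \<in> J \<Longrightarrow> d i > 0" "\<And>i. i \<in> J \<Longrightarrow> ball (\<phi> i) (d i) \<subseteq> V i" by metis
  \<comment> \<open>The inserted 1 keeps the minimum meaningful when no coordinate is
    constrained.\<close>
  define \<epsilon> where "\<epsilon> = Min (insert 1 ((\<lambda>i. d i / (N i + 1)) ` J))"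
  have finJ: "finite J" using V(1) by (simp add: J_def)
  have p: "0 < N i + 1" for i using N_nonneg[of i] by simp
  have \<epsilon>: "\<epsilon> > 0" unfolding \<epsilon>_def using finJ d(1) p by (subst Min_gr_iff) auto
  have "\<psi> \<in> U" if \<psi>: "\<psi> \<in> states e A" "state_dist A L \<phi> \<psi> < ennreal \<epsilon>" for \<psi>
  proof -
    have "\<psi> i \<in> V i" if i: "i \<in> A" for i
    proof (cases "i \<in> J")
      case True
      have "cmod (\<phi> i - \<psi> i) < (N i + 1) * \<epsilon>"
        using \<phi> T(2) by (intro state_dist_bound \<psi> i \<epsilon>) auto
      also have "\<dots> \<le> (N i + 1) * (d i / (N i + 1))"
        using True finJ p[of i] by (intro mult_left_mono) (auto simp: \<epsilon>_def less_imp_le)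
      also have "\<dots> = d i" using p[of i] by simp
      finally show ?thesis using d(2)[OF True] by (auto simp: dist_norm subset_iff)
    next
      case False
      then show ?thesis using i by (auto simp: J_def)
    qed
    moreover have "\<psi> \<in> extensional A" using \<psi> by (auto simp: states_def)
    ultimately show ?thesis using V(4) T(2) \<psi>(1) by (auto simp: PiE_def)
  qed
  then show ?thesis using \<epsilon> by blast
qed

text \<open>The substantial direction: a metric ball contains a weak-* neighbourhood. The difference
  of two states vanishes at the unit, so the term of \<open>N_approx\<close> with
  \<open>norm a\<close>, which is unbounded on the Lip-ball, drops out, and the finitely many values
  on \<open>F\<close> control the whole Lip-ball.\<close>

lemma weak_star_openI:
  assumes U: "U \<subseteq> states e A"
    and op: "\<And>\<phi>. \<phi> \<in> U \<Longrightarrow> \<exists>\<epsilon>>0. \<forall>\<psi>\<in>states e A. state_dist A L \<phi> \<psi> < ennreal \<epsilon> \<longrightarrow> \<psi> \<in> U"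
  shows "openin (weak_star e A) U"
proof (subst openin_subopen, intro ballI)
  fix \<phi> assume \<phi>U: "\<phi> \<in> U"
  then have \<phi>: "\<phi> \<in> states e A" using U by blast
  obtain \<epsilon> where \<epsilon>: "\<epsilon> > 0" "\<And>\<psi>. \<psi> \<in> states e A \<Longrightarrow> state_dist A L \<phi> \<psi> < ennreal \<epsilon> \<Longrightarrow> \<psi> \<in> U"
    using op[OF \<phi>U] by blast
  \<comment> \<open>The approximation error \<open>\<epsilon>/8\<close> is counted once for each
    state, and the finite part will add \<open>\<epsilon>/4\<close>. The total
    \<open>\<epsilon>/2\<close> leaves room for a strict inequality after taking the
    supremum.\<close>
  obtain F K where FK: "finite F" "F \<subseteq> A" "0 \<le> K"
    and ap: "\<And>a. a \<in> A \<Longrightarrow> \<exists>v\<in>A. norm (a - v) \<le> \<epsilon>/8 * N a \<and>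
        (\<forall>\<phi>. clin_fun A \<phi> \<longrightarrow> cmod (\<phi> v) \<le> norm a * cmod (\<phi> e) + K * N a * (\<Sum>x\<in>F. cmod (\<phi> x)))"
    using N_approx[of "\<epsilon>/8"] \<epsilon>(1) by auto
  define g where "g \<psi> = (\<Sum>x\<in>F. cmod (\<psi> x - \<phi> x))" for \<psi>
  define T where "T = {\<psi> \<in> topspace (weak_star e A). g \<psi> \<in> {..<\<epsilon> / (4 * (K + 1))}}"
  have cont: "continuous_map (weak_star e A) euclidean (\<lambda>\<psi>. \<psi> x)" if "x \<in> F" for x
    unfolding weak_star_def
    by (intro continuous_map_from_subtopology continuous_map_product_projection) (use that FK in auto)
  have "openin (weak_star e A) T"
    unfolding T_def g_def
    by (rule openin_continuous_map_preimage[where Y = euclidean])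
       (intro continuous_map_sum continuous_map_norm continuous_map_diff cont FK continuous_map_const[THEN iffD2] disjI2, auto)
  moreover have "\<phi> \<in> T" using \<epsilon>(1) FK(3) \<phi> by (simp add: T_def g_def topspace_weak_star)
  moreover have "T \<subseteq> U"
  proof
    fix \<psi> assume "\<psi> \<in> T"
    then have \<psi>: "\<psi> \<in> states e A" and g: "g \<psi> < \<epsilon> / (4 * (K + 1))"
      by (auto simp: T_def topspace_weak_star)
    have g0: "0 \<le> g \<psi>" by (simp add: g_def sum_nonneg)
    have Kg: "K * g \<psi> \<le> \<epsilon> / 4"
    proof -
      have "K * g \<psi> \<le> (K + 1) * (\<epsilon> / (4 * (K + 1)))"
        using g g0 FK(3) by (intro mult_mono) auto
      also have "\<dots> = \<epsilon> / 4" using FK(3) by (simp add: divide_simps)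
      finally show ?thesis .
    qed
    have cf: "clin_fun A (\<lambda>a. \<psi> a - \<phi> a)"
      using states_clin_fun[OF \<phi>] states_clin_fun[OF \<psi>] by (auto simp: clin_fun_def algebra_simps)
    have "cmod (\<phi> a - \<psi> a) \<le> \<epsilon> / 2" if a: "a \<in> A" "N a \<le> 1" for a
    proof -
      obtain v where v: "v \<in> A" "norm (a - v) \<le> \<epsilon>/8 * N a"
        "cmod (\<psi> v - \<phi> v) \<le> norm a * cmod (\<psi> e - \<phi> e) + K * N a * (\<Sum>x\<in>F. cmod (\<psi> x - \<phi> x))"
        using ap[OF a(1)] cf by blast
      have "norm (a - v) \<le> \<epsilon>/8" using v(2) a(2) \<epsilon>(1) N_nonneg[of a]
        by (smt (verit) divide_nonneg_nonneg mult_left_le)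
      then have 1: "cmod (\<phi> (a - v)) \<le> \<epsilon>/8" "cmod (\<psi> (a - v)) \<le> \<epsilon>/8"
        using state_norm_le[OF \<phi> diff_in[OF a(1) v(1)]] state_norm_le[OF \<psi> diff_in[OF a(1) v(1)]] by linarith+
      have "cmod (\<psi> v - \<phi> v) \<le> K * N a * g \<psi>"
        using v(3) by (simp add: states_unit[OF \<phi>] states_unit[OF \<psi>] g_def)
      also have "\<dots> \<le> K * 1 * g \<psi>" using a(2) FK(3) g0 by (intro mult_right_mono mult_left_mono) auto
      also have "\<dots> \<le> \<epsilon>/4" using Kg by simp
      finally have 2: "cmod (\<psi> v - \<phi> v) \<le> \<epsilon>/4" .
      have "\<phi> a - \<psi> a = \<phi> (a - v) - \<psi> (a - v) - (\<psi> v - \<phi> v)"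
        by (simp add: clin_fun_diff[OF states_clin_fun[OF \<phi>] a(1) v(1)] clin_fun_diff[OF states_clin_fun[OF \<psi>] a(1) v(1)])
      also have "cmod \<dots> \<le> \<epsilon>/8 + \<epsilon>/8 + \<epsilon>/4"
        by (intro norm_triangle_le_diff add_mono 1 2)
      finally show ?thesis by simp
    qed
    then have "state_dist A L \<phi> \<psi> \<le> ennreal (\<epsilon> / 2)"
      unfolding state_dist_def by (intro SUP_least) (auto intro: ennreal_leI)
    also have "\<dots> < ennreal \<epsilon>" using \<epsilon>(1) by (simp add: ennreal_less_iff)
    finally show "\<psi> \<in> U" using \<epsilon>(2)[OF \<psi>] by blast
  qed
  ultimately show "\<exists>T. openin (weak_star e A) T \<and> \<phi> \<in> T \<and> T \<subseteq> U" by blast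
qed

lemma lip_norm: "lip_norm e A L"
  unfolding lip_norm_def
proof (intro conjI ballI allI)
  show "L (a + b) \<le> L a + L b" if "a \<in> A" "b \<in> A" for a b
    using N_add[OF that] by (simp add: N_nonneg ennreal_leI flip: ennreal_plus)
  show "L (c *\<^sub>C a) = ennreal (cmod c) * L a" if "a \<in> A" for c a
    by (simp add: N_scaleC[OF that] ennreal_mult N_nonneg)
  show "L (adj a) = L a" if "a \<in> A" for a by (simp add: N_adj[OF that])
  show "(L a = 0) = (\<exists>c. a = c *\<^sub>C e)" if "a \<in> A" for a
  proof
    assume "L a = 0"
    then have "N a = 0" using N_nonneg[of a] by (simp add: ennreal_eq_0_iff)
    then show "\<exists>c. a = c *\<^sub>C e" by (rule N_eq_0[OF that])
  next
    assume "\<exists>c. a = c *\<^sub>C e"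
    then obtain c where "a = c *\<^sub>C e" ..
    then show "L a = 0" using N_scaleC[OF unit_in, of c] by (simp add: N_unit)
  qed
  \<comment> \<open>\<open>N\<close> is real-valued, so every element has finite Lip-norm.\<close>
  show "A \<subseteq> closure {a \<in> A. L a < \<infinity>}" by (rule subset_trans[OF _ closure_subset]) auto
  show "openin (weak_star e A) U = (U \<subseteq> states e A \<and>
      (\<forall>\<phi>\<in>U. \<exists>\<epsilon>>0. \<forall>\<psi>\<in>states e A. state_dist A L \<phi> \<psi> < ennreal \<epsilon> \<longrightarrow> \<psi> \<in> U))" for U
  proof (intro iffI conjI ballI)
    assume U: "openin (weak_star e A) U"
    show "U \<subseteq> states e A" using openin_subset[OF U] unfolding topspace_weak_star .
    show "\<exists>\<epsilon>>0. \<forall>\<psi>\<in>states e A. state_dist A L \<phi> \<psi> < ennreal \<epsilon> \<longrightarrow> \<psi> \<in> U" if "\<phi> \<in> U" for \<phi>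
      using that by (rule weak_star_openD[OF U])
  qed (elim conjE, rule weak_star_openI, assumption, erule bspec)
  show "closedin (top_of_set A) {a \<in> A. L a \<le> r}" for r
  proof (cases r)
    case (real q)
    define S where "S = {a \<in> A. N a \<le> q}"
    have eq: "{a \<in> A. L a \<le> r} = S" by (simp add: S_def real ennreal_le_iff)
    have "A \<inter> closure S \<subseteq> S"
    proof
      fix a assume "a \<in> A \<inter> closure S"
      then have a: "a \<in> A" "a \<in> closure S" by simp_all
      from a(2) obtain X where X: "\<forall>n. X n \<in> S" "X \<longlonglongrightarrow> a"
        unfolding closure_sequential by blast
      have "N a \<le> q" using X(1) by (intro N_closed[OF _ a(1) X(2)]) (simp_all add: S_def)
      then show "a \<in> S" using a(1) by (simp add: S_def)
    qed
    moreover have "S \<subseteq> A" by (auto simp: S_def)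
    ultimately have S: "S = A \<inter> closure S" using closure_subset[of S] by blast
    show ?thesis unfolding eq by (subst S) (intro closedin_closed_Int closed_closure)
  next
    case top
    have "{a \<in> A. L a \<le> r} = A" by (simp add: top)
    then show ?thesis by simp
  qed
qed

lemma compact_quantum_metric_space: "compact_quantum_metric_space e A L"
  using operator_system lip_norm by (simp add: compact_quantum_metric_space_def)

end


section \<open>Bridges between Lip-normed operator systems\<close>

lemma dsum_op_add: "dsum_op a b + dsum_op a' b' = dsum_op (a + a') (b + b')"
  by (rule blinfun_eqI) (simp add: blinfun.add_left)

lemma dsum_op_diff: "dsum_op a b - dsum_op a' b' = dsum_op (a - a') (b - b')"
  by (rule blinfun_eqI) (simp add: blinfun.diff_left)

lemma dsum_op_scaleC: "c *\<^sub>C dsum_op a b = dsum_op (c *\<^sub>C a) (c *\<^sub>C b)"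
  by (rule blinfun_eqI) (simp add: scaleC_prod_def)

lemma dsum_op_compose: "dsum_op a b o\<^sub>L dsum_op a' b' = dsum_op (a o\<^sub>L a') (b o\<^sub>L b')"
  by (rule blinfun_eqI) simp

lemma norm_fst_snd_le: "norm (fst x) \<le> norm x" "norm (snd x) \<le> norm x"
  by (metis norm_fst_le prod.collapse, metis norm_snd_le prod.collapse)

lemma norm_dsum_op_le: "norm (dsum_op a b) \<le> norm a + norm b"
proof (rule norm_blinfun_bound)
  fix x
  have "norm (blinfun_apply (dsum_op a b) x) \<le> norm (blinfun_apply a (fst x)) + norm (blinfun_apply b (snd x))"
    by (simp add: norm_Pair_le)
  also have "\<dots> \<le> norm a * norm (fst x) + norm b * norm (snd x)" by (intro add_mono norm_blinfun)
  also have "\<dots> \<le> norm a * norm x + norm b * norm x"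
    by (intro add_mono mult_left_mono norm_fst_snd_le norm_ge_zero)
  finally show "norm (blinfun_apply (dsum_op a b) x) \<le> (norm a + norm b) * norm x"
    by (simp add: algebra_simps)
qed simp

lemma norm_coord1_le:
  fixes T :: "('a::complex_hilbert_space \<times> 'b::complex_hilbert_space) \<Rightarrow>\<^sub>L ('a \<times> 'b)"
  shows "norm (coord1 T) \<le> norm T"
proof (rule norm_blinfun_bound)
  fix x
  have "norm (blinfun_apply (coord1 T) x) \<le> norm (blinfun_apply T (x, 0))" by (simp add: norm_fst_snd_le)
  also have "\<dots> \<le> norm T * norm (x, 0 :: 'b)" by (rule norm_blinfun)
  finally show "norm (blinfun_apply (coord1 T) x) \<le> norm T * norm x" by (simp add: norm_Pair)
qed simp

lemma norm_coord2_le: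
  fixes T :: "('a::complex_hilbert_space \<times> 'b::complex_hilbert_space) \<Rightarrow>\<^sub>L ('a \<times> 'b)"
  shows "norm (coord2 T) \<le> norm T"
proof (rule norm_blinfun_bound)
  fix x
  have "norm (blinfun_apply (coord2 T) x) \<le> norm (blinfun_apply T (0, x))" by (simp add: norm_fst_snd_le)
  also have "\<dots> \<le> norm T * norm (0 :: 'a, x)" by (rule norm_blinfun)
  finally show "norm (blinfun_apply (coord2 T) x) \<le> norm T * norm x" by (simp add: norm_Pair)
qed simp

lemma coord_diff: "coord1 (S - T) = coord1 S - coord1 T" "coord2 (S - T) = coord2 S - coord2 T"
  by (auto intro!: blinfun_eqI simp: blinfun.diff_left)

lemma tendsto_coord1: "X \<longlonglongrightarrow> T \<Longrightarrow> (\<lambda>n. coord1 (X n)) \<longlonglongrightarrow> coord1 T"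
  unfolding tendsto_dist_iff[of _ "coord1 T"]
  by (rule tendsto_sandwich[of "\<lambda>_. 0" _ _ "\<lambda>n. dist (X n) T"])
     (auto simp: dist_norm norm_coord1_le tendsto_norm_zero LIM_zero simp flip: coord_diff)

lemma tendsto_coord2: "X \<longlonglongrightarrow> T \<Longrightarrow> (\<lambda>n. coord2 (X n)) \<longlonglongrightarrow> coord2 T"
  unfolding tendsto_dist_iff[of _ "coord2 T"]
  by (rule tendsto_sandwich[of "\<lambda>_. 0" _ _ "\<lambda>n. dist (X n) T"])
     (auto simp: dist_norm norm_coord2_le tendsto_norm_zero LIM_zero simp flip: coord_diff)

text \<open>The interface between the estimates on the group and the distance. Only
  \<open>\<tau>\<close> enters the Lip-norm on the direct sum; \<open>\<sigma>\<close> serves to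
  lift elements of \<open>B\<close> and to pull back states of \<open>A\<close>.\<close>

locale lip_bridge = A: lip_system e A NA + B: lip_system f B NB
  for e :: "'h::complex_hilbert_space \<Rightarrow>\<^sub>L 'h" and A NA
    and f :: "'k::complex_hilbert_space \<Rightarrow>\<^sub>L 'k" and B NB +
  fixes \<tau> :: "('h \<Rightarrow>\<^sub>L 'h) \<Rightarrow> ('k \<Rightarrow>\<^sub>L 'k)" and \<sigma> :: "('k \<Rightarrow>\<^sub>L 'k) \<Rightarrow> ('h \<Rightarrow>\<^sub>L 'h)" and \<epsilon> :: real
  assumes \<epsilon>: "\<epsilon> > 0"
    and \<tau>_in: "a \<in> A \<Longrightarrow> \<tau> a \<in> B"
    and \<tau>_add: "a \<in> A \<Longrightarrow> a' \<in> A \<Longrightarrow> \<tau> (a + a') = \<tau> a + \<tau> a'"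
    and \<tau>_scaleC: "a \<in> A \<Longrightarrow> \<tau> (c *\<^sub>C a) = c *\<^sub>C \<tau> a"
    and \<tau>_adj: "a \<in> A \<Longrightarrow> \<tau> (adj a) = adj (\<tau> a)"
    and \<tau>_unit: "\<tau> e = f"
    and \<tau>_norm: "a \<in> A \<Longrightarrow> norm (\<tau> a) \<le> norm a"
    and \<tau>_positive: "a \<in> A \<Longrightarrow> positive_op a \<Longrightarrow> positive_op (\<tau> a)"
    and \<tau>_N: "a \<in> A \<Longrightarrow> NB (\<tau> a) \<le> NA a"
    and \<sigma>_in: "b \<in> B \<Longrightarrow> \<sigma> b \<in> A"
    and \<sigma>_add: "b \<in> B \<Longrightarrow> b' \<in> B \<Longrightarrow> \<sigma> (b + b') = \<sigma> b + \<sigma> b'"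
    and \<sigma>_scaleC: "b \<in> B \<Longrightarrow> \<sigma> (c *\<^sub>C b) = c *\<^sub>C \<sigma> b"
    and \<sigma>_unit: "\<sigma> f = e"
    and \<sigma>_norm: "b \<in> B \<Longrightarrow> norm (\<sigma> b) \<le> norm b"
    and \<sigma>_positive: "b \<in> B \<Longrightarrow> positive_op b \<Longrightarrow> positive_op (\<sigma> b)"
    and \<sigma>_N: "b \<in> B \<Longrightarrow> NA (\<sigma> b) \<le> NB b"
    and \<sigma>_\<tau>: "a \<in> A \<Longrightarrow> norm (a - \<sigma> (\<tau> a)) \<le> \<epsilon> * NA a"
    and \<tau>_\<sigma>: "b \<in> B \<Longrightarrow> norm (b - \<tau> (\<sigma> b)) \<le> \<epsilon> * NB b"
begin

definition N :: "(('h \<times> 'k) \<Rightarrow>\<^sub>L ('h \<times> 'k)) \<Rightarrow> real" where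
  "N T = max (NA (coord1 T)) (max (NB (coord2 T)) (norm (coord2 T - \<tau> (coord1 T)) / \<epsilon>))"

lemma N_dsum_op: "N (dsum_op a b) = max (NA a) (max (NB b) (norm (b - \<tau> a) / \<epsilon>))"
  by (simp add: N_def)

lemma N_dsum_op_le: "N (dsum_op a b) \<le> r \<longleftrightarrow> NA a \<le> r \<and> NB b \<le> r \<and> norm (b - \<tau> a) \<le> \<epsilon> * r"
  using \<epsilon> by (auto simp: N_dsum_op field_simps)

lemma dsumE: assumes "T \<in> dsum A B" obtains a b where "a \<in> A" "b \<in> B" "T = dsum_op a b"
  using assms by (auto simp: dsum_def)

lemma dsum_op_in: "a \<in> A \<Longrightarrow> b \<in> B \<Longrightarrow> dsum_op a b \<in> dsum A B"
  by (auto simp: dsum_def)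

lemma \<tau>_minus: "a \<in> A \<Longrightarrow> \<tau> (- a) = - \<tau> a"
  using \<tau>_scaleC[of a "-1"] by (simp add: scaleC_blinfun_simps)

lemma \<tau>_diff: "a \<in> A \<Longrightarrow> a' \<in> A \<Longrightarrow> \<tau> (a - a') = \<tau> a - \<tau> a'"
  using \<tau>_add[OF _ A.uminus_in, of a a'] by (simp add: \<tau>_minus)

lemma \<sigma>_diff: "b \<in> B \<Longrightarrow> b' \<in> B \<Longrightarrow> \<sigma> (b - b') = \<sigma> b - \<sigma> b'"
  using \<sigma>_add[OF _ B.uminus_in, of b b'] \<sigma>_scaleC[of b' "-1"] by (simp add: scaleC_blinfun_simps)

lemma adj_rel_dsum:
  "a \<in> A \<Longrightarrow> b \<in> B \<Longrightarrow>
    cinner (blinfun_apply (dsum_op (adj a) (adj b)) x) y = cinner x (blinfun_apply (dsum_op a b) y)"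
  by (simp add: cinner_prod_def A.adj_rel B.adj_rel)

lemma adj_dsum_op: "a \<in> A \<Longrightarrow> b \<in> B \<Longrightarrow> adj (dsum_op a b) = dsum_op (adj a) (adj b)"
  by (rule adj_eqI) (rule adj_rel_dsum)

lemma op_sys_dsum: "op_sys (dsum_op e f) (dsum A B)"
proof
  show "operator_system (dsum_op e f) (dsum A B)"
    unfolding operator_system_def
  proof (intro conjI ballI allI)
    show "dsum_op e f o\<^sub>L dsum_op e f = dsum_op e f"
      by (simp add: dsum_op_compose A.unit_idem B.unit_idem)
    show "adj (dsum_op e f) = dsum_op e f"
      by (simp add: adj_dsum_op A.unit_in B.unit_in A.adj_unit B.adj_unit)
    show "dsum_op e f \<in> dsum A B" by (intro dsum_op_in A.unit_in B.unit_in)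
    fix T assume "T \<in> dsum A B"
    then obtain a b where T: "a \<in> A" "b \<in> B" "T = dsum_op a b" by (rule dsumE)
    show "clinear_op T" using A.clinear_in[OF T(1)] B.clinear_in[OF T(2)]
      by (simp add: T(3) clinear_op_def scaleC_prod_def)
    show "dsum_op e f o\<^sub>L T o\<^sub>L dsum_op e f = T"
      by (simp add: T(3) dsum_op_compose A.corner[OF T(1)] B.corner[OF T(2)])
    show "c *\<^sub>C T \<in> dsum A B" for c
      by (simp add: T(3) dsum_op_scaleC dsum_op_in A.scaleC_in B.scaleC_in T)
    show "adj T \<in> dsum A B" using T by (simp add: adj_dsum_op dsum_op_in A.adj_in B.adj_in)
    fix T' assume "T' \<in> dsum A B"
    then obtain a' b' where T': "a' \<in> A" "b' \<in> B" "T' = dsum_op a' b'" by (rule dsumE)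
    show "T + T' \<in> dsum A B" using T T' by (simp add: dsum_op_add dsum_op_in A.add_in B.add_in)
  qed
next
  fix T x y assume "T \<in> dsum A B"
  then obtain a b where T: "a \<in> A" "b \<in> B" "T = dsum_op a b" by (rule dsumE)
  show "cinner (blinfun_apply (adj T) x) y = cinner x (blinfun_apply T y)"
    unfolding T(3) adj_dsum_op[OF T(1,2)] by (rule adj_rel_dsum[OF T(1,2)])
qed

text \<open>\<open>\<tau>\<close> is linear and contractive, hence continuous, so all three bounds
  contained in \<open>N\<close> pass to the limit.\<close>

lemma N_closed_dsum:
  assumes X: "\<And>n::nat. X n \<in> dsum A B" and T: "T \<in> dsum A B" and lim: "X \<longlonglongrightarrow> T" and r: "\<And>n. N (X n) \<le> r"
  shows "N T \<le> r"
proof -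
  obtain a b where ab: "a \<in> A" "b \<in> B" "T = dsum_op a b" using T by (rule dsumE)
  have "\<forall>n. \<exists>a b. a \<in> A \<and> b \<in> B \<and> X n = dsum_op a b" using X by (meson dsumE)
  then obtain a' b' where X': "\<And>n. a' n \<in> A" "\<And>n. b' n \<in> B" "\<And>n. X n = dsum_op (a' n) (b' n)" by metis
  have la: "a' \<longlonglongrightarrow> a" and lb: "b' \<longlonglongrightarrow> b"
    using tendsto_coord1[OF lim] tendsto_coord2[OF lim] by (simp_all add: X' ab)
  have *: "NA (a' n) \<le> r" "NB (b' n) \<le> r" "norm (b' n - \<tau> (a' n)) \<le> \<epsilon> * r" for n
    using r[of n] by (auto simp: X' N_dsum_op_le)
  have "(\<lambda>n. \<tau> (a' n)) \<longlonglongrightarrow> \<tau> a"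
    unfolding tendsto_dist_iff[of _ "\<tau> a"]
  proof (rule tendsto_sandwich[of "\<lambda>_. 0" _ _ "\<lambda>n. dist (a' n) a"])
    show "\<forall>\<^sub>F n in sequentially. dist (\<tau> (a' n)) (\<tau> a) \<le> dist (a' n) a"
      using \<tau>_norm[OF A.diff_in[OF X'(1) ab(1)]] by (simp add: dist_norm \<tau>_diff[OF X'(1) ab(1)])
  qed (use la in \<open>auto simp flip: tendsto_dist_iff\<close>)
  then have "(\<lambda>n. norm (b' n - \<tau> (a' n))) \<longlonglongrightarrow> norm (b - \<tau> a)" by (intro tendsto_intros lb)
  then have "norm (b - \<tau> a) \<le> \<epsilon> * r"
    using *(3) by (intro LIMSEQ_le_const2) auto
  moreover have "NA a \<le> r" using A.N_closed[OF X'(1) ab(1) la *(1)] .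
  moreover have "NB b \<le> r" using B.N_closed[OF X'(2) ab(2) lb *(2)] .
  ultimately show ?thesis by (simp add: ab N_dsum_op_le)
qed

text \<open>The pair \<open>(a, b)\<close> is split as
  \<open>(a, \<tau> a) + (0, b - \<tau> a)\<close>. The first summand is approximated in
  \<open>A\<close> and carried over to the graph of \<open>\<tau>\<close>, the second one is
  approximated in \<open>B\<close>.\<close>

lemma N_approx_dsum:
  assumes \<delta>: "\<delta> > 0"
  shows "\<exists>F K. finite F \<and> F \<subseteq> dsum A B \<and> 0 \<le> K \<and>
      (\<forall>a\<in>dsum A B. \<exists>v\<in>dsum A B. norm (a - v) \<le> \<delta> * N a \<and>
        (\<forall>\<phi>. clin_fun (dsum A B) \<phi> \<longrightarrow>
          cmod (\<phi> v) \<le> norm a * cmod (\<phi> (dsum_op e f)) + K * N a * (\<Sum>x\<in>F. cmod (\<phi> x))))"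
proof -
  interpret D: op_sys "dsum_op e f" "dsum A B" by (rule op_sys_dsum)
  obtain FA KA where FA: "finite FA" "FA \<subseteq> A" "0 \<le> KA"
    and apA: "\<And>a. a \<in> A \<Longrightarrow> \<exists>v\<in>A. norm (a - v) \<le> \<delta>/4 * NA a \<and>
        (\<forall>\<phi>. clin_fun A \<phi> \<longrightarrow> cmod (\<phi> v) \<le> norm a * cmod (\<phi> e) + KA * NA a * (\<Sum>x\<in>FA. cmod (\<phi> x)))"
    using A.N_approx[of "\<delta>/4"] \<delta> by auto
  obtain FB KB where FB: "finite FB" "FB \<subseteq> B" "0 \<le> KB"
    and apB: "\<And>a. a \<in> B \<Longrightarrow> \<exists>v\<in>B. norm (a - v) \<le> \<delta>/4 * NB a \<and>
        (\<forall>\<phi>. clin_fun B \<phi> \<longrightarrow> cmod (\<phi> v) \<le> norm a * cmod (\<phi> f) + KB * NB a * (\<Sum>x\<in>FB. cmod (\<phi> x)))"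
    using B.N_approx[of "\<delta>/4"] \<delta> by auto
  \<comment> \<open>\<open>f\<close> is inserted because \<open>dsum_op 0 f\<close> is not the unit
    of the direct sum: its coefficient has to be controlled by the Lip-norm, which works as
    \<open>norm (b - \<tau> a)\<close> is at most \<open>\<epsilon> * N T\<close>.\<close>
  define F where "F = (\<lambda>x. dsum_op x (\<tau> x)) ` FA \<union> dsum_op 0 ` insert f FB"
  \<comment> \<open>\<open>KA\<close> belongs to the graph part, \<open>\<epsilon>\<close> to
    \<open>dsum_op 0 f\<close>, and \<open>2 * KB\<close> to \<open>b - \<tau> a\<close>, whose
    Lip-norm is at most twice that of the pair.\<close>
  define K where "K = KA + \<epsilon> + 2 * KB"
  have F: "finite F" "F \<subseteq> dsum A B"
    using FA FB by (auto simp: F_def intro!: dsum_op_in \<tau>_in A.zero_in B.unit_in)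
  have "\<exists>v\<in>dsum A B. norm (T - v) \<le> \<delta> * N T \<and>
        (\<forall>\<phi>. clin_fun (dsum A B) \<phi> \<longrightarrow>
          cmod (\<phi> v) \<le> norm T * cmod (\<phi> (dsum_op e f)) + K * N T * (\<Sum>x\<in>F. cmod (\<phi> x)))"
    if TA: "T \<in> dsum A B" for T
  proof -
    obtain a b where T: "a \<in> A" "b \<in> B" "T = dsum_op a b" using TA by (rule dsumE)
    define M where "M = N T"
    have M: "NA a \<le> M" "NB b \<le> M" "norm (b - \<tau> a) \<le> \<epsilon> * M"
      using N_dsum_op_le[of a b M] by (auto simp: M_def T)
    then have M0: "0 \<le> M" using A.N_nonneg[of a] by simp
    define b' where "b' = b - \<tau> a"
    have b': "b' \<in> B" unfolding b'_def by (intro B.diff_in \<tau>_in T)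
    have "NB (b + - \<tau> a) \<le> NB b + NB (- \<tau> a)" by (intro B.N_add B.uminus_in \<tau>_in T)
    also have "NB (- \<tau> a) = NB (\<tau> a)"
      using B.N_scaleC[OF \<tau>_in[OF T(1)], of "-1"] by (simp add: scaleC_blinfun_simps)
    finally have Nb': "NB b' \<le> 2 * M" using \<tau>_N[OF T(1)] M by (simp add: b'_def)
    obtain u where u: "u \<in> A" "norm (a - u) \<le> \<delta>/4 * NA a"
      "\<And>\<phi>. clin_fun A \<phi> \<Longrightarrow> cmod (\<phi> u) \<le> norm a * cmod (\<phi> e) + KA * NA a * (\<Sum>x\<in>FA. cmod (\<phi> x))"
      using apA[OF T(1)] by blast
    obtain w where w: "w \<in> B" "norm (b' - w) \<le> \<delta>/4 * NB b'"
      "\<And>\<phi>. clin_fun B \<phi> \<Longrightarrow> cmod (\<phi> w) \<le> norm b' * cmod (\<phi> f) + KB * NB b' * (\<Sum>x\<in>FB. cmod (\<phi> x))"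
      using apB[OF b'] by blast
    define v where "v = dsum_op u (\<tau> u) + dsum_op 0 w"
    have v: "v \<in> dsum A B" unfolding v_def by (intro D.add_in dsum_op_in u \<tau>_in w A.zero_in)
    have "T - v = dsum_op (a - u) (\<tau> (a - u) + (b' - w))"
      by (simp add: T v_def dsum_op_add dsum_op_diff \<tau>_diff u b'_def algebra_simps)
    then have "norm (T - v) \<le> norm (a - u) + norm (\<tau> (a - u) + (b' - w))"
      by (simp only: norm_dsum_op_le)
    also have "\<dots> \<le> norm (a - u) + (norm (a - u) + norm (b' - w))"
      by (intro add_left_mono norm_triangle_mono \<tau>_norm A.diff_in T u order_refl)
    \<comment> \<open>The graph part errs in both coordinates and \<open>b'\<close> has Lip-norm up
      to \<open>2 * M\<close>; this uses up the four quarters of \<open>\<delta>\<close>.\<close>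
    also have "\<dots> \<le> \<delta>/4 * M + (\<delta>/4 * M + \<delta>/4 * (2 * M))"
      using M Nb' \<delta> by (intro add_mono order.trans[OF u(2)] order.trans[OF w(2)] mult_left_mono) auto
    also have "\<dots> = \<delta> * M" by simp
    finally have 1: "norm (T - v) \<le> \<delta> * M" .
    have 2: "cmod (\<phi> v) \<le> norm T * cmod (\<phi> (dsum_op e f)) + K * M * (\<Sum>x\<in>F. cmod (\<phi> x))"
      if \<phi>: "clin_fun (dsum A B) \<phi>" for \<phi>
    proof -
      define \<Sigma> where "\<Sigma> = (\<Sum>x\<in>F. cmod (\<phi> x))"
      have sub: "(\<Sum>x\<in>H. cmod (\<phi> x)) \<le> \<Sigma>" if "H \<subseteq> F" for H
        unfolding \<Sigma>_def using F(1) that by (intro sum_mono2) auto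
      have \<Sigma>0: "0 \<le> \<Sigma>" by (simp add: \<Sigma>_def sum_nonneg)
      have cA: "clin_fun A (\<lambda>a. \<phi> (dsum_op a (\<tau> a)))"
        using \<phi> unfolding clin_fun_def
        by (auto simp: \<tau>_add \<tau>_scaleC dsum_op_in \<tau>_in simp flip: dsum_op_add dsum_op_scaleC)
      have cB: "clin_fun B (\<lambda>b. \<phi> (dsum_op 0 b))"
        unfolding clin_fun_def
      proof (intro conjI ballI allI)
        show "\<phi> (dsum_op 0 (b + b')) = \<phi> (dsum_op 0 b) + \<phi> (dsum_op 0 b')" if "b \<in> B" "b' \<in> B" for b b'
          using D.clin_fun_add[OF \<phi> dsum_op_in[OF A.zero_in that(1)] dsum_op_in[OF A.zero_in that(2)]]
          by (simp add: dsum_op_add)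
        show "\<phi> (dsum_op 0 (c *\<^sub>C b)) = c * \<phi> (dsum_op 0 b)" if "b \<in> B" for c b
          using D.clin_fun_scale[OF \<phi> dsum_op_in[OF A.zero_in that], of c]
          by (simp add: dsum_op_scaleC scaleC_blinfun_simps)
      qed
      have "(\<Sum>x\<in>FA. cmod (\<phi> (dsum_op x (\<tau> x)))) = (\<Sum>x\<in>(\<lambda>x. dsum_op x (\<tau> x)) ` FA. cmod (\<phi> x))"
        by (subst sum.reindex) (auto intro!: inj_onI dest: arg_cong[where f = coord1])
      also have "\<dots> \<le> \<Sigma>" by (rule sub) (auto simp: F_def)
      finally have sA: "(\<Sum>x\<in>FA. cmod (\<phi> (dsum_op x (\<tau> x)))) \<le> \<Sigma>" .
      have "(\<Sum>x\<in>FB. cmod (\<phi> (dsum_op 0 x))) = (\<Sum>x\<in>dsum_op 0 ` FB. cmod (\<phi> x))"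
        by (subst sum.reindex) (auto intro!: inj_onI dest: arg_cong[where f = coord2])
      also have "\<dots> \<le> \<Sigma>" by (rule sub) (auto simp: F_def)
      finally have sB: "(\<Sum>x\<in>FB. cmod (\<phi> (dsum_op 0 x))) \<le> \<Sigma>" .
      have sf: "cmod (\<phi> (dsum_op 0 f)) \<le> \<Sigma>"
        using sub[of "{dsum_op 0 f}"] by (auto simp: F_def)
      have "cmod (\<phi> v) \<le> cmod (\<phi> (dsum_op u (\<tau> u))) + cmod (\<phi> (dsum_op 0 w))"
        unfolding v_def using norm_triangle_ineq
        by (simp add: D.clin_fun_add[OF \<phi>] dsum_op_in u \<tau>_in w A.zero_in)
      also have "\<dots> \<le> (norm a * cmod (\<phi> (dsum_op e f)) + KA * NA a * \<Sigma>) + (norm b' * \<Sigma> + KB * NB b' * \<Sigma>)"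
        by (intro add_mono order.trans[OF u(3)[OF cA]] order.trans[OF w(3)[OF cB]] mult_left_mono sA sB sf)
           (auto simp: \<tau>_unit FA FB A.N_nonneg B.N_nonneg)
      also have "\<dots> \<le> (norm T * cmod (\<phi> (dsum_op e f)) + KA * M * \<Sigma>) + (\<epsilon> * M * \<Sigma> + KB * (2 * M) * \<Sigma>)"
        using norm_coord1_le[of T] M Nb' \<Sigma>0 FA(3) FB(3)
        by (intro add_mono mult_right_mono mult_left_mono) (auto simp: T(3) b'_def)
      also have "\<dots> = norm T * cmod (\<phi> (dsum_op e f)) + K * M * \<Sigma>" by (simp add: K_def algebra_simps)
      finally show ?thesis by (simp add: \<Sigma>_def)
    qed
    from v 1 2 show ?thesis unfolding M_def by blast
  qed
  moreover have "0 \<le> K" using FA(3) FB(3) \<epsilon> by (simp add: K_def)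
  ultimately show ?thesis using F by blast
qed

lemma lip_system_dsum: "lip_system (dsum_op e f) (dsum A B) N"
proof -
  interpret D: op_sys "dsum_op e f" "dsum A B" by (rule op_sys_dsum)
  show ?thesis
  proof
    fix T
    show "0 \<le> N T" using A.N_nonneg by (simp add: N_def max.coboundedI1)
  next
    show "N (dsum_op e f) = 0" by (simp add: N_dsum_op A.N_unit B.N_unit \<tau>_unit)
  next
    fix T T' assume "T \<in> dsum A B" "T' \<in> dsum A B"
    then obtain a b a' b' where T: "a \<in> A" "b \<in> B" "T = dsum_op a b" "a' \<in> A" "b' \<in> B" "T' = dsum_op a' b'"
      by (metis dsumE)
    have M: "NA a \<le> N T" "NB b \<le> N T" "norm (b - \<tau> a) \<le> \<epsilon> * N T"
       "NA a' \<le> N T'" "NB b' \<le> N T'" "norm (b' - \<tau> a') \<le> \<epsilon> * N T'"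
      using N_dsum_op_le[of a b "N T"] N_dsum_op_le[of a' b' "N T'"] by (auto simp: T)
    have "NA (a + a') \<le> N T + N T'" using A.N_add[OF T(1,4)] M by simp
    moreover have "NB (b + b') \<le> N T + N T'" using B.N_add[OF T(2,5)] M by simp
    moreover have "norm ((b + b') - \<tau> (a + a')) \<le> \<epsilon> * (N T + N T')"
      using norm_triangle_ineq[of "b - \<tau> a" "b' - \<tau> a'"] M
      by (simp add: \<tau>_add T algebra_simps)
    ultimately show "N (T + T') \<le> N T + N T'" by (simp only: T(3,6) dsum_op_add N_dsum_op_le)
  next
    fix T c assume "T \<in> dsum A B"
    then obtain a b where T: "a \<in> A" "b \<in> B" "T = dsum_op a b" by (metis dsumE)
    have "c *\<^sub>C b - \<tau> (c *\<^sub>C a) = c *\<^sub>C (b - \<tau> a)"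
      by (simp add: \<tau>_scaleC T scaleC_blinfun_diff)
    then have "norm (c *\<^sub>C b - \<tau> (c *\<^sub>C a)) = cmod c * norm (b - \<tau> a)"
      by (simp only: norm_scaleC_blinfun)
    then show "N (c *\<^sub>C T) = cmod c * N T"
      by (simp add: T dsum_op_scaleC N_dsum_op A.N_scaleC B.N_scaleC max_mult_distrib_left)
  next
    fix T assume "T \<in> dsum A B"
    then obtain a b where T: "a \<in> A" "b \<in> B" "T = dsum_op a b" by (metis dsumE)
    have "adj (b - \<tau> a) = adj b - \<tau> (adj a)"
      using B.adj_add[OF T(2) B.uminus_in[OF \<tau>_in[OF T(1)]]] B.adj_scaleC[OF \<tau>_in[OF T(1)], of "-1"]
      by (simp add: \<tau>_adj T scaleC_blinfun_simps)
    then have "norm (adj b - \<tau> (adj a)) = norm (b - \<tau> a)"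
      using B.norm_adj[OF B.diff_in[OF T(2) \<tau>_in[OF T(1)]]] by simp
    then show "N (adj T) = N T"
      by (simp add: T adj_dsum_op N_dsum_op A.N_adj B.N_adj)
  next
    fix T assume "T \<in> dsum A B" and 0: "N T = 0"
    then obtain a b where T: "a \<in> A" "b \<in> B" "T = dsum_op a b" by (metis dsumE)
    have "NA a \<le> 0" "norm (b - \<tau> a) \<le> 0" using N_dsum_op_le[of a b 0] 0 by (auto simp: T)
    then have "NA a = 0" and b: "b = \<tau> a" using A.N_nonneg[of a] by auto
    then obtain c where "a = c *\<^sub>C e" using A.N_eq_0[OF T(1)] by blast
    then show "\<exists>c. T = c *\<^sub>C dsum_op e f"
      using b by (auto simp: T dsum_op_scaleC \<tau>_scaleC A.unit_in \<tau>_unit)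
  qed (fact N_closed_dsum N_approx_dsum)+
qed

interpretation D: lip_system "dsum_op e f" "dsum A B" N by (rule lip_system_dsum)

text \<open>The infima are attained: at \<open>b = \<tau> a\<close>, where the third term of
  \<open>N\<close> vanishes, and at \<open>a = \<sigma> b\<close>, where
  \<open>\<tau>_\<sigma>\<close> bounds that term by \<open>NB b\<close>.\<close>

lemma N_admissible: "(\<lambda>T. ennreal (N T)) \<in> admissible_lip_norms e A (\<lambda>a. ennreal (NA a)) f B (\<lambda>b. ennreal (NB b))"
  unfolding admissible_lip_norms_def
proof (intro CollectI conjI ballI D.lip_norm)
  fix a assume a: "a \<in> A"
  show "ennreal (NA a) = (INF b\<in>B. ennreal (N (dsum_op a b)))"
  proof (rule antisym)
    show "ennreal (NA a) \<le> (INF b\<in>B. ennreal (N (dsum_op a b)))"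
      by (intro INF_greatest ennreal_leI) (simp add: N_dsum_op)
    have "N (dsum_op a (\<tau> a)) \<le> NA a"
      using \<epsilon> by (auto simp: N_dsum_op_le \<tau>_N[OF a] A.N_nonneg)
    then show "(INF b\<in>B. ennreal (N (dsum_op a b))) \<le> ennreal (NA a)"
      by (intro INF_lower2[OF \<tau>_in[OF a]] ennreal_leI)
  qed
next
  fix b assume b: "b \<in> B"
  show "ennreal (NB b) = (INF a\<in>A. ennreal (N (dsum_op a b)))"
  proof (rule antisym)
    show "ennreal (NB b) \<le> (INF a\<in>A. ennreal (N (dsum_op a b)))"
      by (intro INF_greatest ennreal_leI) (simp add: N_dsum_op)
    have "N (dsum_op (\<sigma> b) b) \<le> NB b" by (simp add: N_dsum_op_le \<sigma>_N[OF b] \<tau>_\<sigma>[OF b])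
    then show "(INF a\<in>A. ennreal (N (dsum_op a b))) \<le> ennreal (NB b)"
      by (intro INF_lower2[OF \<sigma>_in[OF b]] ennreal_leI)
  qed
qed

lemma states_pullback_\<tau>:
  assumes "\<psi> \<in> states f B"
  shows "restrict (\<psi> \<circ> \<tau>) A \<in> states e A"
  using B.states_clin_fun[OF assms] B.states_positive[OF assms] B.states_unit[OF assms]
  by (auto simp: states_def A.add_in A.scaleC_in A.unit_in \<tau>_add \<tau>_scaleC \<tau>_in \<tau>_positive \<tau>_unit
      B.clin_fun_add B.clin_fun_scale)

lemma states_pullback_\<sigma>:
  assumes "\<phi> \<in> states e A"
  shows "restrict (\<phi> \<circ> \<sigma>) B \<in> states f B"
  using A.states_clin_fun[OF assms] A.states_positive[OF assms] A.states_unit[OF assms]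
  by (auto simp: states_def B.add_in B.scaleC_in B.unit_in \<sigma>_add \<sigma>_scaleC \<sigma>_in \<sigma>_positive \<sigma>_unit
      A.clin_fun_add A.clin_fun_scale)

text \<open>A state \<open>\<phi>\<close> of \<open>A\<close> is matched with
  \<open>\<phi> \<circ> \<sigma>\<close>, a state \<open>\<psi>\<close> of \<open>B\<close> with
  \<open>\<psi> \<circ> \<tau>\<close>. On the Lip-ball \<open>b\<close> is
  \<open>\<epsilon>\<close>-close to \<open>\<tau> a\<close>; the first matching costs a second
  \<open>\<epsilon>\<close> for replacing \<open>a\<close> by
  \<open>\<sigma> (\<tau> a)\<close>.\<close>

theorem dist_q_le: "dist_q e A (\<lambda>a. ennreal (NA a)) f B (\<lambda>b. ennreal (NB b)) \<le> ennreal (2 * \<epsilon>)"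
proof -
  let ?d = "state_dist (dsum A B) (\<lambda>T. ennreal (N T))"
  let ?p = "\<lambda>\<phi>. restrict (\<phi> \<circ> coord1) (dsum A B)" and ?q = "\<lambda>\<psi>. restrict (\<psi> \<circ> coord2) (dsum A B)"
  have dI: "?d (?p \<phi>) (?q \<psi>) \<le> ennreal (2 * \<epsilon>)"
    if "\<And>a b. a \<in> A \<Longrightarrow> b \<in> B \<Longrightarrow> NA a \<le> 1 \<Longrightarrow> norm (b - \<tau> a) \<le> \<epsilon> \<Longrightarrow> cmod (\<phi> a - \<psi> b) \<le> 2 * \<epsilon>" for \<phi> \<psi>
    unfolding state_dist_def
  proof (intro SUP_least ennreal_leI)
    fix T assume "T \<in> {T \<in> dsum A B. ennreal (N T) \<le> 1}"
    then obtain a b where T: "a \<in> A" "b \<in> B" "T = dsum_op a b" "N (dsum_op a b) \<le> 1"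
      by (auto elim: dsumE)
    then show "cmod (?p \<phi> T - ?q \<psi> T) \<le> 2 * \<epsilon>"
      using that[of a b] by (simp add: N_dsum_op_le dsum_op_in)
  qed
  have 1: "(INF y\<in>?q ` states f B. ?d (?p \<phi>) y) \<le> ennreal (2 * \<epsilon>)" if \<phi>: "\<phi> \<in> states e A" for \<phi>
  proof (rule INF_lower2)
    show "?q (restrict (\<phi> \<circ> \<sigma>) B) \<in> ?q ` states f B" using states_pullback_\<sigma>[OF \<phi>] by blast
    show "?d (?p \<phi>) (?q (restrict (\<phi> \<circ> \<sigma>) B)) \<le> ennreal (2 * \<epsilon>)"
    proof (rule dI)
      fix a b assume ab: "a \<in> A" "b \<in> B" "NA a \<le> 1" "norm (b - \<tau> a) \<le> \<epsilon>"
      have "norm (a - \<sigma> (\<tau> a)) \<le> \<epsilon> * 1" using \<epsilon> ab by (intro order.trans[OF \<sigma>_\<tau>] mult_left_mono) auto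
      moreover have "norm (\<sigma> (\<tau> a - b)) \<le> \<epsilon>"
        using ab by (intro order.trans[OF \<sigma>_norm]) (auto simp: B.diff_in \<tau>_in norm_minus_commute)
      moreover have "a - \<sigma> b = (a - \<sigma> (\<tau> a)) + \<sigma> (\<tau> a - b)" using ab by (simp add: \<sigma>_diff \<tau>_in)
      ultimately have "norm (a - \<sigma> b) \<le> 2 * \<epsilon>" by (simp only:) (rule norm_triangle_le, simp)
      then have "cmod (\<phi> (a - \<sigma> b)) \<le> 2 * \<epsilon>"
        using A.state_norm_le[OF \<phi> A.diff_in[OF ab(1) \<sigma>_in[OF ab(2)]]] by simp
      then show "cmod (\<phi> a - restrict (\<phi> \<circ> \<sigma>) B b) \<le> 2 * \<epsilon>"
        using ab by (simp add: A.clin_fun_diff[OF A.states_clin_fun[OF \<phi>]] \<sigma>_in)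
    qed
  qed
  have 2: "(INF x\<in>?p ` states e A. ?d x (?q \<psi>)) \<le> ennreal (2 * \<epsilon>)" if \<psi>: "\<psi> \<in> states f B" for \<psi>
  proof (rule INF_lower2)
    show "?p (restrict (\<psi> \<circ> \<tau>) A) \<in> ?p ` states e A" using states_pullback_\<tau>[OF \<psi>] by blast
    show "?d (?p (restrict (\<psi> \<circ> \<tau>) A)) (?q \<psi>) \<le> ennreal (2 * \<epsilon>)"
    proof (rule dI)
      fix a b assume ab: "a \<in> A" "b \<in> B" "NA a \<le> 1" "norm (b - \<tau> a) \<le> \<epsilon>"
      have "cmod (\<psi> (\<tau> a - b)) \<le> 2 * \<epsilon>"
        using B.state_norm_le[OF \<psi> B.diff_in[OF \<tau>_in[OF ab(1)] ab(2)]] ab(4) \<epsilon> by (simp add: norm_minus_commute)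
      then show "cmod (restrict (\<psi> \<circ> \<tau>) A a - \<psi> b) \<le> 2 * \<epsilon>"
        using ab by (simp add: B.clin_fun_diff[OF B.states_clin_fun[OF \<psi>]] \<tau>_in)
    qed
  qed
  have "hausdorff_dist ?d (?p ` states e A) (?q ` states f B) \<le> ennreal (2 * \<epsilon>)"
    unfolding hausdorff_dist_def by (intro max.boundedI SUP_least) (use 1 2 in auto)
  then show ?thesis unfolding dist_q_def by (rule INF_lower2[OF N_admissible])
qed

end


section \<open>Word length and growth\<close>

locale word_group = group G for G :: "('a, 'm) monoid_scheme" (structure) +
  fixes S :: "'a set"
  assumes finite_S: "finite S" and S_carrier: "S \<subseteq> carrier G"
    and S_inv: "(\<lambda>x. inv x) ` S = S" and S_gen: "generate G S = carrier G"
begin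

abbreviation len :: "'a \<Rightarrow> nat" where "len \<equiv> word_length G S"
abbreviation eval_word :: "'a list \<Rightarrow> 'a" where "eval_word w \<equiv> foldr (\<otimes>) w \<one>"
abbreviation Bal :: "real \<Rightarrow> 'a set" where "Bal \<equiv> word_ball G S"

lemma eval_word_closed: "set w \<subseteq> S \<Longrightarrow> eval_word w \<in> carrier G"
  using S_carrier by (induction w) auto

lemma eval_word_append: "set u \<subseteq> S \<Longrightarrow> set v \<subseteq> S \<Longrightarrow> eval_word (u @ v) = eval_word u \<otimes> eval_word v"
  using S_carrier by (induction u) (auto simp: eval_word_closed m_assoc subset_iff)

lemma eval_word_rev_inv: "set w \<subseteq> S \<Longrightarrow> eval_word (rev (map (\<lambda>x. inv x) w)) = inv (eval_word w)"
proof (induction w)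
  case (Cons x w)
  have x: "x \<in> carrier G" "inv x \<in> S" using Cons.prems S_carrier S_inv by auto
  have "set (rev (map (\<lambda>x. inv x) w)) \<subseteq> S" using Cons.prems S_inv by auto
  then show ?case using Cons x by (simp add: eval_word_append eval_word_closed inv_mult_group del: foldr_append)
qed simp

lemma word_exists:
  assumes "x \<in> carrier G" shows "\<exists>w. set w \<subseteq> S \<and> eval_word w = x"
proof -
  have "x \<in> generate G S" using assms S_gen by simp
  then show ?thesis
  proof induction
    case one
    then show ?case by (intro exI[of _ "[]"]) simp
  next
    case (incl h)
    then show ?case using S_carrier by (intro exI[of _ "[h]"]) auto
  next
    \<comment> \<open>By symmetry of \<open>S\<close> the inverse of a generator is a word of length
      one.\<close>
    case (inv h)
    then have "inv h \<in> S" using S_inv by blast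
    then show ?case using S_carrier by (intro exI[of _ "[inv h]"]) auto
  next
    case (eng h1 h2)
    then obtain u v where "set u \<subseteq> S" "eval_word u = h1" "set v \<subseteq> S" "eval_word v = h2" by blast
    then show ?case by (intro exI[of _ "u @ v"]) (simp add: eval_word_append del: foldr_append)
  qed
qed

lemma len_word:
  assumes "x \<in> carrier G" obtains w where "length w = len x" "set w \<subseteq> S" "eval_word w = x"
proof -
  have "\<exists>n w. length w = n \<and> set w \<subseteq> S \<and> eval_word w = x" using word_exists[OF assms] by blast
  then have "\<exists>w. length w = len x \<and> set w \<subseteq> S \<and> eval_word w = x"
    unfolding word_length_def by (rule LeastI_ex)
  then show ?thesis using that by blast
qed

lemma len_eval_word_le: "set w \<subseteq> S \<Longrightarrow> len (eval_word w) \<le> length w"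
  unfolding word_length_def by (rule Least_le) auto

lemma len_one: "len \<one> = 0"
  using len_eval_word_le[of "[]"] by simp

lemma len_eq_0: "x \<in> carrier G \<Longrightarrow> len x = 0 \<longleftrightarrow> x = \<one>"
  using len_one by (auto elim: len_word)

lemma len_mult_le: "x \<in> carrier G \<Longrightarrow> y \<in> carrier G \<Longrightarrow> len (x \<otimes> y) \<le> len x + len y"
  by (metis (no_types, lifting) Un_subset_iff eval_word_append len_eval_word_le len_word length_append set_append)

lemma len_inv_le: assumes "x \<in> carrier G" shows "len (inv x) \<le> len x"
proof -
  obtain w where w: "length w = len x" "set w \<subseteq> S" "eval_word w = x" by (rule len_word[OF assms])
  have "set (rev (map (\<lambda>x. inv x) w)) \<subseteq> S" using w S_inv by auto
  from len_eval_word_le[OF this] show ?thesis using w by (simp only: eval_word_rev_inv) simp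
qed

lemma len_inv: "x \<in> carrier G \<Longrightarrow> len (inv x) = len x"
  by (metis inv_closed inv_inv le_antisym len_inv_le)

lemma mem_Bal: "x \<in> Bal r \<longleftrightarrow> x \<in> carrier G \<and> real (len x) \<le> r"
  by (auto simp: word_ball_def)

lemma finite_Bal: "finite (Bal r)"
proof -
  have "Bal r \<subseteq> eval_word ` {w. set w \<subseteq> S \<and> length w \<le> nat \<lceil>r\<rceil>}"
  proof
    fix x assume "x \<in> Bal r"
    then have x: "x \<in> carrier G" "real (len x) \<le> r" by (auto simp: mem_Bal)
    then have "len x \<le> nat \<lceil>r\<rceil>" by linarith
    then show "x \<in> eval_word ` {w. set w \<subseteq> S \<and> length w \<le> nat \<lceil>r\<rceil>}"
      by (metis (mono_tags, lifting) image_eqI len_word mem_Collect_eq x(1))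
  qed
  then show ?thesis using finite_lists_length_le[OF finite_S] finite_surj by blast
qed

lemma one_in_Bal: "0 \<le> r \<Longrightarrow> \<one> \<in> Bal r"
  by (simp add: mem_Bal len_one)

end

text \<open>Rounding the exponent up to an integer is harmless for \<open>n \<ge> 1\<close> and
  makes it available as a number of iterations of the derivation.\<close>

lemma polynomial_growthE:
  assumes "polynomial_growth G S"
  obtains C :: real and p :: nat where "C > 0" "p > 0"
    "\<And>n. n \<ge> 1 \<Longrightarrow> real (card (word_ball G S (real n))) \<le> C * real n ^ p"
proof -
  obtain C k where Ck: "C > 0" "k > 0" "\<And>n. n \<ge> 1 \<Longrightarrow> real (card (word_ball G S (real n))) \<le> C * real n powr k"
    using assms unfolding polynomial_growth_def by blast
  have "real (card (word_ball G S (real n))) \<le> C * real n ^ nat \<lceil>k\<rceil>" if n: "n \<ge> 1" for n :: nat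
  proof -
    have "real n powr k \<le> real n powr real (nat \<lceil>k\<rceil>)" using n by (intro powr_mono) (auto, linarith)
    also have "\<dots> = real n ^ nat \<lceil>k\<rceil>" using n by (intro powr_realpow) auto
    finally have "C * real n powr k \<le> C * real n ^ nat \<lceil>k\<rceil>" using Ck(1) by simp
    then show ?thesis using Ck(3)[OF n] by linarith
  qed
  moreover have "nat \<lceil>k\<rceil> > 0" using Ck(2) by simp
  ultimately show ?thesis using that Ck(1) by blast
qed

locale poly_group = word_group G S for G :: "('a, 'm) monoid_scheme" (structure) and S +
  fixes C :: real and p :: nat
  assumes C_pos: "C > 0" and p_pos: "p > 0"
    and growth: "n \<ge> 1 \<Longrightarrow> real (card (Bal (real n))) \<le> C * real n ^ p"
begin

text \<open>A bound on finite partial sums is all that finitely supported coefficients call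
  for.\<close>

definition tail_bound :: "nat \<Rightarrow> real \<Rightarrow> bool" where
  "tail_bound R \<epsilon> \<longleftrightarrow> (\<forall>F. finite F \<longrightarrow> F \<subseteq> carrier G \<longrightarrow> (\<forall>x\<in>F. len x > R) \<longrightarrow>
     (\<Sum>x\<in>F. 1 / real (len x) ^ (p + 2)) \<le> \<epsilon>)"

lemma tail_boundD:
  "tail_bound R \<epsilon> \<Longrightarrow> finite F \<Longrightarrow> F \<subseteq> carrier G \<Longrightarrow> (\<forall>x\<in>F. len x > R) \<Longrightarrow>
    (\<Sum>x\<in>F. 1 / real (len x) ^ (p + 2)) \<le> \<epsilon>"
  by (simp only: tail_bound_def)

text \<open>The elements of length \<open>n\<close> lie in the ball of radius \<open>n\<close>, so
  they number at most \<open>C * n ^ p\<close> and contribute at most \<open>C / n ^ 2\<close>. The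
  exponent \<open>p + 2\<close> is chosen for this.\<close>

lemma tail_sum_small:
  assumes "\<epsilon> > 0"
  shows "\<exists>R. tail_bound R \<epsilon>"
proof -
  have "summable (\<lambda>n. inverse (real n ^ 2))" by (rule inverse_power_summable) simp
  moreover have "\<epsilon> / C > 0" using assms C_pos by simp
  ultimately obtain R where R: "\<And>m n. m \<ge> R \<Longrightarrow> norm (\<Sum>n=m..<n. inverse (real n ^ 2)) < \<epsilon> / C"
    unfolding summable_Cauchy by blast
  have "(\<Sum>x\<in>F. 1 / real (len x) ^ (p + 2)) \<le> \<epsilon>"
    if F: "finite F" "F \<subseteq> carrier G" "\<forall>x\<in>F. len x > R" for F
  proof -
    obtain M where M: "\<And>x. x \<in> F \<Longrightarrow> len x < M"
      using F(1) by (metis finite_imageI finite_nat_set_iff_bounded imageI)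
    have sub: "len ` F \<subseteq> {Suc R..<M}" using F(3) M by auto
    have "(\<Sum>x\<in>F. 1 / real (len x) ^ (p + 2))
        = (\<Sum>n\<in>len ` F. \<Sum>x\<in>{x \<in> F. len x = n}. 1 / real (len x) ^ (p + 2))"
      by (rule sum.image_gen[OF F(1)])
    also have "\<dots> \<le> (\<Sum>n\<in>len ` F. C * inverse (real n ^ 2))"
    proof (rule sum_mono)
      fix n assume "n \<in> len ` F"
      then have n: "n \<ge> 1" using sub by auto
      have "card {x \<in> F. len x = n} \<le> card (Bal (real n))"
        using F by (intro card_mono finite_Bal) (auto simp: mem_Bal)
      then have c: "real (card {x \<in> F. len x = n}) \<le> C * real n ^ p" using growth[OF n] by linarith
      have "(\<Sum>x\<in>{x \<in> F. len x = n}. 1 / real (len x) ^ (p + 2)) = real (card {x \<in> F. len x = n}) * (1 / real n ^ (p + 2))"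
        by simp
      also have "\<dots> \<le> (C * real n ^ p) * (1 / real n ^ (p + 2))" by (intro mult_right_mono c) simp
      also have "\<dots> = C * inverse (real n ^ 2)" using n by (simp add: power_add field_simps power2_eq_square)
      finally show "(\<Sum>x\<in>{x \<in> F. len x = n}. 1 / real (len x) ^ (p + 2)) \<le> C * inverse (real n ^ 2)" .
    qed
    also have "\<dots> \<le> (\<Sum>n=Suc R..<M. C * inverse (real n ^ 2))"
      using sub C_pos by (intro sum_mono2) auto
    also have "\<dots> = C * (\<Sum>n=Suc R..<M. inverse (real n ^ 2))" by (simp add: sum_distrib_left)
    also have "\<dots> \<le> C * (\<epsilon> / C)"
      using R[of "Suc R" M] C_pos by (intro mult_left_mono) auto
    also have "\<dots> = \<epsilon>" using C_pos by simp
    finally show ?thesis .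
  qed
  then show ?thesis unfolding tail_bound_def by blast
qed

text \<open>If every step of width \<open>R\<close> enlarged the ball by more than the factor
  \<open>1 / (1 - \<epsilon>)\<close>, the cardinalities would grow exponentially.\<close>

lemma slow_growth:
  fixes \<epsilon> :: real
  assumes \<epsilon>: "0 < \<epsilon>" "\<epsilon> < 1" and R: "R > 0"
  shows "\<exists>n. (1 - \<epsilon>) * card (Bal (real (Suc n * R))) \<le> card (Bal (real (n * R)))"
proof (rule ccontr)
  assume "\<not> ?thesis"
  then have less: "real (card (Bal (real (n * R)))) < (1 - \<epsilon>) * card (Bal (real (Suc n * R)))" for n
    by (meson not_le)
  have one: "1 \<le> (1 - \<epsilon>) ^ n * card (Bal (real (n * R)))" for n
  proof (induction n)
    case 0
    have "card (Bal 0) \<noteq> 0" using one_in_Bal[of 0] finite_Bal[of 0] by auto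
    then show ?case by simp
  next
    case (Suc n)
    have "(1 - \<epsilon>) ^ n * card (Bal (real (n * R))) \<le> (1 - \<epsilon>) ^ n * ((1 - \<epsilon>) * card (Bal (real (Suc n * R))))"
      using less[of n] \<epsilon> by (intro mult_left_mono) auto
    with Suc show ?case by (simp add: mult_ac)
  qed
  \<comment> \<open>The \<open>p\<close>-th root absorbs the polynomial factor:
    \<open>(1 - \<epsilon>) ^ n * n ^ p\<close> is the \<open>p\<close>-th power of
    \<open>n * y ^ n\<close>, which tends to 0.\<close>
  define y where "y = root p (1 - \<epsilon>)"
  have y: "0 \<le> y" "y < 1" "y ^ p = 1 - \<epsilon>"
    using \<epsilon> p_pos by (auto simp: y_def real_root_lt_1_iff)
  have "(\<lambda>n. real n * y ^ n) \<longlonglongrightarrow> 0" using powser_times_n_limit_0[of y] y by simp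
  then have "(\<lambda>n. C * real R ^ p * (real n * y ^ n) ^ p) \<longlonglongrightarrow> C * real R ^ p * 0 ^ p" by (intro tendsto_intros)
  then have "(\<lambda>n. C * real R ^ p * (real n * y ^ n) ^ p) \<longlonglongrightarrow> 0"
    by (simp only: zero_power[OF p_pos] mult_zero_right)
  then have "\<forall>\<^sub>F n in sequentially. C * real R ^ p * (real n * y ^ n) ^ p < 1"
    by (rule order_tendstoD) simp
  then obtain n where n: "n \<ge> 1" "C * real R ^ p * (real n * y ^ n) ^ p < 1"
    unfolding eventually_sequentially by (metis le_add1 le_add2)
  have "(y ^ n) ^ p = (1 - \<epsilon>) ^ n" by (metis power_mult mult.commute y(3))
  have "1 \<le> (1 - \<epsilon>) ^ n * card (Bal (real (n * R)))" by (rule one)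
  also have "\<dots> \<le> (1 - \<epsilon>) ^ n * (C * real (n * R) ^ p)"
    using growth[of "n * R"] n(1) R \<epsilon> by (intro mult_left_mono) auto
  also have "\<dots> = C * real R ^ p * (real n * y ^ n) ^ p"
    by (simp add: power_mult_distrib \<open>(y ^ n) ^ p = (1 - \<epsilon>) ^ n\<close> mult_ac)
  finally show False using n(2) by simp
qed

text \<open>Left multiplication by \<open>x\<close> adds at most \<open>R\<close> to the length, so
  it maps the ball of radius \<open>n * (R + 1)\<close> into that of radius
  \<open>(n + 1) * (R + 1)\<close>, and \<open>slow_growth\<close> makes the smaller ball almost all
  of the larger one. The width \<open>R + 1\<close> is positive even for
  \<open>R = 0\<close>.\<close>

lemma folner_ball:
  fixes \<epsilon> :: real
  assumes \<epsilon>: "0 < \<epsilon>" "\<epsilon> < 1"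
  shows "\<exists>r::nat. \<forall>x\<in>carrier G. len x \<le> R \<longrightarrow>
     (1 - \<epsilon>) * card (Bal (real r)) \<le> card {y \<in> Bal (real r). x \<otimes> y \<in> Bal (real r)}"
proof -
  obtain n where n: "(1 - \<epsilon>) * card (Bal (real (Suc n * Suc R))) \<le> card (Bal (real (n * Suc R)))"
    using slow_growth[OF \<epsilon>, of "Suc R"] by blast
  have "card (Bal (real (n * Suc R))) \<le> card {y \<in> Bal (real (Suc n * Suc R)). x \<otimes> y \<in> Bal (real (Suc n * Suc R))}"
    if x: "x \<in> carrier G" "len x \<le> R" for x
  proof (rule card_mono)
    show "finite {y \<in> Bal (real (Suc n * Suc R)). x \<otimes> y \<in> Bal (real (Suc n * Suc R))}" by (simp add: finite_Bal)
    show "Bal (real (n * Suc R)) \<subseteq> {y \<in> Bal (real (Suc n * Suc R)). x \<otimes> y \<in> Bal (real (Suc n * Suc R))}"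
    proof
      fix y assume "y \<in> Bal (real (n * Suc R))"
      then have y: "y \<in> carrier G" "len y \<le> n * Suc R" unfolding mem_Bal of_nat_le_iff by auto
      have "len (x \<otimes> y) \<le> Suc n * Suc R" "len y \<le> Suc n * Suc R"
        using len_mult_le[OF x(1) y(1)] x(2) y(2) by simp_all
      then show "y \<in> {y \<in> Bal (real (Suc n * Suc R)). x \<otimes> y \<in> Bal (real (Suc n * Suc R))}"
        unfolding mem_Collect_eq mem_Bal of_nat_le_iff using x y by simp
    qed
  qed
  then show ?thesis using n by (intro exI[of _ "Suc n * Suc R"]) (meson of_nat_mono order_trans)
qed

end


section \<open>Matrix entries of operators on square-summable families\<close>

lemma clinear_opD: "clinear_op T \<Longrightarrow> blinfun_apply T (c *\<^sub>C x) = c *\<^sub>C blinfun_apply T x"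
  by (simp add: clinear_op_def)

lemma clinear_op_add: "clinear_op S \<Longrightarrow> clinear_op T \<Longrightarrow> clinear_op (S + T)"
  and clinear_op_diff: "clinear_op S \<Longrightarrow> clinear_op T \<Longrightarrow> clinear_op (S - T)"
  and clinear_op_scaleC: "clinear_op S \<Longrightarrow> clinear_op (c *\<^sub>C S)"
  by (auto simp: clinear_op_def blinfun.bilinear_simps scaleC_add_right scaleC_scaleC mult.commute
      linear_diff[OF bounded_linear.linear[OF bounded_linear_scaleC]])

lemma clinear_op_compose: "clinear_op S \<Longrightarrow> clinear_op T \<Longrightarrow> clinear_op (S o\<^sub>L T)"
  by (simp add: clinear_op_def)

lemma clinear_op_zero: "clinear_op 0"
  by (simp add: clinear_op_def linear_0[OF bounded_linear.linear[OF bounded_linear_scaleC]])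

lemma clinear_op_sum: "(\<And>i. i \<in> I \<Longrightarrow> clinear_op (f i)) \<Longrightarrow> clinear_op (sum f I)"
  by (induction I rule: infinite_finite_induct) (auto intro: clinear_op_zero clinear_op_add)

lemma Rep_ell2_delta: "Rep_ell2 (delta y) x = (if x = y then 1 else 0)"
  by (simp add: delta.rep_eq)

lemma clinear_reindex_op: "inj_on h X \<Longrightarrow> clinear_op (reindex_op h X)"
  by (auto simp: clinear_op_def reindex_op_apply scaleC_ell2.rep_eq fun_eq_iff simp flip: Rep_ell2_inject)

lemma clinear_matrix_unit: "clinear_op (matrix_unit x y)"
  by (simp add: clinear_op_def matrix_unit.rep_eq scaleC_ell2.rep_eq scaleC_scaleC)

lemma norm_reindex_op_le: "inj_on h X \<Longrightarrow> norm (reindex_op h X) \<le> 1"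
  by (rule norm_blinfun_bound)
    (auto intro!: norm_ell2_leI simp: reindex_op_apply reindex_sum_le)

definition vec :: "('a \<Rightarrow> complex) \<Rightarrow> 'a set \<Rightarrow> 'a ell2" where
  "vec u X = (\<Sum>y\<in>X. u y *\<^sub>C delta y)"

lemma Rep_vec: "finite X \<Longrightarrow> Rep_ell2 (vec u X) x = (if x \<in> X then u x else 0)"
  by (simp add: vec_def Rep_ell2_sum scaleC_ell2.rep_eq Rep_ell2_delta if_distrib[of "\<lambda>z. _ * z"] cong: if_cong)

lemma norm_vec_le:
  assumes "finite X" shows "norm (vec u X) \<le> L2_set (\<lambda>x. cmod (u x)) X"
proof (rule norm_ell2_leI)
  fix F :: "'a set" assume "finite F"
  have "(\<Sum>x\<in>F. (cmod (Rep_ell2 (vec u X) x))\<^sup>2) = (\<Sum>x\<in>F \<inter> X. (cmod (u x))\<^sup>2)"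
    using \<open>finite F\<close> by (intro sum.mono_neutral_cong_right) (auto simp: Rep_vec assms)
  also have "\<dots> \<le> (\<Sum>x\<in>X. (cmod (u x))\<^sup>2)" by (intro sum_mono2 assms) auto
  also have "\<dots> = (L2_set (\<lambda>x. cmod (u x)) X)\<^sup>2" by (simp add: L2_set_def sum_nonneg)
  finally show "(\<Sum>x\<in>F. (cmod (Rep_ell2 (vec u X) x))\<^sup>2) \<le> (L2_set (\<lambda>x. cmod (u x)) X)\<^sup>2" .
qed simp

lemma L2_set_Rep_le: "finite X \<Longrightarrow> L2_set (\<lambda>x. cmod (Rep_ell2 \<xi> x)) X \<le> norm \<xi>"
  unfolding L2_set_def by (rule real_le_lsqrt) (auto intro: sum_le_norm_ell2_power2)

text \<open>The square of the truncation error is the tail of the sum of squares, that is, at most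
  \<open>(norm \<xi>)\<^sup>2\<close> minus the partial sum over \<open>X\<close>.\<close>

lemma tendsto_vec: "((\<lambda>X. vec (Rep_ell2 \<xi>) X) \<longlongrightarrow> \<xi>) (finite_subsets_at_top UNIV)"
proof -
  let ?f = "\<lambda>x. (cmod (Rep_ell2 \<xi> x))\<^sup>2"
  have le: "norm (\<xi> - vec (Rep_ell2 \<xi>) X) \<le> sqrt ((norm \<xi>)\<^sup>2 - sum ?f X)" if X: "finite X" for X
  proof (rule norm_ell2_leI)
    have nn: "0 \<le> (norm \<xi>)\<^sup>2 - sum ?f X" using sum_le_norm_ell2_power2[OF X, of \<xi>] by simp
    then show "0 \<le> sqrt ((norm \<xi>)\<^sup>2 - sum ?f X)" by simp
    fix F :: "'a set" assume F: "finite F"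
    have "(\<Sum>x\<in>F. (cmod (Rep_ell2 (\<xi> - vec (Rep_ell2 \<xi>) X) x))\<^sup>2) = (\<Sum>x\<in>F - X. ?f x)"
      using F by (intro sum.mono_neutral_cong_right) (auto simp: Rep_vec X minus_ell2.rep_eq)
    also have "\<dots> = sum ?f (F \<union> X) - sum ?f X"
      using F X sum.union_disjoint[of "F - X" X ?f] by (simp add: Un_Diff_cancel2 Diff_disjoint Int_commute)
    also have "\<dots> \<le> (norm \<xi>)\<^sup>2 - sum ?f X"
      using sum_le_norm_ell2_power2[of "F \<union> X" \<xi>] F X by simp
    also have "\<dots> = (sqrt ((norm \<xi>)\<^sup>2 - sum ?f X))\<^sup>2" using nn by simp
    finally show "(\<Sum>x\<in>F. (cmod (Rep_ell2 (\<xi> - vec (Rep_ell2 \<xi>) X) x))\<^sup>2) \<le> (sqrt ((norm \<xi>)\<^sup>2 - sum ?f X))\<^sup>2" .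
  qed
  have "(sum ?f \<longlongrightarrow> (norm \<xi>)\<^sup>2) (finite_subsets_at_top UNIV)"
    unfolding norm_ell2_power2 using has_sum_infsum[OF summable_Rep_ell2] by (simp add: has_sum_def)
  then have "((\<lambda>X. sqrt ((norm \<xi>)\<^sup>2 - sum ?f X)) \<longlongrightarrow> sqrt ((norm \<xi>)\<^sup>2 - (norm \<xi>)\<^sup>2)) (finite_subsets_at_top UNIV)"
    by (intro tendsto_intros)
  then have "((\<lambda>X. sqrt ((norm \<xi>)\<^sup>2 - sum ?f X)) \<longlongrightarrow> 0) (finite_subsets_at_top UNIV)" by simp
  then have "((\<lambda>X. \<xi> - vec (Rep_ell2 \<xi>) X) \<longlongrightarrow> 0) (finite_subsets_at_top UNIV)"
    by (rule Lim_null_comparison[rotated]) (auto simp: eventually_finite_subsets_at_top_weakI le)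
  from tendsto_diff[OF tendsto_const[of \<xi>] this] show ?thesis by simp
qed

lemma cinner_delta: "cinner \<xi> (delta x) = Rep_ell2 \<xi> x"
proof -
  have "cinner \<xi> (delta x) = (\<Sum>\<^sub>\<infinity>z. Rep_ell2 \<xi> z * cnj (if z = x then 1 else 0))"
    by (simp add: cinner_ell2.rep_eq Rep_ell2_delta)
  also have "\<dots> = (\<Sum>\<^sub>\<infinity>z\<in>{x}. Rep_ell2 \<xi> z)" by (rule infsum_cong_neutral) auto
  finally show ?thesis by simp
qed

text \<open>The sesquilinear form of \<open>T\<close> on vectors supported in \<open>X\<close>,
  written with entries and plain functions so that statements on operators become manipulations of
  finite sums.\<close>

definition form :: "('a ell2 \<Rightarrow>\<^sub>L 'a ell2) \<Rightarrow> 'a set \<Rightarrow> ('a \<Rightarrow> complex) \<Rightarrow> ('a \<Rightarrow> complex) \<Rightarrow> complex" where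
  "form T X u v = (\<Sum>x\<in>X. \<Sum>y\<in>X. entry T x y * u y * cnj (v x))"

lemma form_eq_cinner:
  assumes "clinear_op T"
  shows "form T X u v = cinner (blinfun_apply T (vec u X)) (vec v X)"
  unfolding form_def vec_def
  by (simp add: blinfun.sum_right cinner.sum_left cinner.sum_right clinear_opD[OF assms]
      cinner_scaleC_left cinner_scaleC_right cinner_delta entry_def mult_ac sum_distrib_left Rep_ell2_sum scaleC_ell2.rep_eq)

lemma form_tendsto:
  assumes "clinear_op T"
  shows "((\<lambda>X. form T X (Rep_ell2 \<xi>) (Rep_ell2 \<eta>)) \<longlongrightarrow> cinner (blinfun_apply T \<xi>) \<eta>) (finite_subsets_at_top UNIV)"
  unfolding form_eq_cinner[OF assms]
  by (intro cinner.tendsto blinfun.tendsto tendsto_const tendsto_vec)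

lemma form_bound:
  assumes "clinear_op T" "finite X"
  shows "cmod (form T X u v) \<le> norm T * (L2_set (\<lambda>x. cmod (u x)) X * L2_set (\<lambda>x. cmod (v x)) X)"
proof -
  have "cmod (form T X u v) \<le> norm (blinfun_apply T (vec u X)) * norm (vec v X)"
    unfolding form_eq_cinner[OF assms(1)] by (rule cinner_cauchy_schwarz)
  also have "\<dots> \<le> (norm T * L2_set (\<lambda>x. cmod (u x)) X) * L2_set (\<lambda>x. cmod (v x)) X"
    by (intro mult_mono norm_vec_le assms order.trans[OF norm_blinfun] mult_left_mono) auto
  finally show ?thesis by (simp only: mult.assoc)
qed

text \<open>Finitely supported vectors are dense: the bound extends to all vectors by
  \<open>form_tendsto\<close> and is then applied with the image of \<open>\<xi>\<close> as second
  argument.\<close>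

lemma norm_le_form:
  assumes T: "clinear_op T" and C: "0 \<le> C"
    and le: "\<And>X u v. finite X \<Longrightarrow> cmod (form T X u v) \<le> C * (L2_set (\<lambda>x. cmod (u x)) X * L2_set (\<lambda>x. cmod (v x)) X)"
  shows "norm T \<le> C"
proof (rule norm_blinfun_bound[OF C])
  have *: "cmod (cinner (blinfun_apply T \<xi>) \<eta>) \<le> C * (norm \<xi> * norm \<eta>)" for \<xi> \<eta>
  proof (rule tendsto_upperbound[OF tendsto_norm[OF form_tendsto[OF T, of \<xi> \<eta>]]])
    show "\<forall>\<^sub>F X in finite_subsets_at_top UNIV. cmod (form T X (Rep_ell2 \<xi>) (Rep_ell2 \<eta>)) \<le> C * (norm \<xi> * norm \<eta>)"
      by (intro eventually_finite_subsets_at_top_weakI order.trans[OF le] mult_left_mono[OF _ C] mult_mono L2_set_Rep_le) auto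
  qed simp
  fix \<xi>
  have "norm (blinfun_apply T \<xi>) * norm (blinfun_apply T \<xi>) \<le> (C * norm \<xi>) * norm (blinfun_apply T \<xi>)"
    using *[of \<xi> "blinfun_apply T \<xi>"] unfolding cinner_self norm_of_real by (simp add: power2_eq_square mult_ac)
  then show "norm (blinfun_apply T \<xi>) \<le> C * norm \<xi>"
    by (cases "norm (blinfun_apply T \<xi>) = 0") (use C in \<open>auto simp: mult_le_cancel_right\<close>)
qed

lemma positive_op_form:
  assumes "positive_op T" shows "0 \<le> form T X u u"
  using assms by (auto simp: positive_op_def form_eq_cinner)

lemma positive_op_formI:
  assumes T: "clinear_op T" and pos: "\<And>X u. finite X \<Longrightarrow> 0 \<le> form T X u u"
  shows "positive_op T"
  unfolding positive_op_def
proof (intro conjI allI T)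
  fix \<xi>
  let ?c = "cinner (blinfun_apply T \<xi>) \<xi>"
  have nn: "0 \<le> Re (form T X (Rep_ell2 \<xi>) (Rep_ell2 \<xi>))" "Im (form T X (Rep_ell2 \<xi>) (Rep_ell2 \<xi>)) = 0"
    if "finite X" for X using pos[OF that, of "Rep_ell2 \<xi>"] by (auto simp: less_eq_complex_def)
  have "0 \<le> Re ?c"
    by (rule tendsto_lowerbound[OF tendsto_Re[OF form_tendsto[OF T, of \<xi> \<xi>]]])
       (auto intro: eventually_finite_subsets_at_top_weakI nn)
  moreover have "Im ?c = 0"
  proof (rule tendsto_unique[OF _ tendsto_Im[OF form_tendsto[OF T, of \<xi> \<xi>]]])
    show "((\<lambda>X. Im (form T X (Rep_ell2 \<xi>) (Rep_ell2 \<xi>))) \<longlongrightarrow> 0) (finite_subsets_at_top UNIV)"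
      by (rule tendsto_eventually) (auto intro: eventually_finite_subsets_at_top_weakI nn)
  qed simp
  ultimately show "0 \<le> ?c" by (simp add: less_eq_complex_def)
qed

lemma entry_bound: "cmod (entry T x y) \<le> norm T"
proof -
  have "norm (delta y) \<le> 1"
    using norm_vec_le[of "{y}" "\<lambda>_. 1"] by (simp add: vec_def)
  then have "norm (blinfun_apply T (delta y)) \<le> norm T * 1"
    by (intro order.trans[OF norm_blinfun] mult_left_mono) auto
  then show ?thesis unfolding entry_def using norm_Rep_ell2_le order_trans by fastforce
qed

lemma entry_add: "entry (S + T) x y = entry S x y + entry T x y"
  and entry_diff: "entry (S - T) x y = entry S x y - entry T x y"
  and entry_scaleC: "entry (c *\<^sub>C S) x y = c * entry S x y"
  by (simp_all add: entry_def blinfun.bilinear_simps plus_ell2.rep_eq minus_ell2.rep_eq scaleC_ell2.rep_eq)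

lemma entry_zero: "entry 0 x y = 0"
  by (simp add: entry_def zero_ell2.rep_eq)

lemma entry_sum: "entry (sum f I) x y = (\<Sum>i\<in>I. entry (f i) x y)"
  by (induction I rule: infinite_finite_induct) (auto simp: entry_zero entry_add)

text \<open>All forms of the difference vanish. Complex linearity has to be assumed since the
  operator type only guarantees real linearity.\<close>

lemma op_eqI:
  assumes S: "clinear_op S" and T: "clinear_op T" and "\<And>x y. entry S x y = entry T x y"
  shows "S = T"
proof -
  have "norm (S - T) \<le> 0"
    by (rule norm_le_form[OF clinear_op_diff[OF S T]]) (auto simp: form_def entry_diff assms)
  then show ?thesis by simp
qed

text \<open>Both sides are limits of finite forms, for which the identity is an exchange of
  sums.\<close>

lemma adj_rel_entryI:
  assumes S: "clinear_op S" and T: "clinear_op T" and e: "\<And>x y. entry S x y = cnj (entry T y x)"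
  shows "cinner (blinfun_apply S \<xi>) \<eta> = cinner \<xi> (blinfun_apply T \<eta>)"
proof (rule tendsto_unique[OF _ form_tendsto[OF S, of \<xi> \<eta>]])
  have "form S X u v = cnj (form T X v u)" for X u v
    unfolding form_def cnj_sum by (subst sum.swap) (simp add: e mult_ac)
  then show "((\<lambda>X. form S X (Rep_ell2 \<xi>) (Rep_ell2 \<eta>)) \<longlongrightarrow> cinner \<xi> (blinfun_apply T \<eta>)) (finite_subsets_at_top UNIV)"
    using tendsto_cnj[OF form_tendsto[OF T, of \<eta> \<xi>]] by (simp add: cinner_commute[of \<xi>])
qed simp

lemma clinear_proj_op: "clinear_op (proj_op X)"
  unfolding proj_op_def by (intro clinear_reindex_op) simp

lemma norm_proj_op_le: "norm (proj_op X) \<le> 1"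
  unfolding proj_op_def by (intro norm_reindex_op_le) simp

lemma proj_op_apply: "Rep_ell2 (blinfun_apply (proj_op X) \<xi>) = (\<lambda>x. if x \<in> X then Rep_ell2 \<xi> x else 0)"
  unfolding proj_op_def by (rule reindex_op_apply) simp

lemma proj_op_delta: "blinfun_apply (proj_op X) (delta y) = (if y \<in> X then delta y else 0)"
  by (auto simp: proj_op_apply Rep_ell2_delta zero_ell2.rep_eq fun_eq_iff simp flip: Rep_ell2_inject)

lemma entry_proj_op: "entry (proj_op X) x y = (if x \<in> X \<and> x = y then 1 else 0)"
  by (auto simp: entry_def proj_op_apply Rep_ell2_delta)

lemma entry_compress:
  "entry (proj_op X o\<^sub>L T o\<^sub>L proj_op X) x y = (if x \<in> X \<and> y \<in> X then entry T x y else 0)"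
  by (auto simp: entry_def proj_op_apply proj_op_delta zero_ell2.rep_eq)

lemma norm_compress_le: "norm (proj_op X o\<^sub>L T o\<^sub>L proj_op X) \<le> norm T"
proof -
  have "norm (proj_op X o\<^sub>L T o\<^sub>L proj_op X) \<le> (norm (proj_op X) * norm T) * norm (proj_op X)"
    by (intro order.trans[OF norm_blinfun_compose] mult_right_mono norm_blinfun_compose) auto
  also have "\<dots> \<le> (1 * norm T) * 1"
    by (intro mult_mono norm_proj_op_le) auto
  finally show ?thesis by simp
qed

lemma cinner_proj_op: "cinner (blinfun_apply (proj_op X) \<xi>) \<eta> = cinner \<xi> (blinfun_apply (proj_op X) \<eta>)"
  by (rule adj_rel_entryI) (auto simp: clinear_proj_op entry_proj_op)

lemma positive_compress: "positive_op T \<Longrightarrow> positive_op (proj_op X o\<^sub>L T o\<^sub>L proj_op X)"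
  by (simp add: positive_op_def cinner_proj_op clinear_op_compose clinear_proj_op)

lemma clinear_compress: "clinear_op T \<Longrightarrow> clinear_op (proj_op X o\<^sub>L T o\<^sub>L proj_op X)"
  by (intro clinear_op_compose clinear_proj_op)

lemma entry_matrix_unit: "entry (matrix_unit a b) x y = (if x = a \<and> y = b then 1 else 0)"
  by (auto simp: entry_def matrix_unit.rep_eq scaleC_ell2.rep_eq Rep_ell2_delta)


section \<open>Compressions of convolution operators\<close>

text \<open>With \<open>X\<close> the whole group this gives the group algebra, with
  \<open>X\<close> a ball its truncation, so both can be treated at once.\<close>

definition compression :: "('a, 'm) monoid_scheme \<Rightarrow> 'a set \<Rightarrow> ('a \<Rightarrow> complex) \<Rightarrow> ('a ell2 \<Rightarrow>\<^sub>L 'a ell2)" where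
  "compression G X f = proj_op X o\<^sub>L left_reg G f o\<^sub>L proj_op X"

context group
begin

lemma group_alg_add: "f \<in> group_alg G \<Longrightarrow> g \<in> group_alg G \<Longrightarrow> (\<lambda>x. f x + g x) \<in> group_alg G"
proof -
  assume "f \<in> group_alg G" "g \<in> group_alg G"
  moreover have "{x. f x + g x \<noteq> 0} \<subseteq> {x. f x \<noteq> 0} \<union> {x. g x \<noteq> 0}" by auto
  ultimately show ?thesis unfolding group_alg_def by (blast intro: finite_subset)
qed

lemma group_alg_mult: "f \<in> group_alg G \<Longrightarrow> (\<lambda>x. m x * f x) \<in> group_alg G"
  by (auto simp: group_alg_def intro: finite_subset[of _ "{x. f x \<noteq> 0}"])

lemma group_alg_restrict: "f \<in> group_alg G \<Longrightarrow> (\<lambda>x. if Q x then f x else 0) \<in> group_alg G"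
  by (auto simp: group_alg_def intro: finite_subset[of _ "{x. f x \<noteq> 0}"])

lemma group_alg_single: "x \<in> carrier G \<Longrightarrow> (\<lambda>z. if z = x then c else 0) \<in> group_alg G"
  by (auto simp: group_alg_def)

text \<open>This is the involution of the group algebra. Outside the carrier \<open>inv\<close> is
  unspecified, hence the explicit 0 there.\<close>

lemma group_alg_star:
  assumes f: "f \<in> group_alg G"
  shows "(\<lambda>x. if x \<in> carrier G then cnj (f (inv x)) else 0) \<in> group_alg G"
proof -
  have "{x. (if x \<in> carrier G then cnj (f (inv x)) else 0) \<noteq> 0} \<subseteq> (\<lambda>x. inv x) ` {x. f x \<noteq> 0}"
  proof
    fix x assume "x \<in> {x. (if x \<in> carrier G then cnj (f (inv x)) else 0) \<noteq> 0}"
    then have "x = inv (inv x)" "inv x \<in> {x. f x \<noteq> 0}" by (auto split: if_splits)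
    then show "x \<in> (\<lambda>x. inv x) ` {x. f x \<noteq> 0}" by (rule image_eqI)
  qed
  moreover have "finite ((\<lambda>x. inv x) ` {x. f x \<noteq> 0})" using f by (simp add: group_alg_def)
  ultimately have "finite {x. (if x \<in> carrier G then cnj (f (inv x)) else 0) \<noteq> 0}" by (rule finite_subset)
  then show ?thesis by (auto simp: group_alg_def)
qed

lemma clinear_left_transl: "y \<in> carrier G \<Longrightarrow> clinear_op (left_transl G y)"
  and norm_left_transl_le: "y \<in> carrier G \<Longrightarrow> norm (left_transl G y) \<le> 1"
  unfolding left_transl_def
  by (auto intro!: clinear_reindex_op norm_reindex_op_le simp: inj_on_def)

lemma clinear_left_reg: "f \<in> group_alg G \<Longrightarrow> clinear_op (left_reg G f)"
  unfolding left_reg_def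
  by (intro clinear_op_sum clinear_op_scaleC clinear_left_transl) (auto simp: group_alg_def)

lemma norm_left_reg_le: "f \<in> group_alg G \<Longrightarrow> norm (left_reg G f) \<le> (\<Sum>x | f x \<noteq> 0. cmod (f x))"
  unfolding left_reg_def
  by (intro sum_norm_le)
    (auto simp: norm_scaleC_blinfun group_alg_def intro!: mult_left_le norm_left_transl_le)

lemma entry_left_transl:
  "z \<in> carrier G \<Longrightarrow> entry (left_transl G z) x y = (if x \<in> carrier G \<and> inv z \<otimes> x = y then 1 else 0)"
  by (simp add: entry_def left_transl_apply Rep_ell2_delta)

lemma entry_left_reg_if:
  assumes f: "f \<in> group_alg G"
  shows "entry (left_reg G f) x y = (if x \<in> carrier G \<and> y \<in> carrier G then f (x \<otimes> inv y) else 0)"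
proof (cases "x \<in> carrier G \<and> y \<in> carrier G")
  case False
  have "entry (left_reg G f) x y = (\<Sum>z | f z \<noteq> 0. f z * entry (left_transl G z) x y)"
    by (simp add: left_reg_def entry_sum entry_scaleC)
  also have "\<dots> = 0"
    using f False by (intro sum.neutral) (auto simp: group_alg_def subset_iff entry_left_transl)
  finally show ?thesis using False by auto
qed (simp add: entry_left_reg f)

lemma clinear_compression: "f \<in> group_alg G \<Longrightarrow> clinear_op (compression G X f)"
  unfolding compression_def by (intro clinear_compress clinear_left_reg)

lemma entry_compression:
  "f \<in> group_alg G \<Longrightarrow> X \<subseteq> carrier G \<Longrightarrow>
    entry (compression G X f) x y = (if x \<in> X \<and> y \<in> X then f (x \<otimes> inv y) else 0)"
  by (auto simp: compression_def entry_compress entry_left_reg_if)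

lemma norm_compression_le: "f \<in> group_alg G \<Longrightarrow> norm (compression G X f) \<le> (\<Sum>x | f x \<noteq> 0. cmod (f x))"
  unfolding compression_def by (rule order.trans[OF norm_compress_le norm_left_reg_le])

lemma compression_eqI:
  assumes "f \<in> group_alg G" "g \<in> group_alg G" "X \<subseteq> carrier G"
    and "\<And>x y. x \<in> X \<Longrightarrow> y \<in> X \<Longrightarrow> f (x \<otimes> inv y) = g (x \<otimes> inv y)"
  shows "compression G X f = compression G X g"
  by (rule op_eqI) (auto simp: clinear_compression entry_compression assms)

lemma compression_eqD:
  assumes "compression G X f = compression G X g" "f \<in> group_alg G" "g \<in> group_alg G" "X \<subseteq> carrier G"
    and "x \<in> X" "y \<in> X"
  shows "f (x \<otimes> inv y) = g (x \<otimes> inv y)"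
  using entry_compression[OF assms(2,4), of x y] entry_compression[OF assms(3,4), of x y] assms by simp

lemma coeff_le_norm_compression:
  assumes "f \<in> group_alg G" "X \<subseteq> carrier G" "x \<in> X" "y \<in> X"
  shows "cmod (f (x \<otimes> inv y)) \<le> norm (compression G X f)"
  using entry_bound[of "compression G X f" x y] assms by (simp add: entry_compression)

lemma compression_add:
  assumes "f \<in> group_alg G" "g \<in> group_alg G" "X \<subseteq> carrier G"
  shows "compression G X (\<lambda>x. f x + g x) = compression G X f + compression G X g"
  by (rule op_eqI)
    (auto simp: clinear_compression clinear_op_add group_alg_add entry_compression entry_add assms)

lemma compression_scaleC:
  assumes "f \<in> group_alg G" "X \<subseteq> carrier G"
  shows "compression G X (\<lambda>x. c * f x) = c *\<^sub>C compression G X f"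
  by (rule op_eqI)
    (auto simp: clinear_compression clinear_op_scaleC group_alg_mult entry_compression entry_scaleC assms)

lemma compression_diff:
  assumes "f \<in> group_alg G" "g \<in> group_alg G" "X \<subseteq> carrier G"
  shows "compression G X (\<lambda>x. f x - g x) = compression G X f - compression G X g"
  using compression_add[OF assms(1) group_alg_mult[OF assms(2), of "\<lambda>_. -1"] assms(3)]
    compression_scaleC[OF assms(2,3), of "-1"] by (simp add: scaleC_blinfun_simps)

lemma compression_one:
  assumes "X \<subseteq> carrier G"
  shows "compression G X (\<lambda>z. if z = \<one> then 1 else 0) = proj_op X"
proof (rule op_eqI)
  have eq: "x \<otimes> inv y = \<one> \<longleftrightarrow> x = y" if "x \<in> X" "y \<in> X" for x y
    using that assms by (metis inv_solve_right' l_one one_closed subset_iff)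
  show "entry (compression G X (\<lambda>z. if z = \<one> then 1 else 0)) x y = entry (proj_op X) x y" for x y
    by (auto simp: entry_compression[OF group_alg_single[OF one_closed] assms] entry_proj_op eq)
qed (auto intro: clinear_compression group_alg_single clinear_proj_op)

lemma compression_idem:
  assumes "X \<subseteq> Y" "Y \<subseteq> carrier G" "f \<in> group_alg G"
  shows "proj_op X o\<^sub>L compression G Y f o\<^sub>L proj_op X = compression G X f"
  by (rule op_eqI)
    (use assms order.trans[OF assms(1,2)] in
      \<open>auto simp: clinear_compress clinear_compression entry_compress entry_compression\<close>)

lemma left_reg_eq_compression: "f \<in> group_alg G \<Longrightarrow> left_reg G f = compression G (carrier G) f"
  by (rule op_eqI) (auto simp: clinear_left_reg clinear_compression entry_left_reg_if entry_compression)

lemma compression_adj_rel: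
  assumes f: "f \<in> group_alg G" and X: "X \<subseteq> carrier G"
  shows "cinner (blinfun_apply (compression G X (\<lambda>x. if x \<in> carrier G then cnj (f (inv x)) else 0)) \<xi>) \<eta>
       = cinner \<xi> (blinfun_apply (compression G X f) \<eta>)"
proof (rule adj_rel_entryI)
  have "inv (x \<otimes> inv y) = y \<otimes> inv x" if "x \<in> X" "y \<in> X" for x y
    using that X by (simp add: inv_mult_group subset_iff)
  then show "entry (compression G X (\<lambda>x. if x \<in> carrier G then cnj (f (inv x)) else 0)) x y
      = cnj (entry (compression G X f) y x)" for x y
    using X by (auto simp: entry_compression f group_alg_star subset_iff)
qed (auto intro: clinear_compression group_alg_star f)

lemma adj_compression:
  assumes "f \<in> group_alg G" "X \<subseteq> carrier G"
  shows "adj (compression G X f) = compression G X (\<lambda>x. if x \<in> carrier G then cnj (f (inv x)) else 0)"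
  by (rule adj_eqI) (rule compression_adj_rel[OF assms])

text \<open>Coefficients at elements not of the form \<open>y \<otimes> inv z\<close> do not occur
  in the matrix and may be set to 0. For this representative every nonzero coefficient is a matrix
  entry and can be bounded by the norm.\<close>

lemma compression_supported:
  assumes "T \<in> compression G X ` group_alg G" "X \<subseteq> carrier G"
  obtains f where "f \<in> group_alg G" "T = compression G X f"
    "\<forall>x. f x \<noteq> 0 \<longrightarrow> (\<exists>y\<in>X. \<exists>z\<in>X. x = y \<otimes> inv z)"
proof -
  obtain g where g: "g \<in> group_alg G" "T = compression G X g" using assms by blast
  let ?f = "\<lambda>x. if \<exists>y\<in>X. \<exists>z\<in>X. x = y \<otimes> inv z then g x else 0"
  show ?thesis
  proof
    show "?f \<in> group_alg G" by (rule group_alg_restrict[OF g(1)])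
    show "T = compression G X ?f"
      unfolding g(2) by (rule compression_eqI) (use g assms group_alg_restrict in auto)
  qed (auto split: if_splits)
qed

lemma op_sys_compression:
  assumes X: "X \<subseteq> carrier G"
  shows "op_sys (proj_op X) (compression G X ` group_alg G)"
proof
  show "operator_system (proj_op X) (compression G X ` group_alg G)"
    unfolding operator_system_def
  proof (intro conjI ballI allI)
    show "proj_op X o\<^sub>L proj_op X = proj_op X"
      by (rule blinfun_eqI) (simp add: proj_op_apply fun_eq_iff flip: Rep_ell2_inject)
    show "adj (proj_op X) = proj_op X" by (rule adj_eqI) (rule cinner_proj_op)
    show "proj_op X \<in> compression G X ` group_alg G"
      unfolding compression_one[OF X, symmetric] by (intro imageI group_alg_single one_closed)
    fix a assume "a \<in> compression G X ` group_alg G"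
    then obtain f where f: "f \<in> group_alg G" "a = compression G X f" by blast
    show "clinear_op a" by (simp add: f clinear_compression)
    show "proj_op X o\<^sub>L a o\<^sub>L proj_op X = a" using f X by (simp add: compression_idem)
    show "c *\<^sub>C a \<in> compression G X ` group_alg G" for c
      unfolding f(2) compression_scaleC[OF f(1) X, symmetric] by (intro imageI group_alg_mult f)
    show "adj a \<in> compression G X ` group_alg G"
      unfolding f(2) adj_compression[OF f(1) X] by (intro imageI group_alg_star f)
    fix b assume "b \<in> compression G X ` group_alg G"
    then obtain g where g: "g \<in> group_alg G" "b = compression G X g" by blast
    show "a + b \<in> compression G X ` group_alg G"
      unfolding f(2) g(2) compression_add[OF f(1) g(1) X, symmetric] by (intro imageI group_alg_add f g)
  qed
next
  fix a x y assume "a \<in> compression G X ` group_alg G"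
  then obtain f where f: "f \<in> group_alg G" "a = compression G X f" by blast
  show "cinner (blinfun_apply (adj a) x) y = cinner x (blinfun_apply a y)"
    unfolding f(2) adj_compression[OF f(1) X] by (rule compression_adj_rel[OF f(1) X])
qed


section \<open>Averaging over translates\<close>

text \<open>The translate of the index set by any \<open>y\<close> in \<open>K\<close> contains
  \<open>Q\<close>, and \<open>h\<close> vanishes on the rest. One index set thus serves all
  \<open>y\<close>.\<close>

lemma sum_translate:
  fixes h :: "'a \<Rightarrow> 'c::comm_monoid_add"
  assumes KQ: "finite K" "K \<subseteq> carrier G" "finite Q" "Q \<subseteq> carrier G" and y: "y \<in> K"
    and h: "\<And>q. q \<in> carrier G - Q \<Longrightarrow> h q = 0"
  shows "(\<Sum>z\<in>(\<lambda>(y, q). inv y \<otimes> q) ` (K \<times> Q). h (y \<otimes> z)) = (\<Sum>q\<in>Q. h q)"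
proof -
  let ?Z = "(\<lambda>(y, q). inv y \<otimes> q) ` (K \<times> Q)"
  have Z: "?Z \<subseteq> carrier G" "finite ?Z" using KQ by auto
  have yc: "y \<in> carrier G" using y KQ by auto
  have "inj_on ((\<otimes>) y) ?Z" using Z yc by (auto simp: inj_on_def subset_iff)
  then have "(\<Sum>z\<in>?Z. h (y \<otimes> z)) = (\<Sum>q\<in>(\<otimes>) y ` ?Z. h q)" by (simp add: sum.reindex)
  also have "\<dots> = (\<Sum>q\<in>Q. h q)"
  proof (rule sum.mono_neutral_right)
    show "finite ((\<otimes>) y ` ?Z)" using Z by simp
    have "q \<in> (\<otimes>) y ` ?Z" if "q \<in> Q" for q
    proof
      show "q = y \<otimes> (inv y \<otimes> q)" using that yc KQ by (simp add: m_assoc[symmetric] subset_iff)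
      show "inv y \<otimes> q \<in> ?Z" using that y by force
    qed
    then show "Q \<subseteq> (\<otimes>) y ` ?Z" by blast
    show "\<forall>q\<in>(\<otimes>) y ` ?Z - Q. h q = 0" using Z yc h by auto
  qed
  finally show ?thesis .
qed

text \<open>The set counted is in bijection with the intersection of \<open>K\<close> and its
  translate by \<open>x\<close>, so this is the diagonal matrix coefficient of the left regular
  representation at the normalised indicator of \<open>K\<close>, a positive definite
  function.\<close>

definition overlap :: "'a set \<Rightarrow> 'a \<Rightarrow> real" where
  "overlap K x = card {y \<in> K. x \<otimes> y \<in> K} / card K"

lemma overlap_bounds:
  assumes "finite K" shows "0 \<le> overlap K x" "overlap K x \<le> 1"
proof -
  have "card {y \<in> K. x \<otimes> y \<in> K} \<le> card K" using assms by (intro card_mono) auto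
  then show "0 \<le> overlap K x" "overlap K x \<le> 1" by (auto simp: overlap_def divide_le_eq_1)
qed

lemma overlap_one: "finite K \<Longrightarrow> K \<noteq> {} \<Longrightarrow> K \<subseteq> carrier G \<Longrightarrow> overlap K \<one> = 1"
proof -
  assume K: "finite K" "K \<noteq> {}" "K \<subseteq> carrier G"
  then have "{y \<in> K. \<one> \<otimes> y \<in> K} = K" by auto
  then show ?thesis using K by (simp add: overlap_def)
qed

lemma overlap_nonzeroD:
  assumes "overlap K x \<noteq> 0" "K \<subseteq> carrier G" "x \<in> carrier G"
  shows "\<exists>y\<in>K. \<exists>z\<in>K. x = y \<otimes> inv z"
proof -
  have "{y \<in> K. x \<otimes> y \<in> K} \<noteq> {}" using assms(1) by (intro notI) (simp add: overlap_def)
  then obtain y where "y \<in> K" "x \<otimes> y \<in> K" by blast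
  moreover from this have "x = (x \<otimes> y) \<otimes> inv y" using assms by (simp add: m_assoc subset_iff)
  ultimately show ?thesis by blast
qed

text \<open>
  Multiplying the coefficients by \<open>overlap K\<close> averages the compression to \<open>K\<close> over all right
  translates of \<open>K\<close>; this makes the multiplier positive and contractive.
\<close>

lemma form_overlap:
  fixes Z u v
  assumes f: "f \<in> group_alg G" and K: "finite K" "K \<subseteq> carrier G" "K \<noteq> {}" and Z: "finite Z"
  defines "Q \<equiv> Z \<inter> carrier G"
  defines "Y \<equiv> (\<lambda>(y, q). inv y \<otimes> q) ` (K \<times> Q)"
  defines "u' \<equiv> \<lambda>q. if q \<in> Q then u q else 0"
  defines "v' \<equiv> \<lambda>q. if q \<in> Q then v q else 0"
  shows "of_nat (card K) * form (left_reg G (\<lambda>x. complex_of_real (overlap K x) * f x)) Z u v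
       = (\<Sum>z\<in>Y. form (compression G K f) K (\<lambda>y. u' (y \<otimes> z)) (\<lambda>w. v' (w \<otimes> z)))"
proof -
  have Q: "finite Q" "Q \<subseteq> carrier G" using Z by (auto simp: Q_def)
  have Y: "Y \<subseteq> carrier G" using K Q by (auto simp: Y_def)
  \<comment> \<open>The averaged forms carry a summation over \<open>y\<close> in \<open>K\<close>;
    by this identity it will collapse to the weight.\<close>
  have cK: "of_nat (card K) * complex_of_real (overlap K x) = (\<Sum>y\<in>K. if x \<otimes> y \<in> K then 1 else 0)" for x
  proof -
    have "of_nat (card K) * complex_of_real (overlap K x) = of_nat (card {y \<in> K. x \<otimes> y \<in> K})"
      using K by (simp add: overlap_def)
    also have "\<dots> = (\<Sum>y\<in>K. if x \<otimes> y \<in> K then 1 else 0)"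
      using K(1) by (simp add: sum.If_cases Int_def)
    finally show ?thesis .
  qed
  \<comment> \<open>Substitution \<open>x = w \<otimes> inv y \<otimes> q\<close>: the argument of
    \<open>f\<close> becomes \<open>x \<otimes> inv q\<close>, and the range
    \<open>w \<in> K\<close> becomes the condition that is counted by the overlap.\<close>
  have inner: "(\<Sum>w\<in>K. f (w \<otimes> inv y) * cnj (v' (w \<otimes> inv y \<otimes> q)))
      = (\<Sum>x\<in>Q. (if x \<otimes> inv q \<otimes> y \<in> K then f (x \<otimes> inv q) * cnj (v x) else 0))"
    if y: "y \<in> K" and q: "q \<in> Q" for y q
  proof -
    have c: "y \<in> carrier G" "q \<in> carrier G" using y q K Q by auto
    have "(\<Sum>w\<in>K. f (w \<otimes> inv y) * cnj (v' (w \<otimes> inv y \<otimes> q)))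
        = (\<Sum>w\<in>{w \<in> K. w \<otimes> inv y \<otimes> q \<in> Q}. f (w \<otimes> inv y) * cnj (v (w \<otimes> inv y \<otimes> q)))"
      using K(1) by (intro sum.mono_neutral_cong_right) (auto simp: v'_def)
    also have "\<dots> = (\<Sum>x\<in>{x \<in> Q. x \<otimes> inv q \<otimes> y \<in> K}. f (x \<otimes> inv q) * cnj (v x))"
    proof (rule sum.reindex_bij_witness[of _ "\<lambda>x. x \<otimes> inv q \<otimes> y" "\<lambda>w. w \<otimes> inv y \<otimes> q"])
      fix w assume "w \<in> {w \<in> K. w \<otimes> inv y \<otimes> q \<in> Q}"
      then have w: "w \<in> carrier G" "w \<in> K" "w \<otimes> inv y \<otimes> q \<in> Q" using K by auto
      have 1: "w \<otimes> inv y \<otimes> q \<otimes> inv q = w \<otimes> inv y" using w c by (simp add: m_assoc)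
      show 2: "w \<otimes> inv y \<otimes> q \<otimes> inv q \<otimes> y = w" unfolding 1 using w c by (simp add: m_assoc)
      show "w \<otimes> inv y \<otimes> q \<in> {x \<in> Q. x \<otimes> inv q \<otimes> y \<in> K}" using 2 w by simp
      show "f (w \<otimes> inv y \<otimes> q \<otimes> inv q) * cnj (v (w \<otimes> inv y \<otimes> q)) = f (w \<otimes> inv y) * cnj (v (w \<otimes> inv y \<otimes> q))"
        by (simp add: 1)
    next
      fix x assume "x \<in> {x \<in> Q. x \<otimes> inv q \<otimes> y \<in> K}"
      then have x: "x \<in> carrier G" "x \<in> Q" "x \<otimes> inv q \<otimes> y \<in> K" using Q by auto
      have "x \<otimes> inv q \<otimes> y \<otimes> inv y = x \<otimes> inv q" using x c by (simp add: m_assoc)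
      then show 2: "x \<otimes> inv q \<otimes> y \<otimes> inv y \<otimes> q = x" using x c by (simp add: m_assoc)
      show "x \<otimes> inv q \<otimes> y \<in> {w \<in> K. w \<otimes> inv y \<otimes> q \<in> Q}" using 2 x by simp
    qed
    also have "\<dots> = (\<Sum>x\<in>Q. (if x \<otimes> inv q \<otimes> y \<in> K then f (x \<otimes> inv q) * cnj (v x) else 0))"
      using Q(1) by (simp add: sum.inter_filter)
    finally show ?thesis .
  qed
  have "(\<Sum>z\<in>Y. form (compression G K f) K (\<lambda>y. u' (y \<otimes> z)) (\<lambda>w. v' (w \<otimes> z)))
      = (\<Sum>z\<in>Y. \<Sum>w\<in>K. \<Sum>y\<in>K. f (w \<otimes> inv y) * (u' (y \<otimes> z) * cnj (v' (w \<otimes> z))))"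
    unfolding form_def by (intro sum.cong refl) (simp add: entry_compression[OF f K(2)] mult.assoc)
  also have "\<dots> = (\<Sum>w\<in>K. \<Sum>z\<in>Y. \<Sum>y\<in>K. f (w \<otimes> inv y) * (u' (y \<otimes> z) * cnj (v' (w \<otimes> z))))"
    by (rule sum.swap)
  also have "\<dots> = (\<Sum>w\<in>K. \<Sum>y\<in>K. \<Sum>z\<in>Y. f (w \<otimes> inv y) * (u' (y \<otimes> z) * cnj (v' (w \<otimes> z))))"
    by (intro sum.cong refl sum.swap)
  \<comment> \<open>Now \<open>z\<close> occurs only in \<open>y \<otimes> z\<close>, so
    \<open>sum_translate\<close> can replace the sum over translates by a sum over
    \<open>q = y \<otimes> z\<close>.\<close>
  also have "\<dots> = (\<Sum>w\<in>K. \<Sum>y\<in>K. \<Sum>z\<in>Y. f (w \<otimes> inv y) * (u' (y \<otimes> z) * cnj (v' (w \<otimes> inv y \<otimes> (y \<otimes> z)))))"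
  proof (intro sum.cong refl)
    fix w y z assume "w \<in> K" "y \<in> K" "z \<in> Y"
    then have "w \<in> carrier G" "y \<in> carrier G" "z \<in> carrier G" using K Y by auto
    then have "w \<otimes> inv y \<otimes> (y \<otimes> z) = w \<otimes> z" by (simp add: m_assoc) (simp add: m_assoc[symmetric])
    then show "f (w \<otimes> inv y) * (u' (y \<otimes> z) * cnj (v' (w \<otimes> z)))
        = f (w \<otimes> inv y) * (u' (y \<otimes> z) * cnj (v' (w \<otimes> inv y \<otimes> (y \<otimes> z))))" by simp
  qed
  also have "\<dots> = (\<Sum>w\<in>K. \<Sum>y\<in>K. \<Sum>q\<in>Q. f (w \<otimes> inv y) * (u' q * cnj (v' (w \<otimes> inv y \<otimes> q))))"
    unfolding Y_def
    by (intro sum.cong refl sum_translate[where h = "\<lambda>q. f (w \<otimes> inv y) * (u' q * cnj (v' (w \<otimes> inv y \<otimes> q)))" for w y] K Q)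
       (auto simp: u'_def)
  also have "\<dots> = (\<Sum>y\<in>K. \<Sum>w\<in>K. \<Sum>q\<in>Q. f (w \<otimes> inv y) * (u' q * cnj (v' (w \<otimes> inv y \<otimes> q))))"
    by (rule sum.swap)
  also have "\<dots> = (\<Sum>y\<in>K. \<Sum>q\<in>Q. \<Sum>w\<in>K. f (w \<otimes> inv y) * (u' q * cnj (v' (w \<otimes> inv y \<otimes> q))))"
    by (intro sum.cong refl sum.swap)
  also have "\<dots> = (\<Sum>y\<in>K. \<Sum>q\<in>Q. u q * (\<Sum>w\<in>K. f (w \<otimes> inv y) * cnj (v' (w \<otimes> inv y \<otimes> q))))"
    by (intro sum.cong refl) (simp add: u'_def sum_distrib_left mult_ac)
  also have "\<dots> = (\<Sum>y\<in>K. \<Sum>q\<in>Q. u q * (\<Sum>x\<in>Q. (if x \<otimes> inv q \<otimes> y \<in> K then f (x \<otimes> inv q) * cnj (v x) else 0)))"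
    by (intro sum.cong refl) (simp add: inner)
  also have "\<dots> = (\<Sum>y\<in>K. \<Sum>q\<in>Q. \<Sum>x\<in>Q. (if x \<otimes> inv q \<otimes> y \<in> K then 1 else 0) * (f (x \<otimes> inv q) * u q * cnj (v x)))"
    by (intro sum.cong refl) (auto simp: sum_distrib_left mult_ac intro!: sum.cong)
  also have "\<dots> = (\<Sum>q\<in>Q. \<Sum>y\<in>K. \<Sum>x\<in>Q. (if x \<otimes> inv q \<otimes> y \<in> K then 1 else 0) * (f (x \<otimes> inv q) * u q * cnj (v x)))"
    by (rule sum.swap)
  also have "\<dots> = (\<Sum>q\<in>Q. \<Sum>x\<in>Q. \<Sum>y\<in>K. (if x \<otimes> inv q \<otimes> y \<in> K then 1 else 0) * (f (x \<otimes> inv q) * u q * cnj (v x)))"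
    by (intro sum.cong refl sum.swap)
  also have "\<dots> = (\<Sum>x\<in>Q. \<Sum>q\<in>Q. \<Sum>y\<in>K. (if x \<otimes> inv q \<otimes> y \<in> K then 1 else 0) * (f (x \<otimes> inv q) * u q * cnj (v x)))"
    by (rule sum.swap)
  also have "\<dots> = (\<Sum>x\<in>Q. \<Sum>q\<in>Q. of_nat (card K) * (complex_of_real (overlap K (x \<otimes> inv q)) * f (x \<otimes> inv q) * u q * cnj (v x)))"
  proof (intro sum.cong refl)
    fix x q
    show "(\<Sum>y\<in>K. (if x \<otimes> inv q \<otimes> y \<in> K then 1 else 0) * (f (x \<otimes> inv q) * u q * cnj (v x)))
        = of_nat (card K) * (complex_of_real (overlap K (x \<otimes> inv q)) * f (x \<otimes> inv q) * u q * cnj (v x))"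
      unfolding sum_distrib_right[symmetric] cK[symmetric] by (simp only: mult.assoc)
  qed
  also have "\<dots> = of_nat (card K) * (\<Sum>x\<in>Q. \<Sum>q\<in>Q. entry (left_reg G (\<lambda>x. complex_of_real (overlap K x) * f x)) x q * u q * cnj (v x))"
    using Q(2) by (simp add: sum_distrib_left entry_left_reg_if[OF group_alg_mult[OF f]] subset_iff)
  \<comment> \<open>Rows and columns outside the carrier are zero, so \<open>Q\<close> may be
    enlarged to \<open>Z\<close>.\<close>
  also have "(\<Sum>x\<in>Q. \<Sum>q\<in>Q. entry (left_reg G (\<lambda>x. complex_of_real (overlap K x) * f x)) x q * u q * cnj (v x))
      = (\<Sum>x\<in>Z. \<Sum>q\<in>Q. entry (left_reg G (\<lambda>x. complex_of_real (overlap K x) * f x)) x q * u q * cnj (v x))"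
    using Z by (intro sum.mono_neutral_left) (auto simp: Q_def entry_left_reg_if[OF group_alg_mult[OF f]])
  also have "\<dots> = form (left_reg G (\<lambda>x. complex_of_real (overlap K x) * f x)) Z u v"
    unfolding form_def using Z
    by (intro sum.cong refl sum.mono_neutral_left) (auto simp: Q_def entry_left_reg_if[OF group_alg_mult[OF f]])
  finally show ?thesis by simp
qed

text \<open>Each point of \<open>Q\<close> is met once for every \<open>y\<close> in
  \<open>K\<close>, so the squares add up to \<open>card K\<close> times those on
  \<open>Q\<close>.\<close>

lemma L2_translates:
  fixes Z u
  assumes K: "finite K" "K \<subseteq> carrier G" and Z: "finite Z"
  defines "Q \<equiv> Z \<inter> carrier G"
  defines "Y \<equiv> (\<lambda>(y, q). inv y \<otimes> q) ` (K \<times> Q)"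
  defines "u' \<equiv> \<lambda>q. if q \<in> Q then u q else (0::complex)"
  shows "L2_set (\<lambda>z. L2_set (\<lambda>y. cmod (u' (y \<otimes> z))) K) Y \<le> sqrt (card K) * L2_set (\<lambda>q. cmod (u q)) Z"
proof -
  have Q: "finite Q" "Q \<subseteq> carrier G" using Z by (auto simp: Q_def)
  have "(\<Sum>z\<in>Y. (L2_set (\<lambda>y. cmod (u' (y \<otimes> z))) K)\<^sup>2) = (\<Sum>z\<in>Y. \<Sum>y\<in>K. (cmod (u' (y \<otimes> z)))\<^sup>2)"
    by (simp add: L2_set_def sum_nonneg)
  also have "\<dots> = (\<Sum>y\<in>K. \<Sum>z\<in>Y. (cmod (u' (y \<otimes> z)))\<^sup>2)" by (rule sum.swap)
  also have "\<dots> = (\<Sum>y\<in>K. \<Sum>q\<in>Q. (cmod (u' q))\<^sup>2)"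
    unfolding Y_def
    by (intro sum.cong refl sum_translate[where h = "\<lambda>q. (cmod (u' q))\<^sup>2"] K Q) (auto simp: u'_def)
  also have "\<dots> = card K * (\<Sum>q\<in>Q. (cmod (u q))\<^sup>2)" by (simp add: u'_def)
  also have "\<dots> \<le> card K * (\<Sum>q\<in>Z. (cmod (u q))\<^sup>2)"
    using Z by (intro mult_left_mono sum_mono2) (auto simp: Q_def)
  finally have "sqrt (\<Sum>z\<in>Y. (L2_set (\<lambda>y. cmod (u' (y \<otimes> z))) K)\<^sup>2) \<le> sqrt (card K * (\<Sum>q\<in>Z. (cmod (u q))\<^sup>2))"
    by (rule real_sqrt_le_mono)
  then show ?thesis by (simp add: L2_set_def[of _ Y] L2_set_def[of _ Z] real_sqrt_mult)
qed

text \<open>By \<open>form_overlap\<close> the form on the left is an average of forms of the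
  compression. Cauchy-Schwarz over the translates and \<open>L2_translates\<close> for both vectors
  produce two factors \<open>sqrt (card K)\<close>, which cancel the normalisation.\<close>

lemma norm_overlap_le:
  assumes f: "f \<in> group_alg G" and K: "finite K" "K \<subseteq> carrier G" "K \<noteq> {}"
  shows "norm (left_reg G (\<lambda>x. complex_of_real (overlap K x) * f x)) \<le> norm (compression G K f)" (is "_ \<le> ?N")
proof (rule norm_le_form[OF clinear_left_reg[OF group_alg_mult[OF f]]])
  fix Z :: "'a set" and u v :: "'a \<Rightarrow> complex"
  assume Z: "finite Z"
  define Q where "Q = Z \<inter> carrier G"
  define Y where "Y = (\<lambda>(y, q). inv y \<otimes> q) ` (K \<times> Q)"
  define u' where "u' = (\<lambda>q. if q \<in> Q then u q else 0)"
  define v' where "v' = (\<lambda>q. if q \<in> Q then v q else 0)"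
  define a where "a z = L2_set (\<lambda>y. cmod (u' (y \<otimes> z))) K" for z
  define b where "b z = L2_set (\<lambda>y. cmod (v' (y \<otimes> z))) K" for z
  let ?F = "form (left_reg G (\<lambda>x. complex_of_real (overlap K x) * f x)) Z u v"
  have ck: "0 < real (card K)" using K by (simp add: card_gt_0_iff)
  have "real (card K) * cmod ?F = cmod (of_nat (card K) * ?F)" by (simp add: norm_mult)
  also have "\<dots> = cmod (\<Sum>z\<in>Y. form (compression G K f) K (\<lambda>y. u' (y \<otimes> z)) (\<lambda>w. v' (w \<otimes> z)))"
    unfolding form_overlap[OF f K Z] Y_def Q_def u'_def v'_def ..
  also have "\<dots> \<le> (\<Sum>z\<in>Y. ?N * (a z * b z))"
    unfolding a_def b_def by (intro sum_norm_le form_bound clinear_compression f K)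
  also have "\<dots> = ?N * (\<Sum>z\<in>Y. \<bar>a z\<bar> * \<bar>b z\<bar>)"
    by (simp add: sum_distrib_left a_def b_def)
  also have "\<dots> \<le> ?N * (L2_set a Y * L2_set b Y)"
    by (intro mult_left_mono L2_set_mult_ineq) auto
  also have "\<dots> \<le> ?N * ((sqrt (card K) * L2_set (\<lambda>q. cmod (u q)) Z) * (sqrt (card K) * L2_set (\<lambda>q. cmod (v q)) Z))"
    unfolding a_def b_def Y_def u'_def v'_def Q_def
    by (intro mult_left_mono mult_mono L2_translates K Z) auto
  also have "\<dots> = real (card K) * (?N * (L2_set (\<lambda>x. cmod (u x)) Z * L2_set (\<lambda>x. cmod (v x)) Z))"
    by (simp add: mult_ac flip: real_sqrt_mult)
  finally show "cmod ?F \<le> ?N * (L2_set (\<lambda>x. cmod (u x)) Z * L2_set (\<lambda>x. cmod (v x)) Z)"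
    using ck by (simp only: mult_le_cancel_left_pos)
qed simp

lemma positive_overlap:
  assumes f: "f \<in> group_alg G" and K: "finite K" "K \<subseteq> carrier G" "K \<noteq> {}"
    and pos: "positive_op (compression G K f)"
  shows "positive_op (left_reg G (\<lambda>x. complex_of_real (overlap K x) * f x))"
proof (rule positive_op_formI[OF clinear_left_reg[OF group_alg_mult[OF f]]])
  fix Z :: "'a set" and u :: "'a \<Rightarrow> complex"
  assume Z: "finite Z"
  have "0 \<le> of_nat (card K) * form (left_reg G (\<lambda>x. complex_of_real (overlap K x) * f x)) Z u u"
    unfolding form_overlap[OF f K Z] by (intro sum_nonneg positive_op_form pos)
  moreover have "0 < card K" using K by (simp add: card_gt_0_iff)
  ultimately show "0 \<le> form (left_reg G (\<lambda>x. complex_of_real (overlap K x) * f x)) Z u u"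
    by (auto simp: less_eq_complex_def zero_le_mult_iff)
qed

end


section \<open>Convergence of the spectral truncations\<close>

context poly_group
begin

text \<open>The iterated derivation on coefficients. It annihilates the coefficient at the unit, as
  \<open>len \<one> = 0\<close> and the exponent is positive.\<close>

definition dpow :: "('a \<Rightarrow> complex) \<Rightarrow> 'a \<Rightarrow> complex" where
  "dpow f = (\<lambda>x. of_nat (len x) ^ (p + 2) * f x)"

lemma dpow_in: "f \<in> group_alg G \<Longrightarrow> dpow f \<in> group_alg G"
  unfolding dpow_def by (rule group_alg_mult)

lemma len_pow_ge_1: "x \<in> carrier G \<Longrightarrow> x \<noteq> \<one> \<Longrightarrow> 1 \<le> real (len x) ^ (p + 2)"
  using len_eq_0[of x] by (intro one_le_power) simp

text \<open>By the support condition each nonzero coefficient gives a matrix entry of the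
  compression of \<open>dpow f\<close>. The first bound serves for long elements, the second one for
  the finitely many others.\<close>

lemma coeff_le_norm_dpow:
  assumes f: "f \<in> group_alg G" and X: "X \<subseteq> carrier G" and supp: "\<forall>x. f x \<noteq> 0 \<longrightarrow> (\<exists>y\<in>X. \<exists>z\<in>X. x = y \<otimes> inv z)"
    and x: "x \<in> carrier G" "x \<noteq> \<one>"
  shows "cmod (f x) \<le> norm (compression G X (dpow f)) * (1 / real (len x) ^ (p + 2))"
    and "cmod (f x) \<le> norm (compression G X (dpow f))"
proof -
  let ?M = "norm (compression G X (dpow f))"
  have 1: "real (len x) ^ (p + 2) * cmod (f x) \<le> ?M"
  proof (cases "f x = 0")
    case False
    then obtain y z where yz: "y \<in> X" "z \<in> X" "x = y \<otimes> inv z" using supp by blast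
    have "cmod (dpow f x) \<le> ?M"
      unfolding yz(3) by (rule coeff_le_norm_compression[OF dpow_in[OF f] X yz(1,2)])
    then show ?thesis by (simp add: dpow_def norm_mult norm_power)
  qed simp
  have l: "1 \<le> real (len x) ^ (p + 2)" by (rule len_pow_ge_1[OF x])
  then have pos: "0 < real (len x) ^ (p + 2)" by linarith
  show "cmod (f x) \<le> ?M * (1 / real (len x) ^ (p + 2))"
    unfolding times_divide_eq_right mult_1_right pos_le_divide_eq[OF pos] by (subst mult.commute) (rule 1)
  have "1 * cmod (f x) \<le> real (len x) ^ (p + 2) * cmod (f x)" by (intro mult_right_mono l) simp
  with 1 show "cmod (f x) \<le> ?M" by simp
qed

text \<open>Up to length \<open>R\<close> the multiplier is small, beyond \<open>R\<close> the
  coefficients are; \<open>w \<one> = 0\<close> is required because the Lip-norm says nothing about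
  the coefficient at the unit. A sharp cut-off with \<open>\<eta> = 0\<close> yields the finite-rank
  approximation, and \<open>w = 1 - overlap K\<close> shows that the two maps of the bridge are
  almost inverse to each other.\<close>

lemma norm_multiplier_le:
  fixes w :: "'a \<Rightarrow> complex"
  assumes f: "f \<in> group_alg G" and X: "X \<subseteq> carrier G" and supp: "\<forall>x. f x \<noteq> 0 \<longrightarrow> (\<exists>y\<in>X. \<exists>z\<in>X. x = y \<otimes> inv z)"
    and w: "w \<one> = 0" "\<And>x. cmod (w x) \<le> 1" "\<forall>x\<in>carrier G. len x \<le> R \<longrightarrow> cmod (w x) \<le> \<eta>"
    and tail: "tail_bound R \<epsilon>"
  shows "norm (compression G X (\<lambda>x. w x * f x)) \<le> (\<eta> * card (Bal (real R)) + \<epsilon>) * norm (compression G X (dpow f))"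
proof -
  let ?M = "norm (compression G X (dpow f))"
  let ?D = "{x. w x * f x \<noteq> 0}"
  define D1 D2 where "D1 = {x \<in> ?D. len x \<le> R}" and "D2 = {x \<in> ?D. len x > R}"
  have D: "finite ?D" "?D \<subseteq> carrier G" using group_alg_mult[OF f, of w] by (auto simp: group_alg_def)
  have "D1 \<subseteq> ?D" "D2 \<subseteq> ?D" by (auto simp: D1_def D2_def)
  then have "finite D1" "finite D2" using D(1) finite_subset by blast+
  moreover have "D1 \<union> D2 = ?D" "D1 \<inter> D2 = {}" "D1 \<subseteq> Bal (real R)" "D2 \<subseteq> carrier G"
    using D by (auto simp: D1_def D2_def mem_Bal)
  ultimately have D12: "D1 \<union> D2 = ?D" "D1 \<inter> D2 = {}" "finite D1" "finite D2" "D1 \<subseteq> Bal (real R)" "D2 \<subseteq> carrier G"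
    by blast+
  have ne: "x \<in> carrier G" "x \<noteq> \<one>" if "x \<in> ?D" for x using that D w(1) by auto
  note c = coeff_le_norm_dpow[OF f X supp]
  have \<eta>: "0 \<le> \<eta>" using w(3)[rule_format, OF one_closed] w(1) by (simp add: len_one)
  have "norm (compression G X (\<lambda>x. w x * f x)) \<le> (\<Sum>x\<in>?D. cmod (w x * f x))"
    by (rule norm_compression_le[OF group_alg_mult[OF f]])
  also have "\<dots> = (\<Sum>x\<in>D1. cmod (w x * f x)) + (\<Sum>x\<in>D2. cmod (w x * f x))"
    unfolding D12(1)[symmetric] by (rule sum.union_disjoint[OF D12(3,4,2)])
  also have "\<dots> \<le> (\<Sum>x\<in>D1. \<eta> * ?M) + (\<Sum>x\<in>D2. 1 * (?M * (1 / real (len x) ^ (p + 2))))"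
    unfolding norm_mult
    by (intro add_mono sum_mono mult_mono w(2) w(3)[rule_format] c ne) (auto simp: D1_def D2_def \<eta> dest: ne(1))
  also have "\<dots> = card D1 * (\<eta> * ?M) + ?M * (\<Sum>x\<in>D2. 1 / real (len x) ^ (p + 2))"
    by (simp add: sum_distrib_left)
  also have "\<dots> \<le> card (Bal (real R)) * (\<eta> * ?M) + ?M * \<epsilon>"
    using D12 finite_Bal \<eta> by (intro add_mono mult_right_mono mult_left_mono tail_boundD[OF tail]) (auto simp: card_mono D2_def)
  also have "\<dots> = (\<eta> * card (Bal (real R)) + \<epsilon>) * ?M" by (simp add: algebra_simps)
  finally show ?thesis .
qed

section \<open>Lip-norms on compressions of the group algebra\<close>

lemma compression_ball_sum:
  assumes f: "f \<in> group_alg G" and X: "X \<subseteq> carrier G"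
  shows "compression G X (\<lambda>x. if len x \<le> R then f x else 0)
    = (\<Sum>x\<in>Bal (real R). f x *\<^sub>C compression G X (\<lambda>z. if z = x then 1 else 0))"
proof (rule op_eqI)
  have B: "x \<in> carrier G" if "x \<in> Bal (real R)" for x using that by (simp add: mem_Bal)
  show "clinear_op (compression G X (\<lambda>x. if len x \<le> R then f x else 0))"
    by (intro clinear_compression group_alg_restrict f)
  show "clinear_op (\<Sum>x\<in>Bal (real R). f x *\<^sub>C compression G X (\<lambda>z. if z = x then 1 else 0))"
    by (intro clinear_op_sum clinear_op_scaleC clinear_compression group_alg_single B)
  fix a b
  have "entry (\<Sum>x\<in>Bal (real R). f x *\<^sub>C compression G X (\<lambda>z. if z = x then 1 else 0)) a b
      = (\<Sum>x\<in>Bal (real R). f x * (if a \<in> X \<and> b \<in> X then (if a \<otimes> inv b = x then 1 else 0) else 0))"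
    unfolding entry_sum entry_scaleC
    by (intro sum.cong refl) (simp add: entry_compression[OF group_alg_single X] B)
  also have "\<dots> = (if a \<in> X \<and> b \<in> X then (if a \<otimes> inv b \<in> Bal (real R) then f (a \<otimes> inv b) else 0) else 0)"
    by (cases "a \<in> X \<and> b \<in> X") (auto simp: finite_Bal if_distrib[of "\<lambda>z. _ * z"] cong: if_cong)
  also have "\<dots> = entry (compression G X (\<lambda>x. if len x \<le> R then f x else 0)) a b"
    using X by (auto simp: entry_compression[OF group_alg_restrict[OF f] X] mem_Bal subset_iff)
  finally show "entry (compression G X (\<lambda>x. if len x \<le> R then f x else 0)) a b
    = entry (\<Sum>x\<in>Bal (real R). f x *\<^sub>C compression G X (\<lambda>z. if z = x then 1 else 0)) a b" ..
qed

lemma dpow_add: "dpow (\<lambda>x. f x + g x) = (\<lambda>x. dpow f x + dpow g x)"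
  and dpow_mult: "dpow (\<lambda>x. m x * f x) = (\<lambda>x. m x * dpow f x)"
  by (auto simp: dpow_def algebra_simps)

text \<open>\<open>X\<close> and \<open>N\<close> are kept general, with \<open>N\<close> prescribed
  on compressions only, so as to cover the group algebra and the truncations, whose seminorms are
  defined by different formulas.\<close>

lemma lip_system_compression:
  assumes X: "X \<subseteq> carrier G" and N0: "\<And>T. 0 \<le> N T"
    and N: "\<And>f. f \<in> group_alg G \<Longrightarrow> N (compression G X f) = norm (compression G X (dpow f))"
  shows "lip_system (proj_op X) (compression G X ` group_alg G) N"
proof -
  interpret O: op_sys "proj_op X" "compression G X ` group_alg G" by (rule op_sys_compression[OF X])
  show ?thesis
  proof
    show "0 \<le> N T" for T by (rule N0)
  next
    fix a b assume "a \<in> compression G X ` group_alg G" "b \<in> compression G X ` group_alg G"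
    then obtain f g where fg: "f \<in> group_alg G" "g \<in> group_alg G" "a = compression G X f" "b = compression G X g"
      by blast
    have "N (a + b) = norm (compression G X (dpow f) + compression G X (dpow g))"
      unfolding fg(3,4) compression_add[OF fg(1,2) X, symmetric] N[OF group_alg_add[OF fg(1,2)]] dpow_add
      by (simp only: compression_add[OF dpow_in[OF fg(1)] dpow_in[OF fg(2)] X])
    then show "N (a + b) \<le> N a + N b" unfolding fg(3,4) N[OF fg(1)] N[OF fg(2)] by (simp add: norm_triangle_ineq)
  next
    fix a c assume "a \<in> compression G X ` group_alg G"
    then obtain f where f: "f \<in> group_alg G" "a = compression G X f" by blast
    show "N (c *\<^sub>C a) = cmod c * N a"
      unfolding f(2) compression_scaleC[OF f(1) X, symmetric] N[OF group_alg_mult[OF f(1)]] dpow_mult N[OF f(1)]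
      by (simp only: compression_scaleC[OF dpow_in[OF f(1)] X] norm_scaleC_blinfun)
  next
    fix a assume "a \<in> compression G X ` group_alg G"
    then obtain f where f: "f \<in> group_alg G" "a = compression G X f" by blast
    \<comment> \<open>The derivation commutes with the involution because an element and its inverse
      have equal length.\<close>
    have "dpow (\<lambda>x. if x \<in> carrier G then cnj (f (inv x)) else 0)
        = (\<lambda>x. if x \<in> carrier G then cnj (dpow f (inv x)) else 0)"
      by (auto simp: dpow_def len_inv)
    then have "N (adj a) = norm (adj (compression G X (dpow f)))"
      unfolding f(2) adj_compression[OF f(1) X] adj_compression[OF dpow_in[OF f(1)] X] N[OF group_alg_star[OF f(1)]]
      by simp
    also have "\<dots> = N a" unfolding f(2) N[OF f(1)] by (intro O.norm_adj imageI dpow_in f)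
    finally show "N (adj a) = N a" .
  next
    fix a assume a: "a \<in> compression G X ` group_alg G" and 0: "N a = 0"
    obtain f where f: "f \<in> group_alg G" "a = compression G X f"
      and supp: "\<forall>x. f x \<noteq> 0 \<longrightarrow> (\<exists>y\<in>X. \<exists>z\<in>X. x = y \<otimes> inv z)" by (rule compression_supported[OF a X])
    define c where "c = f \<one>"
    have "f x = c * (if x = \<one> then 1 else 0)" for x
    proof (cases "x \<in> carrier G \<and> x \<noteq> \<one>")
      case True
      have "norm (compression G X (dpow f)) = 0" using 0 unfolding f(2) N[OF f(1)] .
      then have "cmod (f x) \<le> 0"
        using True coeff_le_norm_dpow(2)[OF f(1) X supp, of x] by (elim conjE) simp
      then show ?thesis using True by simp
    next
      case False
      then have "x = \<one> \<or> f x = 0" using f(1) unfolding group_alg_def by blast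
      then show ?thesis by (auto simp: c_def)
    qed
    then have "f = (\<lambda>x. c * (if x = \<one> then 1 else 0))" by (rule ext)
    then have "a = compression G X (\<lambda>x. c * (if x = \<one> then 1 else 0))"
      unfolding f(2) by (rule arg_cong)
    also have "\<dots> = c *\<^sub>C proj_op X"
      by (simp only: compression_scaleC[OF group_alg_single[OF one_closed] X] compression_one[OF X])
    finally show "\<exists>c. a = c *\<^sub>C proj_op X" ..
  next
    have z: "(\<lambda>_. 0) \<in> group_alg G" by (simp add: group_alg_def)
    have "dpow (\<lambda>z. if z = \<one> then 1 else 0) = (\<lambda>_. 0 * 0)" by (auto simp: dpow_def len_one)
    then have "N (compression G X (\<lambda>z. if z = \<one> then 1 else 0)) = norm (compression G X (\<lambda>_. 0 * 0))"
      by (simp only: N[OF group_alg_single[OF one_closed]])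
    also have "compression G X (\<lambda>_. 0 * 0) = 0"
      unfolding compression_scaleC[OF z X, of 0] by (rule scaleC_blinfun_simps)
    also have "norm \<dots> = 0" by simp
    finally show "N (proj_op X) = 0" by (simp add: compression_one[OF X])
  next
    fix T a r
    assume T: "\<And>n::nat. T n \<in> compression G X ` group_alg G" and a: "a \<in> compression G X ` group_alg G"
      and lim: "T \<longlonglongrightarrow> a" and r: "\<And>n. N (T n) \<le> r"
    have "\<forall>n. \<exists>f. f \<in> group_alg G \<and> T n = compression G X f" using T by blast
    then obtain g where g: "\<And>n. g n \<in> group_alg G" "\<And>n. T n = compression G X (g n)" by metis
    obtain f where f: "f \<in> group_alg G" "a = compression G X f" using a by blast
    have r0: "0 \<le> r" using N0[of "T 0"] r[of 0] by linarith
    \<comment> \<open>The derivation may be unbounded, so norm convergence is used only through the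
      entries, each of which is multiplied by a fixed number. Bounds on finite forms then survive
      the limit.\<close>
    have ent: "(\<lambda>n. entry (compression G X (dpow (g n))) x y) \<longlonglongrightarrow> entry (compression G X (dpow f)) x y" for x y
    proof (cases "x \<in> X \<and> y \<in> X")
      case True
      have "(\<lambda>n. cmod (entry (T n - a) x y)) \<longlonglongrightarrow> 0"
        by (rule tendsto_sandwich[of "\<lambda>_. 0" _ _ "\<lambda>n. norm (T n - a)"])
          (use lim in \<open>auto simp: entry_bound tendsto_norm_zero LIM_zero\<close>)
      then have "(\<lambda>n. entry (T n) x y) \<longlonglongrightarrow> entry a x y"
        by (simp add: entry_diff tendsto_norm_zero_iff LIM_zero_iff)
      then have "(\<lambda>n. g n (x \<otimes> inv y)) \<longlonglongrightarrow> f (x \<otimes> inv y)"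
        using True by (simp add: g f entry_compression X)
      then show ?thesis
        using True by (simp add: entry_compression X dpow_in g f) (simp add: dpow_def tendsto_mult_left)
    qed (auto simp: entry_compression X dpow_in g f)
    have "norm (compression G X (dpow f)) \<le> r"
    proof (rule norm_le_form[OF clinear_compression[OF dpow_in[OF f(1)]] r0])
      fix Z :: "'a set" and u v assume Z: "finite Z"
      have "(\<lambda>n. form (compression G X (dpow (g n))) Z u v) \<longlonglongrightarrow> form (compression G X (dpow f)) Z u v"
        unfolding form_def by (intro tendsto_intros ent)
      then have "(\<lambda>n. cmod (form (compression G X (dpow (g n))) Z u v)) \<longlonglongrightarrow> cmod (form (compression G X (dpow f)) Z u v)"
        by (rule tendsto_norm)
      moreover have "cmod (form (compression G X (dpow (g n))) Z u v) \<le> r * (L2_set (\<lambda>x. cmod (u x)) Z * L2_set (\<lambda>x. cmod (v x)) Z)" for n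
        using r[of n] unfolding g(2) N[OF g(1)]
        by (intro order.trans[OF form_bound] clinear_compression dpow_in g Z mult_right_mono) auto
      ultimately show "cmod (form (compression G X (dpow f)) Z u v) \<le> r * (L2_set (\<lambda>x. cmod (u x)) Z * L2_set (\<lambda>x. cmod (v x)) Z)"
        by (intro LIMSEQ_le_const2) auto
    qed
    then show "N a \<le> r" by (simp add: f N)
  next
    fix \<epsilon> :: real assume "\<epsilon> > 0"
    then obtain R where R: "tail_bound R \<epsilon>"
      using tail_sum_small by blast
    define u where "u x = compression G X (\<lambda>z. if z = x then 1 else 0)" for x
    define B where "B = Bal (real R)"
    define F where "F = u ` B"
    have B: "finite B" "B \<subseteq> carrier G" "\<one> \<in> B" using finite_Bal by (auto simp: B_def mem_Bal len_one)
    have u: "u x \<in> compression G X ` group_alg G" if "x \<in> B" for x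
      unfolding u_def using that B by (intro imageI group_alg_single) auto
    have "\<exists>v\<in>compression G X ` group_alg G. norm (a - v) \<le> \<epsilon> * N a \<and>
        (\<forall>\<phi>. clin_fun (compression G X ` group_alg G) \<phi> \<longrightarrow>
          cmod (\<phi> v) \<le> norm a * cmod (\<phi> (proj_op X)) + card B * N a * (\<Sum>x\<in>F. cmod (\<phi> x)))"
      if a: "a \<in> compression G X ` group_alg G" for a
    proof -
      obtain f where f: "f \<in> group_alg G" "a = compression G X f"
        and supp: "\<forall>x. f x \<noteq> 0 \<longrightarrow> (\<exists>y\<in>X. \<exists>z\<in>X. x = y \<otimes> inv z)" by (rule compression_supported[OF a X])
      define v where "v = compression G X (\<lambda>x. if len x \<le> R then f x else 0)"
      \<comment> \<open>The multiplier of the part that the cut-off at length \<open>R\<close>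
        removes; it vanishes up to length \<open>R\<close>, so only the tail contributes to the
        error.\<close>
      define w :: "'a \<Rightarrow> complex" where "w x = (if len x \<le> R then 0 else 1)" for x
      have v: "v \<in> compression G X ` group_alg G" unfolding v_def by (intro imageI group_alg_restrict f)
      have "(\<lambda>x. f x - (if len x \<le> R then f x else 0)) = (\<lambda>x. w x * f x)" by (auto simp: w_def)
      then have "a - v = compression G X (\<lambda>x. w x * f x)"
        unfolding v_def f(2) by (simp only: compression_diff[OF f(1) group_alg_restrict[OF f(1)] X, symmetric])
      also have "norm \<dots> \<le> ((0::real) * card (Bal (real R)) + \<epsilon>) * norm (compression G X (dpow f))"
        by (rule norm_multiplier_le[OF f(1) X supp]) (auto simp: w_def len_one intro: R)
      finally have 1: "norm (a - v) \<le> \<epsilon> * N a" by (simp add: f N)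
      have "cmod (\<phi> v) \<le> norm a * cmod (\<phi> (proj_op X)) + card B * N a * (\<Sum>x\<in>F. cmod (\<phi> x))"
        if \<phi>: "clin_fun (compression G X ` group_alg G) \<phi>" for \<phi>
      proof -
        define \<Sigma> where "\<Sigma> = (\<Sum>x\<in>F. cmod (\<phi> x))"
        have \<Sigma>: "cmod (\<phi> (u x)) \<le> \<Sigma>" if "x \<in> B" for x
          unfolding \<Sigma>_def F_def using B(1) that by (intro member_le_sum) auto
        \<comment> \<open>The coefficient at the unit is a diagonal entry, hence bounded by the norm
          though not by the Lip-norm. For empty \<open>X\<close> there is no diagonal entry, but
          then the support condition makes this coefficient 0.\<close>
        have f1: "cmod (f \<one>) \<le> norm a"
        proof (cases "f \<one> = 0")
          case False
          then obtain y z where "y \<in> X" "z \<in> X" "\<one> = y \<otimes> inv z" using supp by blast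
          then show ?thesis using coeff_le_norm_compression[OF f(1) X, of y z] f(2) by simp
        qed simp
        have "v = (\<Sum>x\<in>B. f x *\<^sub>C u x)"
          unfolding v_def u_def B_def by (rule compression_ball_sum[OF f(1) X])
        then have "\<phi> v = (\<Sum>x\<in>B. \<phi> (f x *\<^sub>C u x))"
          using u by (simp add: O.clin_fun_sum[OF \<phi>] O.scaleC_in)
        also have "\<dots> = (\<Sum>x\<in>B. f x * \<phi> (u x))" using u by (simp add: O.clin_fun_scale[OF \<phi>])
        also have "\<dots> = f \<one> * \<phi> (proj_op X) + (\<Sum>x\<in>B - {\<one>}. f x * \<phi> (u x))"
          using B by (simp add: sum.remove[of B \<one>] u_def compression_one[OF X])
        finally have "cmod (\<phi> v) \<le> cmod (f \<one> * \<phi> (proj_op X)) + (\<Sum>x\<in>B - {\<one>}. cmod (f x * \<phi> (u x)))"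
          by (simp only:) (intro norm_triangle_mono order_refl norm_sum)
        also have "\<dots> \<le> norm a * cmod (\<phi> (proj_op X)) + (\<Sum>x\<in>B - {\<one>}. N a * \<Sigma>)"
          unfolding norm_mult using B
          by (intro add_mono sum_mono mult_mono mult_right_mono f1 \<Sigma>)
            (auto simp: f N intro!: coeff_le_norm_dpow(2)[OF f(1) X supp])
        also have "(\<Sum>x\<in>B - {\<one>}. N a * \<Sigma>) \<le> (\<Sum>x\<in>B. N a * \<Sigma>)"
          using B(1) by (intro sum_mono2) (auto simp: N0 \<Sigma>_def sum_nonneg)
        finally show ?thesis by (simp add: \<Sigma>_def mult.assoc)
      qed
      with v 1 show ?thesis by blast
    qed
    moreover have "finite F" "F \<subseteq> compression G X ` group_alg G" "0 \<le> real (card B)"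
      using B u by (auto simp: F_def)
    ultimately show "\<exists>F K. finite F \<and> F \<subseteq> compression G X ` group_alg G \<and> 0 \<le> K \<and>
      (\<forall>a\<in>compression G X ` group_alg G. \<exists>v\<in>compression G X ` group_alg G. norm (a - v) \<le> \<epsilon> * N a \<and>
        (\<forall>\<phi>. clin_fun (compression G X ` group_alg G) \<phi> \<longrightarrow>
          cmod (\<phi> v) \<le> norm a * cmod (\<phi> (proj_op X)) + K * N a * (\<Sum>x\<in>F. cmod (\<phi> x))))"
      by blast
  qed
qed

section \<open>The map \<open>\<sigma>\<close> and the bridge between the group algebra and a
  truncation\<close>

definition mult_overlap :: "'a set \<Rightarrow> 'a set \<Rightarrow> ('a ell2 \<Rightarrow>\<^sub>L 'a ell2) \<Rightarrow> ('a ell2 \<Rightarrow>\<^sub>L 'a ell2)" where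
  "mult_overlap K X T = left_reg G (\<lambda>x. complex_of_real (overlap K x) * inv_into (group_alg G) (compression G X) T x)"

text \<open>\<open>T\<close> determines the coefficients at the elements \<open>y z\<^sup>-\<^sup>1\<close> with \<open>y, z \<in> X\<close>; \<open>overlap K\<close> vanishes elsewhere.\<close>

lemma mult_overlap_compression:
  assumes f: "f \<in> group_alg G" and KX: "K \<subseteq> X" "X \<subseteq> carrier G"
  shows "mult_overlap K X (compression G X f) = left_reg G (\<lambda>x. complex_of_real (overlap K x) * f x)"
proof -
  define g where "g = inv_into (group_alg G) (compression G X) (compression G X f)"
  have "g \<in> group_alg G" unfolding g_def by (rule inv_into_into[OF imageI[OF f]])
  moreover have "compression G X g = compression G X f" unfolding g_def by (rule f_inv_into_f[OF imageI[OF f]])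
  ultimately have g: "g \<in> group_alg G" "compression G X g = compression G X f" .
  have "complex_of_real (overlap K x) * g x = complex_of_real (overlap K x) * f x" for x
  proof (cases "x \<in> carrier G \<and> overlap K x \<noteq> 0")
    case True
    then obtain y z where "y \<in> K" "z \<in> K" "x = y \<otimes> inv z" using overlap_nonzeroD[of K x] KX by blast
    then show ?thesis using compression_eqD[OF g(2) g(1) f KX(2), of y z] KX by auto
  next
    case False
    then have "overlap K x = 0 \<or> f x = 0 \<and> g x = 0" using f g(1) unfolding group_alg_def by blast
    then show ?thesis by auto
  qed
  then have "(\<lambda>x. complex_of_real (overlap K x) * g x) = (\<lambda>x. complex_of_real (overlap K x) * f x)" by (rule ext)
  then show ?thesis unfolding mult_overlap_def g_def[symmetric] by (rule arg_cong)
qed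

text \<open>\<open>X\<close> is tied to the constants only through \<open>K \<subseteq> X\<close>:
  the conditions on \<open>R\<close>, \<open>\<eta>\<close> and \<open>K\<close> do not mention it,
  which makes the estimate uniform over the truncations.\<close>

lemma bridge_compression:
  assumes \<epsilon>: "\<epsilon> > 0" and K: "K \<noteq> {}" "K \<subseteq> X" and X: "finite X" "X \<subseteq> carrier G"
    and NA: "\<And>T. 0 \<le> NA T" "\<And>f. f \<in> group_alg G \<Longrightarrow> NA (left_reg G f) = norm (left_reg G (dpow f))"
    and NB: "\<And>T. 0 \<le> NB T" "\<And>f. f \<in> group_alg G \<Longrightarrow> NB (compression G X f) = norm (compression G X (dpow f))"
    and tail: "tail_bound R (\<epsilon> / 2)"
    and \<eta>: "\<And>x. x \<in> carrier G \<Longrightarrow> len x \<le> R \<Longrightarrow> 1 - \<eta> \<le> overlap K x" "\<eta> * card (Bal (real R)) \<le> \<epsilon> / 2"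
  shows "lip_bridge (proj_op (carrier G)) (group_alg_op G) NA (proj_op X) (compression G X ` group_alg G) NB
    (\<lambda>T. proj_op X o\<^sub>L T o\<^sub>L proj_op X) (mult_overlap K X) \<epsilon>"
proof -
  have A: "group_alg_op G = compression G (carrier G) ` group_alg G"
    unfolding group_alg_op_def by (intro image_cong refl left_reg_eq_compression)
  have Kf: "finite K" "K \<subseteq> carrier G" using K X by (auto intro: finite_subset)
  let ?m = "\<lambda>f x. complex_of_real (overlap K x) * f x"
  let ?w = "\<lambda>x. 1 - complex_of_real (overlap K x)"
  note om = mult_overlap_compression[OF _ K(2) X(2)]
  have \<tau>: "proj_op X o\<^sub>L left_reg G f o\<^sub>L proj_op X = compression G X f" for f
    by (simp add: compression_def)
  have w: "?w \<one> = 0" "\<And>x. cmod (?w x) \<le> 1" "\<forall>x\<in>carrier G. len x \<le> R \<longrightarrow> cmod (?w x) \<le> \<eta>"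
  proof -
    have eq: "cmod (?w x) = 1 - overlap K x" for x
    proof -
      have "?w x = complex_of_real (1 - overlap K x)" by simp
      then show ?thesis using overlap_bounds[OF Kf(1), of x] by (simp only: norm_of_real abs_of_nonneg)
    qed
    show "?w \<one> = 0" by (simp add: overlap_one Kf K)
    show "cmod (?w x) \<le> 1" for x unfolding eq using overlap_bounds[OF Kf(1), of x] by simp
    show "\<forall>x\<in>carrier G. len x \<le> R \<longrightarrow> cmod (?w x) \<le> \<eta>"
    proof (intro ballI impI)
      fix x assume "x \<in> carrier G" "len x \<le> R"
      then show "cmod (?w x) \<le> \<eta>" unfolding eq using \<eta>(1)[of x] by simp
    qed
  qed
  \<comment> \<open>Needed with \<open>Y\<close> the whole group for
    \<open>\<sigma> \<circ> \<tau>\<close> and with \<open>Y = X\<close> for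
    \<open>\<tau> \<circ> \<sigma>\<close>.\<close>
  have est: "norm (compression G Y f - compression G Y (?m f)) \<le> \<epsilon> * norm (compression G Y (dpow f))"
    if f: "f \<in> group_alg G" and Y: "Y \<subseteq> carrier G" and supp: "\<forall>x. f x \<noteq> 0 \<longrightarrow> (\<exists>y\<in>Y. \<exists>z\<in>Y. x = y \<otimes> inv z)" for f Y
  proof -
    have "compression G Y f - compression G Y (?m f) = compression G Y (\<lambda>x. ?w x * f x)"
      unfolding compression_diff[OF f group_alg_mult[OF f] Y, symmetric] by (simp add: algebra_simps)
    also have "norm \<dots> \<le> (\<eta> * card (Bal (real R)) + \<epsilon> / 2) * norm (compression G Y (dpow f))"
      by (rule norm_multiplier_le[OF f Y supp w tail])
    also have "\<dots> \<le> \<epsilon> * norm (compression G Y (dpow f))"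
      using \<eta>(2) by (intro mult_right_mono) auto
    finally show ?thesis .
  qed
  \<comment> \<open>The multiplier is bounded by the compression to \<open>K\<close>, which is a
    further compression of the one to \<open>X\<close>.\<close>
  have contr: "norm (left_reg G (?m f)) \<le> norm (compression G X f)" if f: "f \<in> group_alg G" for f
  proof -
    have "norm (left_reg G (?m f)) \<le> norm (compression G K f)" by (rule norm_overlap_le[OF f Kf K(1)])
    also have "compression G K f = proj_op K o\<^sub>L compression G X f o\<^sub>L proj_op K"
      by (rule compression_idem[symmetric, OF K(2) X(2) f])
    also have "norm \<dots> \<le> norm (compression G X f)" by (rule norm_compress_le)
    finally show ?thesis .
  qed
  interpret SA: lip_system "proj_op (carrier G)" "group_alg_op G" NA
    unfolding A by (rule lip_system_compression) (auto simp: NA dpow_in simp flip: left_reg_eq_compression)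
  interpret SB: lip_system "proj_op X" "compression G X ` group_alg G" NB
    by (rule lip_system_compression[OF X(2) NB])
  have AE: thesis if "T \<in> group_alg_op G" "\<And>f. f \<in> group_alg G \<Longrightarrow> T = left_reg G f \<Longrightarrow> thesis" for T thesis
    using that by (auto simp: group_alg_op_def)
  have BE: thesis if "T \<in> compression G X ` group_alg G" "\<And>f. f \<in> group_alg G \<Longrightarrow> T = compression G X f \<Longrightarrow> thesis" for T thesis
    using that by auto
  show ?thesis
  proof
    show "0 < \<epsilon>" by (rule \<epsilon>)
    show "proj_op X o\<^sub>L a o\<^sub>L proj_op X \<in> compression G X ` group_alg G" if "a \<in> group_alg_op G" for a
      using that by (auto simp: group_alg_op_def \<tau>)
    show "proj_op X o\<^sub>L (a + a') o\<^sub>L proj_op X = (proj_op X o\<^sub>L a o\<^sub>L proj_op X) + (proj_op X o\<^sub>L a' o\<^sub>L proj_op X)" for a a'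
      by (rule blinfun_eqI) (simp add: blinfun.bilinear_simps)
    show "proj_op X o\<^sub>L (c *\<^sub>C a) o\<^sub>L proj_op X = c *\<^sub>C (proj_op X o\<^sub>L a o\<^sub>L proj_op X)" for c a
      by (rule blinfun_eqI) (simp add: clinear_opD[OF clinear_proj_op])
    show "proj_op X o\<^sub>L adj a o\<^sub>L proj_op X = adj (proj_op X o\<^sub>L a o\<^sub>L proj_op X)" if a: "a \<in> group_alg_op G" for a
      by (rule adj_eqI[symmetric]) (simp add: cinner_proj_op SA.adj_rel[OF a])
    show "proj_op X o\<^sub>L proj_op (carrier G) o\<^sub>L proj_op X = proj_op X"
      using X(2) by (intro blinfun_eqI) (auto simp: proj_op_apply fun_eq_iff simp flip: Rep_ell2_inject)
    show "norm (proj_op X o\<^sub>L a o\<^sub>L proj_op X) \<le> norm a" for a :: "'a ell2 \<Rightarrow>\<^sub>L 'a ell2" by (rule norm_compress_le)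
    show "positive_op (proj_op X o\<^sub>L a o\<^sub>L proj_op X)" if "positive_op a" for a :: "'a ell2 \<Rightarrow>\<^sub>L 'a ell2"
      by (rule positive_compress[OF that])
    show "NB (proj_op X o\<^sub>L a o\<^sub>L proj_op X) \<le> NA a" if "a \<in> group_alg_op G" for a
      using that
    proof (rule AE)
      fix f assume f: "f \<in> group_alg G" "a = left_reg G f"
      show ?thesis unfolding f(2) \<tau> NB(2)[OF f(1)] NA(2)[OF f(1)]
        unfolding compression_def by (rule norm_compress_le)
    qed
    show "mult_overlap K X b \<in> group_alg_op G" if "b \<in> compression G X ` group_alg G" for b
      using that by (auto simp: om group_alg_op_def group_alg_mult)
    show "mult_overlap K X (b + b') = mult_overlap K X b + mult_overlap K X b'"
      if "b \<in> compression G X ` group_alg G" "b' \<in> compression G X ` group_alg G" for b b'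
    proof -
      from that obtain f g where fg: "f \<in> group_alg G" "b = compression G X f" "g \<in> group_alg G" "b' = compression G X g"
        by blast
      have "?m (\<lambda>x. f x + g x) = (\<lambda>x. ?m f x + ?m g x)" by (simp add: algebra_simps)
      then show ?thesis
        unfolding fg compression_add[OF fg(1,3) X(2), symmetric] om[OF fg(1)] om[OF fg(3)] om[OF group_alg_add[OF fg(1,3)]]
        by (simp only: left_reg_eq_compression group_alg_mult group_alg_add fg compression_add subset_refl)
    qed
    show "mult_overlap K X (c *\<^sub>C b) = c *\<^sub>C mult_overlap K X b" if "b \<in> compression G X ` group_alg G" for b c
      using that
    proof (rule BE)
      fix f assume f: "f \<in> group_alg G" "b = compression G X f"
      have "?m (\<lambda>x. c * f x) = (\<lambda>x. c * ?m f x)" by (simp add: algebra_simps)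
      then show ?thesis
        unfolding f compression_scaleC[OF f(1) X(2), symmetric] om[OF f(1)] om[OF group_alg_mult[OF f(1)]]
        by (simp only: left_reg_eq_compression group_alg_mult f compression_scaleC subset_refl)
    qed
    show "mult_overlap K X (proj_op X) = proj_op (carrier G)"
    proof -
      let ?e = "\<lambda>z. if z = \<one> then 1 else 0 :: complex"
      have e: "?e \<in> group_alg G" by (intro group_alg_single one_closed)
      have "?m ?e = ?e" by (auto simp: overlap_one Kf K)
      then have "mult_overlap K X (compression G X ?e) = compression G (carrier G) ?e"
        by (simp only: om[OF e] left_reg_eq_compression[OF e])
      then show ?thesis by (simp only: compression_one X subset_refl)
    qed
    show "norm (mult_overlap K X b) \<le> norm b" if "b \<in> compression G X ` group_alg G" for b
      using that by (auto simp: om contr)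
    show "positive_op (mult_overlap K X b)" if "b \<in> compression G X ` group_alg G" "positive_op b" for b
      using that(1)
    proof (rule BE)
      fix f assume f: "f \<in> group_alg G" "b = compression G X f"
      have "positive_op (compression G K f)"
        using positive_compress[OF that(2), of K] by (simp add: f compression_idem[OF K(2) X(2)])
      then show ?thesis unfolding f om[OF f(1)] by (rule positive_overlap[OF f(1) Kf K(1)])
    qed
    show "NA (mult_overlap K X b) \<le> NB b" if "b \<in> compression G X ` group_alg G" for b
      using that
    proof (rule BE)
      fix f assume f: "f \<in> group_alg G" "b = compression G X f"
      show ?thesis unfolding f om[OF f(1)] NA(2)[OF group_alg_mult[OF f(1)]] NB(2)[OF f(1)] dpow_mult
        by (rule contr[OF dpow_in[OF f(1)]])
    qed
    show "norm (a - mult_overlap K X (proj_op X o\<^sub>L a o\<^sub>L proj_op X)) \<le> \<epsilon> * NA a" if "a \<in> group_alg_op G" for a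
      using that
    proof (rule AE)
      fix f assume f: "f \<in> group_alg G" "a = left_reg G f"
      have supp: "\<forall>x. f x \<noteq> 0 \<longrightarrow> (\<exists>y\<in>carrier G. \<exists>z\<in>carrier G. x = y \<otimes> inv z)"
      proof (intro allI impI)
        fix x assume "f x \<noteq> 0"
        then have "x \<in> carrier G" using f(1) unfolding group_alg_def by blast
        then show "\<exists>y\<in>carrier G. \<exists>z\<in>carrier G. x = y \<otimes> inv z"
          by (intro bexI[of _ x] bexI[of _ \<one>]) auto
      qed
      show ?thesis
        using est[OF f(1) subset_refl supp]
        unfolding f(2) \<tau> om[OF f(1)] NA(2)[OF f(1)]
        by (simp only: left_reg_eq_compression f(1) group_alg_mult dpow_in)
    qed
    show "norm (b - (proj_op X o\<^sub>L mult_overlap K X b o\<^sub>L proj_op X)) \<le> \<epsilon> * NB b"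
      if b: "b \<in> compression G X ` group_alg G" for b
    proof -
      obtain f where f: "f \<in> group_alg G" "b = compression G X f"
        and supp: "\<forall>x. f x \<noteq> 0 \<longrightarrow> (\<exists>y\<in>X. \<exists>z\<in>X. x = y \<otimes> inv z)" by (rule compression_supported[OF b X(2)])
      show ?thesis unfolding f(2) om[OF f(1)] \<tau> NB(2)[OF f(1)] by (rule est[OF f(1) X(2) supp])
    qed
  qed
qed

section \<open>The seminorms of the statement in terms of coefficients\<close>

definition N_full :: "('a ell2 \<Rightarrow>\<^sub>L 'a ell2) \<Rightarrow> real" where
  "N_full T = norm (left_reg G ((d_map G S ^^ (p + 2)) (inv_into (group_alg G) (left_reg G) T)))"

definition N_trunc :: "real \<Rightarrow> ('a ell2 \<Rightarrow>\<^sub>L 'a ell2) \<Rightarrow> real" where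
  "N_trunc \<Lambda> T = norm ((d_trunc G S \<Lambda> ^^ (p + 2)) T)"

lemma L_full_eq: "L_full G S (p + 2) = (\<lambda>T. ennreal (N_full T))"
  and L_trunc_eq: "L_trunc G S (p + 2) \<Lambda> = (\<lambda>T. ennreal (N_trunc \<Lambda> T))"
  by (rule ext, simp only: L_full_def N_full_def, rule ext, simp only: L_trunc_def N_trunc_def)

lemma d_map_pow: "(d_map G S ^^ n) f = (\<lambda>x. of_nat (len x) ^ n * f x)"
  by (induction n) (auto simp: d_map_def mult_ac)

text \<open>The column at the unit lists all coefficients.\<close>

lemma inj_left_reg: "inj_on (left_reg G) (group_alg G)"
proof (rule inj_onI)
  fix f g assume fg: "f \<in> group_alg G" "g \<in> group_alg G" "left_reg G f = left_reg G g"
  show "f = g"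
  proof
    fix x
    show "f x = g x"
    proof (cases "x \<in> carrier G")
      case True
      then show ?thesis using entry_left_reg_if[OF fg(1), of x \<one>] entry_left_reg_if[OF fg(2), of x \<one>] fg(3) by simp
    next
      case False
      then have "f x = 0" "g x = 0" using fg(1,2) unfolding group_alg_def by blast+
      then show ?thesis by simp
    qed
  qed
qed

lemma N_full_left_reg: "f \<in> group_alg G \<Longrightarrow> N_full (left_reg G f) = norm (left_reg G (dpow f))"
  by (simp only: N_full_def inv_into_f_f[OF inj_left_reg] d_map_pow dpow_def)

lemma Bal_carrier: "Bal \<Lambda> \<subseteq> carrier G"
  by (auto simp: mem_Bal)

text \<open>The weight depends on \<open>x \<otimes> inv y\<close> only, so weighting the entries of
  a compression amounts to weighting the coefficients.\<close>

lemma d_trunc_compression: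
  assumes f: "f \<in> group_alg G"
  shows "d_trunc G S \<Lambda> (compression G (Bal \<Lambda>) f) = compression G (Bal \<Lambda>) (d_map G S f)"
proof (rule op_eqI)
  have df: "d_map G S f \<in> group_alg G" unfolding d_map_def by (rule group_alg_mult[OF f])
  show "clinear_op (compression G (Bal \<Lambda>) (d_map G S f))" by (rule clinear_compression[OF df])
  show "clinear_op (d_trunc G S \<Lambda> (compression G (Bal \<Lambda>) f))"
    unfolding d_trunc_def by (intro clinear_op_sum clinear_op_scaleC clinear_matrix_unit)
  fix a b
  let ?c = "\<lambda>x y. of_nat (len (x \<otimes> inv y)) * entry (compression G (Bal \<Lambda>) f) x y"
  have "entry (d_trunc G S \<Lambda> (compression G (Bal \<Lambda>) f)) a b
      = (\<Sum>x\<in>Bal \<Lambda>. \<Sum>y\<in>Bal \<Lambda>. ?c x y * (if a = x \<and> b = y then 1 else 0))"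
    unfolding d_trunc_def by (simp only: entry_sum entry_scaleC entry_matrix_unit)
  also have "\<dots> = (\<Sum>x\<in>Bal \<Lambda>. if a = x then (\<Sum>y\<in>Bal \<Lambda>. if b = y then ?c x y else 0) else 0)"
    by (intro sum.cong refl) (auto intro!: sum.cong sum.neutral)
  also have "\<dots> = (if a \<in> Bal \<Lambda> \<and> b \<in> Bal \<Lambda> then ?c a b else 0)"
    by (simp add: finite_Bal)
  also have "\<dots> = entry (compression G (Bal \<Lambda>) (d_map G S f)) a b"
    unfolding entry_compression[OF f Bal_carrier] entry_compression[OF df Bal_carrier] by (simp add: d_map_def)
  finally show "entry (d_trunc G S \<Lambda> (compression G (Bal \<Lambda>) f)) a b = entry (compression G (Bal \<Lambda>) (d_map G S f)) a b" .
qed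

lemma N_trunc_compression:
  assumes f: "f \<in> group_alg G"
  shows "N_trunc \<Lambda> (compression G (Bal \<Lambda>) f) = norm (compression G (Bal \<Lambda>) (dpow f))"
proof -
  have "(d_trunc G S \<Lambda> ^^ n) (compression G (Bal \<Lambda>) f) = compression G (Bal \<Lambda>) ((d_map G S ^^ n) f)" for n
  proof (induction n)
    case (Suc n)
    have "(d_map G S ^^ n) f \<in> group_alg G" unfolding d_map_pow by (rule group_alg_mult[OF f])
    then show ?case using Suc by (simp add: d_trunc_compression)
  qed simp
  then show ?thesis by (simp only: N_trunc_def d_map_pow dpow_def)
qed

lemma truncation_eq: "truncation G S \<Lambda> = compression G (Bal \<Lambda>) ` group_alg G"
  by (simp add: truncation_def compression_def P_op_def)

lemma lip_system_full: "lip_system (proj_op (carrier G)) (group_alg_op G) N_full"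
proof -
  have "group_alg_op G = compression G (carrier G) ` group_alg G"
    unfolding group_alg_op_def by (intro image_cong refl left_reg_eq_compression)
  moreover have "lip_system (proj_op (carrier G)) (compression G (carrier G) ` group_alg G) N_full"
    by (rule lip_system_compression)
      (auto simp: N_full_left_reg dpow_in simp flip: left_reg_eq_compression, simp add: N_full_def)
  ultimately show ?thesis by simp
qed

lemma lip_system_trunc: "lip_system (P_op G S \<Lambda>) (truncation G S \<Lambda>) (N_trunc \<Lambda>)"
  unfolding truncation_eq P_op_def
  by (rule lip_system_compression[OF Bal_carrier]) (simp_all add: N_trunc_compression, simp add: N_trunc_def)

text \<open>The order of choices matters: \<open>R\<close> depends on \<open>\<epsilon>\<close>,
  then \<open>\<eta>\<close> on \<open>\<epsilon>\<close> and the size of the ball of radius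
  \<open>R\<close>, then \<open>r\<close> on \<open>\<eta>\<close> and \<open>R\<close>; all precede
  \<open>\<Lambda>\<close>.\<close>

lemma dist_q_truncation_le:
  assumes \<epsilon>: "\<epsilon> > 0"
  shows "\<exists>r::nat. \<forall>\<Lambda>\<ge>real r. dist_q (proj_op (carrier G)) (group_alg_op G) (L_full G S (p + 2))
    (P_op G S \<Lambda>) (truncation G S \<Lambda>) (L_trunc G S (p + 2) \<Lambda>) \<le> ennreal (2 * \<epsilon>)"
proof -
  obtain R where R: "tail_bound R (\<epsilon> / 2)"
    using tail_sum_small[of "\<epsilon> / 2"] \<epsilon> by auto
  define c where "c = real (card (Bal (real R)))"
  \<comment> \<open>The second term keeps the contribution of the ball below
    \<open>\<epsilon> / 2\<close>, the other half being spent on the tail; the bound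
    \<open>1 / 2\<close> ensures \<open>\<eta> < 1\<close>, as \<open>folner_ball\<close>
    requires.\<close>
  define \<eta> where "\<eta> = min (1 / 2) (\<epsilon> / (2 * (c + 1)))"
  have c: "0 \<le> c" by (simp add: c_def)
  have \<eta>: "0 < \<eta>" "\<eta> < 1" using \<epsilon> c by (auto simp: \<eta>_def)
  have "\<eta> * c \<le> \<epsilon> / (2 * (c + 1)) * (c + 1)" using \<epsilon> c by (intro mult_mono) (auto simp: \<eta>_def)
  also have "\<dots> = \<epsilon> / 2" using c by (simp add: divide_simps)
  finally have \<eta>c: "\<eta> * card (Bal (real R)) \<le> \<epsilon> / 2" by (simp add: c_def)
  obtain r :: nat where r: "\<And>x. x \<in> carrier G \<Longrightarrow> len x \<le> R \<Longrightarrow>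
      (1 - \<eta>) * card (Bal (real r)) \<le> card {y \<in> Bal (real r). x \<otimes> y \<in> Bal (real r)}"
    using folner_ball[OF \<eta>, of R] by blast
  have ne: "Bal (real r) \<noteq> {}" using one_in_Bal[of "real r"] by auto
  have cp: "0 < real (card (Bal (real r)))" using ne finite_Bal by (simp add: card_gt_0_iff)
  have ov: "1 - \<eta> \<le> overlap (Bal (real r)) x" if "x \<in> carrier G" "len x \<le> R" for x
    unfolding overlap_def using r[OF that] cp by (simp add: pos_le_divide_eq)
  show ?thesis
  proof (intro exI allI impI)
    fix \<Lambda> :: real assume "real r \<le> \<Lambda>"
    then have sub: "Bal (real r) \<subseteq> Bal \<Lambda>" by (auto simp: mem_Bal)
    interpret lip_bridge "proj_op (carrier G)" "group_alg_op G" N_full "proj_op (Bal \<Lambda>)"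
      "compression G (Bal \<Lambda>) ` group_alg G" "N_trunc \<Lambda>" "\<lambda>T. proj_op (Bal \<Lambda>) o\<^sub>L T o\<^sub>L proj_op (Bal \<Lambda>)"
      "mult_overlap (Bal (real r)) (Bal \<Lambda>)" \<epsilon>
      by (rule bridge_compression[OF \<epsilon> ne sub finite_Bal Bal_carrier _ N_full_left_reg _ N_trunc_compression R ov \<eta>c])
        (simp_all add: N_full_def N_trunc_def)
    show "dist_q (proj_op (carrier G)) (group_alg_op G) (L_full G S (p + 2))
      (P_op G S \<Lambda>) (truncation G S \<Lambda>) (L_trunc G S (p + 2) \<Lambda>) \<le> ennreal (2 * \<epsilon>)"
      unfolding L_full_eq L_trunc_eq truncation_eq P_op_def by (rule dist_q_le)
  qed
qed

lemma dist_q_truncation_tendsto: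
  "((\<lambda>\<Lambda>::real. dist_q (proj_op (carrier G)) (group_alg_op G) (L_full G S (p + 2))
      (P_op G S \<Lambda>) (truncation G S \<Lambda>) (L_trunc G S (p + 2) \<Lambda>)) \<longlongrightarrow> 0) at_top"
proof (rule order_tendstoI)
  fix a :: ennreal assume "0 < a"
  \<comment> \<open>The target \<open>a\<close> may be infinite; an intermediate \<open>b\<close> is
    finite and still positive.\<close>
  then obtain b where b: "0 < b" "b < a" using dense by blast
  then obtain t where t: "b = ennreal t" "t > 0" by (cases b) auto
  obtain r :: nat where r: "\<And>\<Lambda>. \<Lambda> \<ge> real r \<Longrightarrow> dist_q (proj_op (carrier G)) (group_alg_op G) (L_full G S (p + 2))
    (P_op G S \<Lambda>) (truncation G S \<Lambda>) (L_trunc G S (p + 2) \<Lambda>) \<le> ennreal (2 * (t / 2))"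
    using dist_q_truncation_le[of "t / 2"] t(2) by auto
  show "\<forall>\<^sub>F \<Lambda> in at_top. dist_q (proj_op (carrier G)) (group_alg_op G) (L_full G S (p + 2))
      (P_op G S \<Lambda>) (truncation G S \<Lambda>) (L_trunc G S (p + 2) \<Lambda>) < a"
    using eventually_ge_at_top[of "real r"]
  proof eventually_elim
    case (elim \<Lambda>)
    from r[OF this] b(2) show ?case by (simp add: t(1))
  qed
qed simp

end

theorem theorem1p1:
  fixes G :: "('a, 'm) monoid_scheme" (structure) and S :: "'a set"
  assumes "group G"
    and "finite S" and "S \<subseteq> carrier G" and "(\<lambda>x. inv x) ` S = S" and "generate G S = carrier G"
    and "polynomial_growth G S"
  shows "\<exists>s::nat. s > 0 \<and>
    compact_quantum_metric_space (proj_op (carrier G)) (group_alg_op G) (L_full G S s) \<and>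
    (\<forall>\<Lambda>>0. compact_quantum_metric_space (P_op G S \<Lambda>) (truncation G S \<Lambda>) (L_trunc G S s \<Lambda>)) \<and>
    ((\<lambda>\<Lambda>::real. dist_q (proj_op (carrier G)) (group_alg_op G) (L_full G S s)
                       (P_op G S \<Lambda>) (truncation G S \<Lambda>) (L_trunc G S s \<Lambda>)) \<longlongrightarrow> 0) at_top"
proof -
  obtain C :: real and p :: nat where Cp: "C > 0" "p > 0"
    "\<And>n. n \<ge> 1 \<Longrightarrow> real (card (word_ball G S (real n))) \<le> C * real n ^ p"
    using polynomial_growthE[OF assms(6)] by blast
  interpret group G by (rule assms(1))
  interpret poly_group G S C p
    by standard (use assms Cp in auto)
  show ?thesis
  proof (intro exI[of _ "p + 2"] conjI allI impI)
    show "compact_quantum_metric_space (proj_op (carrier G)) (group_alg_op G) (L_full G S (p + 2))"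
      unfolding L_full_eq by (rule lip_system.compact_quantum_metric_space[OF lip_system_full])
    show "compact_quantum_metric_space (P_op G S \<Lambda>) (truncation G S \<Lambda>) (L_trunc G S (p + 2) \<Lambda>)" for \<Lambda>
      unfolding L_trunc_eq by (rule lip_system.compact_quantum_metric_space[OF lip_system_trunc])
  qed (simp, rule dist_q_truncation_tendsto)
qed

end
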